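(* Let $1\le n<N$ and let $\mathbf{H}_N$ be the real vector space of Hermitian $N\times N$ matrices. For almost every pair $(A,B)\in\mathbf{H}_N\times\mathbf{H}_N$ with $B\prec0$ (with respect to Lebesgue measure on $\mathbf{H}_N\times\mathbf{H}_N$), the following holds: the matrix $A+B$ has a density matrix $P$, and for almost every initial guess $P^{(0)}\in\mathcal{D}$ the fixed point iteration $P^{(k+1)}=\mathfrak{F}(P^{(k)})$ converges to $P$, i.e. $\lim_{k\to\infty}P^{(k)}=P$.
   Context: $\mathcal{D}$ is the set of rank-$n$ orthogonal projectors in $\mathbb{C}^{N\times N}$, a smooth compact submanifold (identified with the Grassmannian $\mathbf{Gr}(n,\mathbb{C}^N)$); "almost every" in $\mathcal{D}$ is with respect to the natural notion of measure zero on a smooth manifold (Lebesgue measure zero in charts, equivalently zero volume for any Riemannian metric). For a Hermitian matrix $H$, $\lambda_i\{H\}$ is its $i$-th smallest eigenvalue (with multiplicity); if $\lambda_{n}\{H\}<\lambda_{n+1}\{H\}$, the density matrix associated with $H$ is the orthogonal projector onto the span of the eigenvectors of $H$ for its $n$ lowest eigenvalues (this strict gap holds for $A+B$ for almost every pair $(A,B)$). For $Q\in\mathcal{D}$ the adaptive compression of $B\prec0$ is $\underline{B}[Q]=B(QBQ)^\dagger B$ ($\dagger$ is the Moore–Penrose pseudoinverse); equivalently $\underline{B}[Q]=BV(V^*BV)^{-1}V^*B$ for any $N\times n$ matrix $V$ with orthonormal columns and $Q=VV^*$. Fixed point map $\mathfrak{F}:\mathcal{D}\to\mathcal{D}$: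 $\mathfrak{F}(Q)=\sum_{i=1}^n u_iu_i^*$ where $u_1,\dots,u_n$ are orthonormal with $(A+\underline{B}[Q])u_i=\lambda_i\{A+\underline{B}[Q]\}u_i$. If $A+\underline{B}[Q]$ has a positive gap between its $n$-th and $(n+1)$-th eigenvalues this is the unique density matrix associated with $A+\underline{B}[Q]$; otherwise an arbitrary (fixed) choice is made within the eigenspace of the $n$-th eigenvalue. *)

theory Defs
  imports "HOL-Analysis.Analysis" "HOL-Library.Multiset"
begin

definition cdot :: "complex^'N \<Rightarrow> complex^'N \<Rightarrow> complex" where
  "cdot v w = (\<Sum>i\<in>UNIV. cnj (v $ i) * w $ i)"

definition ctranspose :: "complex^'N^'M \<Rightarrow> complex^'M^'N" where
  "ctranspose A = (\<chi> i j. cnj (A $ j $ i))"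

definition outer :: "complex^'N \<Rightarrow> complex^'N \<Rightarrow> complex^'N^'N" where
  "outer v w = (\<chi> i j. v $ i * cnj (w $ j))"

definition hermitian :: "complex^'N^'N \<Rightarrow> bool" where
  "hermitian A \<longleftrightarrow> ctranspose A = A"

definition neg_def :: "complex^'N^'N \<Rightarrow> bool" where
  "neg_def A \<longleftrightarrow> hermitian A \<and> (\<forall>v. v \<noteq> 0 \<longrightarrow> Re (cdot v (A *v v)) < 0)"

definition orth_projector :: "complex^'N^'N \<Rightarrow> bool" where
  "orth_projector Q \<longleftrightarrow> hermitian Q \<and> Q ** Q = Q"

definition projectors :: "nat \<Rightarrow> (complex^'N^'N) set" where
  "projectors n = {Q. orth_projector Q \<and> rank Q = n}"

definition pinv :: "complex^'N^'N \<Rightarrow> complex^'N^'N" where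
  "pinv A = (THE X. A ** X ** A = A \<and> X ** A ** X = X \<and> hermitian (A ** X) \<and> hermitian (X ** A))"

definition eigenspace :: "complex^'N^'N \<Rightarrow> real \<Rightarrow> (complex^'N) set" where
  "eigenspace H \<mu> = {v. H *v v = complex_of_real \<mu> *s v}"

text \<open>For Hermitian \<open>H\<close> all eigenvalues are real, and their multiplicity is the complex
  dimension of the eigenspace.\<close>

definition eigenvalues :: "complex^'N^'N \<Rightarrow> real multiset" where
  "eigenvalues H =
     (\<Sum>\<mu>\<in>{\<mu>. eigenspace H \<mu> \<noteq> {0}}. replicate_mset (vec.dim (eigenspace H \<mu>)) \<mu>)"

text \<open>The \<open>i\<close>-th smallest eigenvalue with multiplicity; indices run from 1 to \<open>CARD('N)\<close>.\<close>

definition eigval :: "complex^'N^'N \<Rightarrow> nat \<Rightarrow> real" where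
  "eigval H i = sorted_list_of_multiset (eigenvalues H) ! (i - 1)"

definition is_density_matrix :: "nat \<Rightarrow> complex^'N^'N \<Rightarrow> complex^'N^'N \<Rightarrow> bool" where
  "is_density_matrix n H P \<longleftrightarrow>
     eigval H n < eigval H (n + 1) \<and>
     orth_projector P \<and>
     range (\<lambda>v. P *v v) = vec.span (\<Union>i\<in>{1..n}. eigenspace H (eigval H i))"

definition adaptive_compression :: "complex^'N^'N \<Rightarrow> complex^'N^'N \<Rightarrow> complex^'N^'N" where
  "adaptive_compression B Q = B ** pinv (Q ** B ** Q) ** B"

text \<open>The map is determined only up to the choice of eigenvectors in the eigenspace of the
  \<open>n\<close>-th eigenvalue, so it is specified by a predicate; its values outside
  \<open>projectors n\<close> are irrelevant.\<close>

definition is_fixed_point_map ::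
  "nat \<Rightarrow> complex^'N^'N \<Rightarrow> complex^'N^'N \<Rightarrow> (complex^'N^'N \<Rightarrow> complex^'N^'N) \<Rightarrow> bool" where
  "is_fixed_point_map n A B F \<longleftrightarrow>
     (\<forall>Q\<in>projectors n. \<exists>u :: nat \<Rightarrow> complex^'N.
        (\<forall>i\<in>{1..n}. \<forall>j\<in>{1..n}. cdot (u i) (u j) = (if i = j then 1 else 0)) \<and>
        (\<forall>i\<in>{1..n}. u i \<in> eigenspace (A + adaptive_compression B Q)
                                       (eigval (A + adaptive_compression B Q) i)) \<and>
        F Q = (\<Sum>i\<in>{1..n}. outer (u i) (u i)))"

text \<open>Lebesgue measure on a linear subspace \<open>V\<close>, regarded as a measure on the ambient space:
  the same construction as for \<^const>\<open>lborel\<close>, with an orthonormal basis of \<open>V\<close>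
  in place of \<^const>\<open>Basis\<close>. It does not depend on the choice of that basis.\<close>

definition orthonormal_basis :: "'a::euclidean_space set \<Rightarrow> 'a set \<Rightarrow> bool" where
  "orthonormal_basis V B \<longleftrightarrow> B \<subseteq> V \<and> pairwise orthogonal B \<and> (\<forall>b\<in>B. norm b = 1) \<and> span B = V"

definition subspace_lborel :: "'a::euclidean_space set \<Rightarrow> 'a measure" where
  "subspace_lborel V = (let B = (SOME B. orthonormal_basis V B) in
     distr (\<Pi>\<^sub>M b\<in>B. (lborel :: real measure)) borel (\<lambda>f. \<Sum>b\<in>B. f b *\<^sub>R b))"

text \<open>\<open>k\<close>-fold continuous differentiability, meant for open \<open>S\<close>: all iterated directional
  derivatives up to order \<open>k\<close> exist and are continuous on \<open>S\<close>.\<close>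

primrec Ck_on :: "nat \<Rightarrow> 'a::euclidean_space set \<Rightarrow> ('a \<Rightarrow> 'b::euclidean_space) \<Rightarrow> bool" where
  "Ck_on 0 S f \<longleftrightarrow> continuous_on S f"
| "Ck_on (Suc k) S f \<longleftrightarrow> (\<forall>x\<in>S. f differentiable (at x)) \<and>
     (\<forall>v. Ck_on k S (\<lambda>x. frechet_derivative f (at x) v))"

definition smooth_on :: "'a::euclidean_space set \<Rightarrow> ('a \<Rightarrow> 'b::euclidean_space) \<Rightarrow> bool" where
  "smooth_on S f \<longleftrightarrow> (\<forall>k. Ck_on k S f)"

text \<open>Slice charts: diffeomorphisms between open subsets of the ambient space that flatten the
  submanifold \<open>M\<close> to a linear subspace \<open>V\<close>. Their restrictions to \<open>M\<close> form an atlas of an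
  embedded submanifold \<open>M\<close>.\<close>

definition slice_chart ::
  "'a::euclidean_space set \<Rightarrow> 'a set \<Rightarrow> 'a set \<Rightarrow> ('a \<Rightarrow> 'a) \<Rightarrow> bool" where
  "slice_chart M V W \<phi> \<longleftrightarrow>
     subspace V \<and> open W \<and> open (\<phi> ` W) \<and> inj_on \<phi> W \<and>
     smooth_on W \<phi> \<and> smooth_on (\<phi> ` W) (inv_into W \<phi>) \<and>
     \<phi> ` (W \<inter> M) = \<phi> ` W \<inter> V"

definition null_in_submanifold :: "'a::euclidean_space set \<Rightarrow> 'a set \<Rightarrow> bool" where
  "null_in_submanifold M S \<longleftrightarrow>
     (\<forall>V W \<phi>. slice_chart M V W \<phi> \<longrightarrow> (AE y in subspace_lborel V. y \<notin> \<phi> ` (W \<inter> S)))"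

definition almost_every_on :: "'a::euclidean_space set \<Rightarrow> ('a \<Rightarrow> bool) \<Rightarrow> bool" where
  "almost_every_on M R \<longleftrightarrow> null_in_submanifold M {x \<in> M. \<not> R x}"

end

theory Submission
  imports Defs "HOL-Computational_Algebra.Polynomial"
begin

text \<open>
  Write \<open>M = - B\<close> and \<open>K = A + B\<close>. The compressed matrix is \<open>H Q = K + M ** (mat 1 - mproj M Q)\<close>,
  where \<open>mproj M Q\<close> is the \<open>M\<close>-orthogonal projector onto the range of \<open>Q\<close>; the correction term is
  positive semidefinite and vanishes on the range of \<open>Q\<close>. By the variational principle the energy
  \<open>tr (Q K)\<close> decreases along the iteration by at least a multiple of the squared step length, so
  the steps and the commutators \<open>[K, Q]\<close> tend to zero. If \<open>K\<close> has simple spectrum, only finitely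
  many projectors commute with it, and every orbit converges to one of them.

  Limits other than \<open>P\<close> are saddles: near such a limit the quadratic form \<open>- \<langle>X, [K, X]\<rangle>\<close> grows
  along the difference of two orbits unless that difference stays in a cone. Hence the points whose
  orbits stay near the saddle form a Lipschitz graph of positive codimension, a null set. Off a set
  of degenerate points the iteration is bounded below by a linear function, so preimages of null
  sets are null. For almost every \<open>(A, B)\<close> the degenerate points are null, by Fubini after a shear
  in \<open>A\<close>, since in graph charts degeneracy is a nontrivial rational condition on lines.
\<close>

section \<open>Complex matrices\<close>

text \<open>The iteration map is discontinuous, and not even determined, where the gap of
  \<open>H Q\<close> closes, and nothing keeps an orbit away from such points. Hence neither a
  derivative of the map nor a stable manifold theorem is available. All that is used about an image
  \<open>Q'\<close> of \<open>Q\<close> is that it commutes with \<open>H Q\<close> and minimises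
  \<open>rtr (R ** H Q)\<close>; the local estimates are stated for all commuting projectors.
  Differentiation is replaced by an exact difference formula for \<open>M ** mproj M Q\<close>, from
  which limits of normalised secants are taken, and local invertibility by a lower bound around each
  single point. Two notions of null set must be matched to Lebesgue measure. Slice charts come with
  subspaces whose dimension is not given, so nullity in the Grassmannian is tested against all
  pointwise Lipschitz maps (\<open>dnull\<close>). Exceptional pairs live in the space of Hermitian
  pairs, whereas Fubini and Lipschitz images are used in the ambient space; all conditions are
  therefore phrased through Hermitian parts, which makes them invariant in the orthogonal
  directions.\<close>

abbreviation ct :: "complex^'N^'M \<Rightarrow> complex^'M^'N" where "ct \<equiv> ctranspose"

lemma ct_nth [simp]: "ct A $ i $ j = cnj (A $ j $ i)"
  by (simp add: ctranspose_def)

lemma ct_ct [simp]: "ct (ct A) = A"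
  by (simp add: vec_eq_iff)

lemma ct_mult: "ct (A ** B) = ct B ** ct A"
  by (simp add: vec_eq_iff matrix_matrix_mult_def mult.commute)

lemma ct_add: "ct (A + B) = ct A + ct B"
  and ct_diff: "ct (A - B) = ct A - ct B"
  and ct_minus: "ct (- A) = - ct A"
  and ct_zero: "ct 0 = 0"
  and ct_scaleR: "ct (r *\<^sub>R A) = r *\<^sub>R ct A"
  by (simp_all add: vec_eq_iff)

lemma ct_mat1: "ct (mat 1) = mat 1"
  by (simp add: vec_eq_iff mat_def)

lemma linear_ct: "linear (ct :: complex^'N^'M \<Rightarrow> _)"
  by (rule linearI) (simp_all add: ct_add ct_scaleR)

lemma bounded_linear_ct: "bounded_linear (ct :: complex^'N^'M \<Rightarrow> _)"
  by (simp add: linear_conv_bounded_linear[symmetric] linear_ct)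

lemmas tendsto_ct = bounded_linear.tendsto[OF bounded_linear_ct]
lemmas continuous_on_ct = bounded_linear.continuous_on[OF bounded_linear_ct]
lemmas ct_simps = ct_mult ct_add ct_diff ct_minus ct_zero ct_scaleR ct_mat1

lemma cdot_ct: "cdot (A *v x) y = cdot x (ct A *v y)"
proof -
  have "cdot (A *v x) y = (\<Sum>i\<in>UNIV. \<Sum>j\<in>UNIV. cnj (A$i$j) * cnj (x$j) * y$i)"
    by (simp add: cdot_def matrix_vector_mult_def sum_distrib_right)
  also have "\<dots> = (\<Sum>j\<in>UNIV. \<Sum>i\<in>UNIV. cnj (A$i$j) * cnj (x$j) * y$i)"
    by (rule sum.swap)
  also have "\<dots> = cdot x (ct A *v y)"
    by (simp add: cdot_def matrix_vector_mult_def sum_distrib_left mult_ac)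
  finally show ?thesis .
qed

lemma cdot_add_left: "cdot (x + y) z = cdot x z + cdot y z"
  and cdot_add_right: "cdot z (x + y) = cdot z x + cdot z y"
  and cdot_diff_left: "cdot (x - y) z = cdot x z - cdot y z"
  and cdot_diff_right: "cdot z (x - y) = cdot z x - cdot z y"
  and cdot_scale_left: "cdot (c *s x) z = cnj c * cdot x z"
  and cdot_scale_right: "cdot z (c *s x) = c * cdot z x"
  and cdot_zero_left: "cdot 0 z = 0"
  and cdot_zero_right: "cdot z 0 = 0"
  by (simp_all add: cdot_def algebra_simps sum.distrib sum_subtractf sum_distrib_left)

lemma cdot_scaleR_left: "cdot (r *\<^sub>R x) z = r *\<^sub>R cdot x z"
  and cdot_scaleR_right: "cdot z (r *\<^sub>R x) = r *\<^sub>R cdot z x"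
  by (simp_all add: cdot_def scaleR_sum_right)

lemmas cdot_simps = cdot_add_left cdot_add_right cdot_diff_left cdot_diff_right cdot_scale_left
  cdot_scale_right cdot_zero_left cdot_zero_right cdot_scaleR_left cdot_scaleR_right

lemma cdot_sum_right: "cdot z (sum f I) = (\<Sum>i\<in>I. cdot z (f i))"
  by (induction I rule: infinite_finite_induct) (simp_all add: cdot_simps)

lemma cdot_commute: "cdot y x = cnj (cdot x y)"
  by (simp add: cdot_def mult.commute)

lemma inner_cdot: "inner x y = Re (cdot x y)"
  by (simp add: cdot_def inner_vec_def inner_complex_def)

lemma cdot_self: "cdot x x = of_real ((norm x)\<^sup>2)"
proof (rule complex_eqI)
  show "Re (cdot x x) = Re (of_real ((norm x)\<^sup>2))"
    by (simp add: inner_cdot[symmetric] dot_square_norm)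
  have "cdot x x = cnj (cdot x x)" by (rule cdot_commute)
  then show "Im (cdot x x) = Im (of_real ((norm x)\<^sup>2))"
    by (metis Im_complex_of_real cnj.simps(2) equation_minus_iff add.inverse_neutral eq_neg_iff_add_eq_0 mult_2 mult_eq_0_iff zero_neq_numeral)
qed

lemma bounded_bilinear_mm: "bounded_bilinear ((**) :: complex^'N^'N \<Rightarrow> complex^'N^'N \<Rightarrow> _)"
  unfolding bilinear_conv_bounded_bilinear[symmetric] bilinear_def
  by (auto intro!: linearI simp: vec_eq_iff matrix_matrix_mult_def algebra_simps sum.distrib
      sum_distrib_left scaleR_sum_right)

lemma bounded_bilinear_mv: "bounded_bilinear ((*v) :: complex^'N^'N \<Rightarrow> complex^'N \<Rightarrow> _)"
  unfolding bilinear_conv_bounded_bilinear[symmetric] bilinear_def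
  by (auto intro!: linearI simp: vec_eq_iff matrix_vector_mult_def algebra_simps sum.distrib
      sum_distrib_left scaleR_sum_right)

interpretation mm: bounded_bilinear "(**) :: complex^'N^'N \<Rightarrow> complex^'N^'N \<Rightarrow> _"
  by (rule bounded_bilinear_mm)

interpretation mv: bounded_bilinear "(*v) :: complex^'N^'N \<Rightarrow> complex^'N \<Rightarrow> _"
  by (rule bounded_bilinear_mv)

lemmas mm_simps = mm.add_left mm.add_right mm.diff_left mm.diff_right mm.minus_left mm.minus_right
  mm.zero_left mm.zero_right mm.scaleR_left mm.scaleR_right matrix_mul_assoc
  matrix_mul_lid matrix_mul_rid

text \<open>Products are normalised to left-nested form by \<open>matrix_mul_assoc\<close>, where a
  rule \<open>A ** B = C\<close> no longer matches behind a further factor; this lifts it to that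
  position.\<close>

lemma mm_absorb:
  fixes A B C X :: "complex^'N^'N"
  assumes "A ** B = C" shows "X ** A ** B = X ** C"
  by (simp add: assms matrix_mul_assoc[symmetric])

section \<open>Frobenius inner product and real trace\<close>

lemma inner_trace: "inner (A :: complex^'N^'N) B = Re (trace (ct A ** B))"
proof -
  have "inner A B = (\<Sum>i\<in>UNIV. \<Sum>j\<in>UNIV. inner (A$i$j) (B$i$j))"
    by (simp add: inner_vec_def)
  also have "\<dots> = (\<Sum>j\<in>UNIV. \<Sum>i\<in>UNIV. inner (A$i$j) (B$i$j))"
    by (rule sum.swap)
  also have "\<dots> = Re (trace (ct A ** B))"
    by (simp add: trace_def matrix_matrix_mult_def inner_complex_def)
  finally show ?thesis .
qed

definition rtr :: "complex^'N^'N \<Rightarrow> real" where "rtr A = Re (trace A)"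

lemma linear_rtr: "linear (rtr :: complex^'N^'N \<Rightarrow> real)"
  by (rule linearI) (simp_all add: rtr_def trace_def sum.distrib sum_distrib_left)

lemma bounded_linear_rtr: "bounded_linear (rtr :: complex^'N^'N \<Rightarrow> real)"
  by (simp add: linear_conv_bounded_linear[symmetric] linear_rtr)

lemmas rtr_add = linear_add[OF linear_rtr]
  and rtr_diff = linear_diff[OF linear_rtr]
  and rtr_minus = linear_neg[OF linear_rtr]
  and rtr_scaleR = linear_scale[OF linear_rtr]
  and rtr_sum = linear_sum[OF linear_rtr]
  and tendsto_rtr = bounded_linear.tendsto[OF bounded_linear_rtr]
  and continuous_on_rtr = bounded_linear.continuous_on[OF bounded_linear_rtr]

lemma rtr_commute: "rtr (A ** B) = rtr (B ** A)"
  unfolding rtr_def by (rule arg_cong[OF trace_mul_sym])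

lemma rtr_ct: "rtr (ct A) = rtr A"
  by (simp add: rtr_def trace_def)

lemma inner_rtr: "inner (A :: complex^'N^'N) B = rtr (ct A ** B)"
  by (simp add: inner_trace rtr_def)

lemma norm_rtr: "(norm (A :: complex^'N^'N))\<^sup>2 = rtr (ct A ** A)"
  by (simp add: inner_rtr[symmetric] dot_square_norm)

lemma norm_ct: "norm (ct A) = norm (A :: complex^'N^'N)"
proof -
  have "(norm (ct A))\<^sup>2 = (norm A)\<^sup>2" unfolding norm_rtr ct_ct by (rule rtr_commute)
  then show ?thesis by (simp add: power2_eq_iff_nonneg)
qed

lemma outer_mv: "outer v w *v x = cdot w x *s v"
  by (simp add: vec_eq_iff outer_def matrix_vector_mult_def cdot_def sum_distrib_right mult.assoc
      mult.commute[of "v $ _"])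

lemma outer_mm: "outer v w ** outer x y = outer (cdot w x *s v) y"
  by (simp add: vec_eq_iff outer_def matrix_matrix_mult_def cdot_def sum_distrib_right mult.assoc
      mult.commute[of "v $ _"])

lemma mm_outer: "A ** outer v w = outer (A *v v) w"
  by (simp add: vec_eq_iff outer_def matrix_vector_mult_def matrix_matrix_mult_def
      sum_distrib_right mult.assoc)

lemma ct_outer: "ct (outer v w) = outer w v"
  by (simp add: vec_eq_iff outer_def mult.commute)

lemma outer_mm': "outer v w ** A = outer v (ct A *v w)"
proof -
  have "ct (outer v w ** A) = ct (outer v (ct A *v w))"
    unfolding ct_mult ct_outer by (rule mm_outer)
  then show ?thesis by (metis ct_ct)
qed

lemma rtr_outer: "rtr (outer v w) = Re (cdot w v)"
  by (simp add: rtr_def trace_def outer_def cdot_def mult.commute)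

section \<open>Inverses of injective square matrices\<close>

lemma inj_mm_invertible:
  fixes A :: "complex^'N^'N"
  assumes "\<And>v. A *v v = 0 \<Longrightarrow> v = 0"
  shows "A ** matrix_inv A = mat 1" "matrix_inv A ** A = mat 1"
proof -
  obtain B where B: "B ** A = mat 1"
    using assms matrix_left_invertible_ker by blast
  then have "A ** B = mat 1" using matrix_left_right_inverse by blast
  with B have "A ** matrix_inv A = mat 1 \<and> matrix_inv A ** A = mat 1"
    unfolding matrix_inv_def by (metis (mono_tags, lifting) someI_ex)
  then show "A ** matrix_inv A = mat 1" "matrix_inv A ** A = mat 1"
    by simp_all
qed

lemma matrix_inv_commute:
  fixes A X :: "complex^'N^'N"
  assumes "A ** matrix_inv A = mat 1" "matrix_inv A ** A = mat 1" "A ** X = X ** A"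
  shows "matrix_inv A ** X = X ** matrix_inv A"
proof -
  have "matrix_inv A ** X = matrix_inv A ** X ** (A ** matrix_inv A)" by (simp add: assms)
  also have "\<dots> = matrix_inv A ** (X ** A) ** matrix_inv A" by (simp add: matrix_mul_assoc)
  also have "\<dots> = matrix_inv A ** A ** X ** matrix_inv A" by (simp add: assms(3)[symmetric] matrix_mul_assoc)
  finally show ?thesis by (simp add: assms)
qed

lemma matrix_eq_zeroI:
  fixes A :: "complex^'N^'N"
  assumes "\<And>v. A *v v = 0" shows "A = 0"
  using assms by (simp add: matrix_eq)

section \<open>Spectral theorem and projectors\<close>

definition orthonormal_on :: "('i \<Rightarrow> complex^'N) \<Rightarrow> 'i set \<Rightarrow> bool" where
  "orthonormal_on w I \<longleftrightarrow> (\<forall>i\<in>I. \<forall>j\<in>I. cdot (w i) (w j) = (if i = j then 1 else 0))"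

lemma hermitian_cdot: "hermitian H \<Longrightarrow> cdot (H *v x) y = cdot x (H *v y)"
  by (simp add: cdot_ct hermitian_def)

lemma orthonormal_norm: "orthonormal_on w I \<Longrightarrow> i \<in> I \<Longrightarrow> norm (w i) = 1"
proof -
  assume "orthonormal_on w I" "i \<in> I"
  then have "of_real ((norm (w i))\<^sup>2) = (1::complex)"
    unfolding cdot_self[symmetric] by (simp add: orthonormal_on_def)
  then have "(norm (w i))\<^sup>2 = 1" by (metis of_real_eq_1_iff)
  then show ?thesis using norm_ge_zero[of "w i"] unfolding power2_eq_1_iff by linarith
qed

text \<open>Complex orthogonality to \<open>v\<close> amounts to real orthogonality to both
  \<open>v\<close> and \<open>\<i> *s v\<close>; the doubled set still spans less than the real
  dimension \<open>2 * CARD('N)\<close>.\<close>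

lemma exists_orthogonal_vector:
  fixes O' :: "(complex^'N) set"
  assumes "finite O'" "card O' < CARD('N)"
  shows "\<exists>x. x \<noteq> 0 \<and> (\<forall>o'\<in>O'. cdot o' x = 0)"
proof -
  let ?T = "O' \<union> (\<lambda>v. \<i> *s v) ` O'"
  have "card ?T \<le> 2 * card O'"
    using card_Un_le[of O' "(\<lambda>v. \<i> *s v) ` O'"] card_image_le[OF assms(1), of "\<lambda>v. \<i> *s v"] by linarith
  then have "dim ?T < DIM(complex^'N)"
    using dim_le_card'[of ?T] assms by simp
  then have "span ?T \<noteq> UNIV" by (metis dim_UNIV dim_span less_irrefl)
  then obtain x where x: "x \<noteq> 0" "\<And>y. y \<in> span ?T \<Longrightarrow> orthogonal x y"
    by (metis orthogonal_to_subspace_exists \<open>dim ?T < DIM(complex^'N)\<close>)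
  have "cdot o' x = 0" if "o' \<in> O'" for o'
  proof -
    have 1: "inner o' x = 0" and 2: "inner (\<i> *s o') x = 0"
      using x(2)[of o'] x(2)[of "\<i> *s o'"] that
      by (auto intro!: span_base simp: orthogonal_def inner_commute)
    show ?thesis
      by (rule complex_eqI) (use 1 2 in \<open>auto simp: inner_cdot cdot_simps\<close>)
  qed
  then show ?thesis using x(1) by blast
qed

text \<open>First-order condition at a minimum: if \<open>a\<close> is nonzero, a small
  \<open>t\<close> of the opposite sign lets the linear term win. Dividing by
  \<open>\<bar>b\<bar> + 1\<close> makes \<open>t\<close> small enough and avoids a zero
  denominator.\<close>

lemma nonneg_quadratic_zero:
  fixes a b :: real
  assumes "\<And>t. 0 \<le> 2 * t * a + t\<^sup>2 * b" shows "a = 0"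
proof (rule ccontr)
  assume "a \<noteq> 0"
  define t where "t = - a / (\<bar>b\<bar> + 1)"
  have "t * (\<bar>b\<bar> + 1) = - a" by (simp add: t_def)
  then have ta: "t\<^sup>2 * (\<bar>b\<bar> + 1) = - t * a" by (simp add: power2_eq_square mult.assoc)
  have "t\<^sup>2 * b \<le> t\<^sup>2 * (\<bar>b\<bar> + 1)" by (intro mult_left_mono) auto
  also note ta
  finally have "0 \<le> t * a" using assms[of t] by simp
  moreover have "t * a < 0"
    using \<open>a \<noteq> 0\<close> by (simp add: t_def divide_neg_pos power2_eq_square[symmetric])
  ultimately show False by simp
qed

text \<open>A maximiser of the Rayleigh quotient on the orthogonal complement is an eigenvector.\<close>

lemma exists_orthogonal_eigenvector:
  fixes H :: "complex^'N^'N"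
  assumes H: "hermitian H" and fin: "finite O'" "card O' < CARD('N)"
    and eig: "\<And>o'. o' \<in> O' \<Longrightarrow> \<exists>l::real. H *v o' = of_real l *s o'"
  shows "\<exists>x (l::real). norm x = 1 \<and> (\<forall>o'\<in>O'. cdot o' x = 0) \<and> H *v x = of_real l *s x"
proof -
  let ?E = "{x. \<forall>o'\<in>O'. cdot o' x = 0}"
  let ?S = "{x. norm x = 1} \<inter> ?E"
  let ?f = "\<lambda>x. inner x (H *v x)"
  have clE: "closed ?E"
  proof -
    have "?E = (\<Inter>o'\<in>O'. {x. cdot o' x = 0})" by auto
    moreover have "closed {x. cdot o' x = 0}" for o' :: "complex^'N"
      unfolding cdot_def by (intro closed_Collect_eq continuous_intros)
    ultimately show ?thesis by auto
  qed
  have comp: "compact ?S"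
    using clE compact_sphere[of "0::complex^'N" 1]
    by (intro compact_Int_closed) (simp_all add: sphere_def)
  obtain x0 where x0: "x0 \<noteq> 0" "x0 \<in> ?E"
    using exists_orthogonal_vector[OF fin] by blast
  have "(1 / norm x0) *\<^sub>R x0 \<in> ?S" using x0 by (simp add: cdot_simps)
  then have ne: "?S \<noteq> {}" by blast
  have "continuous_on ?S ?f"
    by (intro continuous_on_inner continuous_on_id mv.continuous_on continuous_on_const)
  then obtain x where x: "x \<in> ?S" "\<And>y. y \<in> ?S \<Longrightarrow> ?f y \<le> ?f x"
    using continuous_attains_sup[OF comp ne] by blast
  define l where "l = ?f x"
  have max: "?f y \<le> l * (norm y)\<^sup>2" if "y \<in> ?E" for y
  proof (cases "y = 0")
    case False
    let ?z = "(1 / norm y) *\<^sub>R y"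
    have "?z \<in> ?S" using that False by (simp add: cdot_simps)
    then have "?f ?z \<le> l" using x(2) unfolding l_def by blast
    moreover have "?f ?z = ?f y / (norm y)\<^sup>2"
      by (simp add: mv.scaleR_right power2_eq_square)
    ultimately have "?f y / (norm y)\<^sup>2 \<le> l" by argo
    then show ?thesis using False by (simp add: pos_divide_le_eq)
  qed simp
  \<comment> \<open>\<open>z\<close> is half the gradient at \<open>x\<close> of the function
    \<open>l * (norm y)\<^sup>2 - ?f y\<close>, which is nonnegative on \<open>?E\<close> and
    vanishes at \<open>x\<close>. Since \<open>H\<close> preserves \<open>?E\<close>, the direction
    \<open>z\<close> is admissible, and the linear term along it is a multiple of
    \<open>(norm z)\<^sup>2\<close>.\<close>
  define z where "z = l *\<^sub>R x - H *v x"
  have HE: "H *v y \<in> ?E" if "y \<in> ?E" for y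
  proof (clarify)
    fix o' assume o': "o' \<in> O'"
    then obtain k :: real where k: "H *v o' = of_real k *s o'" using eig by blast
    have "cdot o' (H *v y) = cdot (H *v o') y" by (simp add: hermitian_cdot H)
    also have "\<dots> = 0" using that o' by (simp add: k cdot_simps)
    finally show "cdot o' (H *v y) = 0" .
  qed
  have xE: "x \<in> ?E" and nx: "norm x = 1" using x(1) by auto
  have zE: "z \<in> ?E" using xE HE[OF xE] by (simp add: z_def cdot_simps)
  have sym: "inner (H *v a) b = inner a (H *v b)" for a b
    by (simp add: inner_cdot hermitian_cdot H)
  have "0 \<le> 2 * t * (norm z)\<^sup>2 + t\<^sup>2 * (l * (norm z)\<^sup>2 - ?f z)" for t
  proof -
    have "x + t *\<^sub>R z \<in> ?E" using xE zE by (simp add: cdot_simps)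
    from max[OF this] have "0 \<le> l * (norm (x + t *\<^sub>R z))\<^sup>2 - ?f (x + t *\<^sub>R z)" by simp
    also have "\<dots> = (l * inner x x - ?f x) + 2 * t * (inner z (l *\<^sub>R x - H *v x))
        + t\<^sup>2 * (l * inner z z - ?f z)"
    proof -
      have 1: "(norm (x + t *\<^sub>R z))\<^sup>2 = inner x x + 2 * t * inner z x + t\<^sup>2 * inner z z"
        unfolding dot_square_norm[symmetric]
        by (simp add: inner_add_left inner_add_right power2_eq_square inner_commute[of x z]
              distrib_left)
      have "inner x (H *v z) = inner z (H *v x)" using sym[of x z] by (simp add: inner_commute)
      then have 2: "?f (x + t *\<^sub>R z) = ?f x + 2 * t * inner z (H *v x) + t\<^sup>2 * ?f z"
        by (simp add: mv.add_right mv.scaleR_right inner_add_left inner_add_right power2_eq_square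
              distrib_left)
      show ?thesis unfolding 1 2 by (simp add: inner_diff_right algebra_simps)
    qed
    also have "\<dots> = 2 * t * (norm z)\<^sup>2 + t\<^sup>2 * (l * (norm z)\<^sup>2 - ?f z)"
      using nx by (simp add: l_def[symmetric] z_def[symmetric] dot_square_norm)
    finally show ?thesis .
  qed
  from nonneg_quadratic_zero[OF this] have "z = 0" by simp
  then have "H *v x = l *\<^sub>R x" by (simp add: z_def)
  also have "\<dots> = of_real l *s x"
    by (simp add: vec_eq_iff scaleR_conv_of_real[where 'a = complex])
  finally show ?thesis using x(1) by blast
qed

section \<open>Orthonormal eigenbases and the eigenvalue multiset\<close>

lemma hermitian_eigenbasis_nat:
  fixes H :: "complex^'N^'N"
  assumes H: "hermitian H" and "k \<le> CARD('N)"
  shows "\<exists>w (l::nat \<Rightarrow> real). orthonormal_on w {..<k} \<and> (\<forall>i<k. H *v w i = of_real (l i) *s w i)"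
  using assms(2)
proof (induction k)
  case 0
  show ?case by (auto simp: orthonormal_on_def)
next
  case (Suc k)
  then obtain w and l :: "nat \<Rightarrow> real" where w: "orthonormal_on w {..<k}"
    "\<And>i. i < k \<Longrightarrow> H *v w i = of_real (l i) *s w i" by auto
  have "card (w ` {..<k}) < CARD('N)"
    using card_image_le[of "{..<k}" w] Suc.prems by simp
  then obtain x and m :: real where x: "norm x = 1" "\<And>i. i < k \<Longrightarrow> cdot (w i) x = 0"
    "H *v x = of_real m *s x"
    using exists_orthogonal_eigenvector[OF H, of "w ` {..<k}"] w(2) by blast
  have x': "i < k \<Longrightarrow> cdot x (w i) = 0" for i
    using x(2)[of i] cdot_commute[of x "w i"] by simp
  have "orthonormal_on (w(k := x)) {..<Suc k}"
    using w(1) x x' cdot_self[of x] by (auto simp: orthonormal_on_def less_Suc_eq)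
  moreover have "\<forall>i<Suc k. H *v (w(k := x)) i = of_real ((l(k := m)) i) *s (w(k := x)) i"
    using w(2) x(3) by (auto simp: less_Suc_eq)
  ultimately show ?case by blast
qed

text \<open>Orthonormality says that the matrix of columns has its adjoint as left inverse; for
  square matrices this is also a right inverse, which is completeness.\<close>

lemma orthonormal_sum_outer_UNIV:
  fixes w :: "'N \<Rightarrow> complex^'N"
  assumes "orthonormal_on w UNIV"
  shows "(\<Sum>i\<in>UNIV. outer (w i) (w i)) = mat 1"
proof -
  define V :: "complex^'N^'N" where "V = (\<chi> i j. w j $ i)"
  have "ct V ** V = mat 1"
    using assms by (simp add: vec_eq_iff V_def matrix_matrix_mult_def mat_def orthonormal_on_def cdot_def)
  then have "V ** ct V = mat 1" using matrix_left_right_inverse by blast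
  moreover have "V ** ct V = (\<Sum>i\<in>UNIV. outer (w i) (w i))"
    by (simp add: vec_eq_iff V_def matrix_matrix_mult_def outer_def)
  ultimately show ?thesis by simp
qed

lemma orthonormal_sum_outer:
  fixes w :: "'i \<Rightarrow> complex^'N"
  assumes "orthonormal_on w I" "finite I" "card I = CARD('N)"
  shows "(\<Sum>i\<in>I. outer (w i) (w i)) = mat 1"
proof -
  obtain h where h: "bij_betw h (UNIV::'N set) I"
    using finite_same_card_bij[of "UNIV::'N set" I] assms by auto
  have "orthonormal_on (w \<circ> h) UNIV"
    using assms(1) h by (auto simp: orthonormal_on_def bij_betw_def inj_on_def)
  from orthonormal_sum_outer_UNIV[OF this] show ?thesis
    using sum.reindex_bij_betw[OF h, of "\<lambda>i. outer (w i) (w i)"] by simp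
qed

lemma orthonormal_expansion:
  fixes w :: "'i \<Rightarrow> complex^'N"
  assumes "orthonormal_on w I" "finite I" "card I = CARD('N)"
  shows "x = (\<Sum>i\<in>I. cdot (w i) x *s w i)"
proof -
  have "x = (\<Sum>i\<in>I. outer (w i) (w i)) *v x" by (simp add: orthonormal_sum_outer[OF assms])
  also have "\<dots> = (\<Sum>i\<in>I. cdot (w i) x *s w i)" by (simp add: mv.sum_left outer_mv)
  finally show ?thesis .
qed

lemma orthonormal_card_le:
  fixes w :: "'i \<Rightarrow> complex^'N"
  assumes "orthonormal_on w I" "finite I"
  shows "vec.independent (w ` I)" "inj_on w I"
proof -
  show inj: "inj_on w I"
    using assms(1) unfolding inj_on_def orthonormal_on_def by (metis zero_neq_one)
  show "vec.independent (w ` I)"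
  proof (rule vec.independent_if_scalars_zero)
    show "finite (w ` I)" using assms by simp
    fix f x assume s: "(\<Sum>x\<in>w ` I. f x *s x) = 0" and "x \<in> w ` I"
    then obtain j where j: "j \<in> I" "x = w j" by blast
    have "0 = cdot (w j) (\<Sum>x\<in>w ` I. f x *s x)" by (simp add: s cdot_simps)
    also have "\<dots> = (\<Sum>i\<in>I. f (w i) * cdot (w j) (w i))"
      by (simp add: sum.reindex[OF inj] cdot_sum_right cdot_simps)
    also have "\<dots> = (\<Sum>i\<in>I. if i = j then f (w i) else 0)"
      using assms(1) j by (intro sum.cong) (auto simp: orthonormal_on_def)
    also have "\<dots> = f x" using j assms(2) by simp
    finally show "f x = 0" by simp
  qed
qed

lemma eigenspace_span:
  fixes w :: "'i \<Rightarrow> complex^'N"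
  assumes w: "orthonormal_on w I" "finite I" "card I = CARD('N)"
    and eig: "\<And>i. i \<in> I \<Longrightarrow> H *v w i = of_real (l i) *s w i"
  shows "eigenspace H m = vec.span (w ` {i\<in>I. l i = m})"
proof
  show "eigenspace H m \<subseteq> vec.span (w ` {i\<in>I. l i = m})"
  proof
    fix v assume "v \<in> eigenspace H m"
    then have Hv: "H *v v = of_real m *s v" by (simp add: eigenspace_def)
    have "cdot (w i) v = 0" if "i \<in> I" "l i \<noteq> m" for i
    proof -
      have "H *v v = (\<Sum>j\<in>I. cdot (w j) v *s (H *v w j))"
        by (subst orthonormal_expansion[OF w, of v]) (simp add: mv.sum_right vec.scale)
      then have "cdot (w i) (H *v v) = (\<Sum>j\<in>I. cdot (w j) v * of_real (l j) * cdot (w i) (w j))"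
        by (simp add: cdot_sum_right cdot_simps eig mult.assoc)
      also have "\<dots> = (\<Sum>j\<in>I. if j = i then cdot (w j) v * of_real (l j) else 0)"
        using w(1) that by (intro sum.cong) (auto simp: orthonormal_on_def)
      also have "\<dots> = cdot (w i) v * of_real (l i)" using that w(2) by simp
      finally have "cdot (w i) v * of_real (l i) = of_real m * cdot (w i) v"
        by (auto simp: Hv cdot_simps)
      then show ?thesis using that by auto
    qed
    then have "v = (\<Sum>i\<in>{i\<in>I. l i = m}. cdot (w i) v *s w i)"
      by (subst orthonormal_expansion[OF w, of v], intro sum.mono_neutral_right) (auto simp: w)
    also have "\<dots> \<in> vec.span (w ` {i\<in>I. l i = m})"
      by (intro vec.span_sum vec.span_scale vec.span_base) auto
    finally show "v \<in> vec.span (w ` {i\<in>I. l i = m})" .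
  qed
  have sub: "vec.subspace (eigenspace H m)"
    by (auto simp: vec.subspace_def eigenspace_def vec.scale matrix_vector_right_distrib
        vector_add_ldistrib mult.commute)
  show "vec.span (w ` {i\<in>I. l i = m}) \<subseteq> eigenspace H m"
    by (rule vec.span_minimal[OF _ sub]) (auto simp: eigenspace_def eig)
qed

lemma dim_eigenspace:
  fixes w :: "'i \<Rightarrow> complex^'N"
  assumes w: "orthonormal_on w I" "finite I" "card I = CARD('N)"
    and eig: "\<And>i. i \<in> I \<Longrightarrow> H *v w i = of_real (l i) *s w i"
  shows "vec.dim (eigenspace H m) = card {i\<in>I. l i = m}"
proof -
  have "orthonormal_on w {i\<in>I. l i = m}" using w(1) by (simp add: orthonormal_on_def)
  note * = orthonormal_card_le[OF this]
  have sp: "eigenspace H m = vec.span (w ` {i\<in>I. l i = m})"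
    by (rule eigenspace_span[OF w]) (rule eig)
  have "vec.dim (eigenspace H m) = card (w ` {i\<in>I. l i = m})"
    unfolding sp vec.dim_span
    by (rule vec.dim_eq_card_independent) (use * w(2) in auto)
  also have "\<dots> = card {i\<in>I. l i = m}" by (rule card_image) (use * w(2) in auto)
  finally show ?thesis .
qed

text \<open>\<open>eigenvalues\<close> counts dimensions of eigenspaces. Given an orthonormal
  eigenbasis, the dimension at \<open>m\<close> is the number of basis vectors with eigenvalue
  \<open>m\<close>, so the multiset can be read off any such basis.\<close>

lemma eigenvalues_eq:
  fixes w :: "'i \<Rightarrow> complex^'N"
  assumes w: "orthonormal_on w I" "finite I" "card I = CARD('N)"
    and eig: "\<And>i. i \<in> I \<Longrightarrow> H *v w i = of_real (l i) *s w i"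
  shows "eigenvalues H = image_mset l (mset_set I)"
proof -
  have sp: "eigenspace H m = vec.span (w ` {i\<in>I. l i = m})" for m
    by (rule eigenspace_span[OF w]) (rule eig)
  have dm: "vec.dim (eigenspace H m) = card {i\<in>I. l i = m}" for m
    by (rule dim_eigenspace[OF w]) (rule eig)
  have S: "{m. eigenspace H m \<noteq> {0}} = l ` I"
  proof -
    have "eigenspace H m \<noteq> {0} \<longleftrightarrow> m \<in> l ` I" for m
    proof
      assume "eigenspace H m \<noteq> {0}"
      then have "{i\<in>I. l i = m} \<noteq> {}"
        unfolding sp by force
      then show "m \<in> l ` I" by auto
    next
      assume "m \<in> l ` I"
      then obtain i where i: "i \<in> I" "l i = m" by blast
      then have "w i \<in> eigenspace H m" by (auto simp: eigenspace_def eig)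
      moreover have "w i \<noteq> 0" using orthonormal_norm[OF w(1) i(1)] by force
      ultimately show "eigenspace H m \<noteq> {0}" by blast
    qed
    then show ?thesis by blast
  qed
  show ?thesis
  proof (rule multiset_eqI)
    fix x
    have "count (eigenvalues H) x = (\<Sum>m\<in>l ` I. if x = m then card {i\<in>I. l i = m} else 0)"
      by (simp add: eigenvalues_def S count_sum dm)
    also have "\<dots> = card {i\<in>I. l i = x}" using w(2) by (auto simp: card_eq_0_iff)
    also have "\<dots> = (\<Sum>i\<in>{y. y \<in># mset_set I \<and> x = l y}. count (mset_set I) i)"
      using w(2) by (subst sum.cong[where h = "\<lambda>_. 1" and B = "{i\<in>I. l i = x}"]) auto
    also have "\<dots> = count (image_mset l (mset_set I)) x"
      by (rule count_image_mset'[symmetric])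
    finally show "count (eigenvalues H) x = count (image_mset l (mset_set I)) x" .
  qed
qed

theorem hermitian_sorted_eigenbasis:
  fixes H :: "complex^'N^'N"
  assumes H: "hermitian H"
  obtains w :: "nat \<Rightarrow> complex^'N" where "orthonormal_on w {1..CARD('N)}"
    "\<And>i. i \<in> {1..CARD('N)} \<Longrightarrow> H *v w i = of_real (eigval H i) *s w i"
    "\<And>i j. 1 \<le> i \<Longrightarrow> i \<le> j \<Longrightarrow> j \<le> CARD('N) \<Longrightarrow> eigval H i \<le> eigval H j"
proof -
  let ?N = "CARD('N)"
  obtain w and l :: "nat \<Rightarrow> real" where w: "orthonormal_on w {..<?N}"
    "\<And>i. i < ?N \<Longrightarrow> H *v w i = of_real (l i) *s w i"
    using hermitian_eigenbasis_nat[OF H, of ?N] by auto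
  \<comment> \<open>Indices are sorted instead of values, so that each eigenvector keeps its
    eigenvalue. \<open>eigval\<close> counts from 1 and lists count from 0, hence
    \<open>i - 1\<close> below.\<close>
  define xs where "xs = sort_key l [0..<?N]"
  have len: "length xs = ?N" and dist: "distinct xs" and set: "set xs = {..<?N}"
    by (auto simp: xs_def)
  have "mset (map l xs) = eigenvalues H"
    using eigenvalues_eq[OF w(1), of H l] w(2) by (simp add: xs_def lessThan_atLeast0)
  moreover have "sorted (map l xs)" by (simp add: xs_def)
  ultimately have sl: "sorted_list_of_multiset (eigenvalues H) = map l xs"
    by (metis sorted_list_of_multiset_mset sorted_sort_id)
  have ev: "eigval H i = l (xs ! (i - 1))" if "i \<in> {1..?N}" for i
    using that len by (auto simp: eigval_def sl)
  have mem: "xs ! (i - 1) < ?N" if "i \<in> {1..?N}" for i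
  proof -
    have "i - 1 < length xs" using that unfolding len by auto
    then have "xs ! (i - 1) \<in> set xs" by (rule nth_mem)
    then show ?thesis unfolding set by simp
  qed
  show thesis
  proof
    show "orthonormal_on (\<lambda>i. w (xs ! (i - 1))) {1..?N}"
      unfolding orthonormal_on_def
    proof (intro ballI)
      fix i j assume ij: "i \<in> {1..?N}" "j \<in> {1..?N}"
      have "(xs ! (i - 1) = xs ! (j - 1)) = (i - 1 = j - 1)"
        by (rule nth_eq_iff_index_eq[OF dist]) (use ij len in auto)
      also have "\<dots> = (i = j)" using ij by auto
      finally have eq: "(xs ! (i - 1) = xs ! (j - 1)) = (i = j)" .
      have "cdot (w (xs ! (i - 1))) (w (xs ! (j - 1)))
          = (if xs ! (i - 1) = xs ! (j - 1) then 1 else 0)"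
        using w(1) mem[OF ij(1)] mem[OF ij(2)] by (simp only: orthonormal_on_def lessThan_iff)
      then show "cdot (w (xs ! (i - 1))) (w (xs ! (j - 1))) = (if i = j then 1 else 0)"
        by (simp only: eq)
    qed
    show "H *v w (xs ! (i - 1)) = of_real (eigval H i) *s w (xs ! (i - 1))"
      if "i \<in> {1..?N}" for i
      by (simp only: ev[OF that] w(2)[OF mem[OF that]])
    show "eigval H i \<le> eigval H j" if "1 \<le> i" "i \<le> j" "j \<le> ?N" for i j
    proof -
      have "map l xs ! (i - 1) \<le> map l xs ! (j - 1)"
        by (rule sorted_nth_mono[OF \<open>sorted (map l xs)\<close>]) (use that len in auto)
      moreover have "i - 1 < length xs" "j - 1 < length xs" using that unfolding len by auto
      ultimately show ?thesis using that by (simp add: ev)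
    qed
  qed
qed

lemma orthonormal_on_subset: "orthonormal_on w I \<Longrightarrow> J \<subseteq> I \<Longrightarrow> orthonormal_on w J"
  unfolding orthonormal_on_def by blast

section \<open>Orthogonal projectors as sums of rank-one projectors\<close>

context
  fixes w :: "'i \<Rightarrow> complex^'N" and J P
  assumes on: "orthonormal_on w J" "finite J" and P: "P = (\<Sum>i\<in>J. outer (w i) (w i))"
begin

lemma sum_outer_ct: "ct P = P"
  by (simp add: P linear_sum[OF linear_ct] ct_outer)

lemma sum_outer_mv: "P *v x = (\<Sum>i\<in>J. cdot (w i) x *s w i)"
  by (simp add: P mv.sum_left outer_mv)

lemma sum_outer_fix: "i \<in> J \<Longrightarrow> P *v w i = w i"
proof -
  assume i: "i \<in> J"
  have "P *v w i = (\<Sum>j\<in>J. if j = i then w i else 0)"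
    unfolding sum_outer_mv using on i by (intro sum.cong) (auto simp: orthonormal_on_def)
  also have "\<dots> = w i" using on i by simp
  finally show ?thesis .
qed

lemma sum_outer_orth: "(\<And>i. i \<in> J \<Longrightarrow> cdot (w i) x = 0) \<Longrightarrow> P *v x = 0"
  by (simp add: sum_outer_mv)

lemma sum_outer_idem: "P ** P = P"
proof -
  have "P ** P = (\<Sum>i\<in>J. outer (P *v w i) (w i))"
    by (subst (2) P) (simp add: mm.sum_right mm_outer)
  also have "\<dots> = P" by (simp add: sum_outer_fix P[symmetric])
  finally show ?thesis .
qed

lemma sum_outer_rtr: "rtr P = card J"
proof -
  have "rtr P = (\<Sum>i\<in>J. 1)"
    unfolding P rtr_sum rtr_outer using on by (intro sum.cong) (auto simp: orthonormal_on_def)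
  then show ?thesis by simp
qed

lemma sum_outer_range: "range (\<lambda>v. P *v v) = vec.span (w ` J)"
proof
  show "range (\<lambda>v. P *v v) \<subseteq> vec.span (w ` J)"
    by (auto simp: sum_outer_mv intro!: vec.span_sum vec.span_scale intro: vec.span_base)
  have "vec.subspace (range (\<lambda>v. P *v v))"
    unfolding vec.subspace_def
    by (auto simp: matrix_vector_right_distrib[symmetric] vec.scale[symmetric])
      (metis mv.zero_right rangeI)
  moreover have "w ` J \<subseteq> range (\<lambda>v. P *v v)"
    using sum_outer_fix by (metis (no_types, lifting) image_subsetI rangeI)
  ultimately show "vec.span (w ` J) \<subseteq> range (\<lambda>v. P *v v)"
    by (rule vec.span_minimal[rotated])
qed

text \<open>The rows of \<open>P\<close> span the complex conjugates of the \<open>w i\<close>.\<close>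

lemma sum_outer_rank: "rank P = card J"
proof -
  define cw where "cw i = (\<chi> k. cnj (w i $ k))" for i
  have ocw: "orthonormal_on cw J"
    unfolding orthonormal_on_def
  proof (intro ballI)
    fix i j assume ij: "i \<in> J" "j \<in> J"
    have "cdot (cw i) (cw j) = cdot (w j) (w i)"
      by (simp add: cdot_def cw_def mult.commute)
    then show "cdot (cw i) (cw j) = (if i = j then 1 else 0)"
      using on ij by (auto simp: orthonormal_on_def)
  qed
  have row: "row k P = (\<Sum>i\<in>J. (w i $ k) *s cw i)" for k
    by (simp add: vec_eq_iff row_def P outer_def cw_def)
  have "vec.span (rows P) = vec.span (cw ` J)"
  proof
    show "vec.span (rows P) \<subseteq> vec.span (cw ` J)"
      by (rule vec.span_minimal[OF _ vec.subspace_span])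
        (auto simp: rows_def row intro!: vec.span_sum vec.span_scale intro: vec.span_base)
    have "cw i \<in> vec.span (rows P)" if "i \<in> J" for i
    proof -
      have "(\<Sum>k\<in>UNIV. cnj (w i $ k) *s row k P) = (\<Sum>k\<in>UNIV. \<Sum>j\<in>J. (cnj (w i $ k) * w j $ k) *s cw j)"
        by (simp add: row vec.scale_sum_right)
      also have "\<dots> = (\<Sum>j\<in>J. \<Sum>k\<in>UNIV. (cnj (w i $ k) * w j $ k) *s cw j)"
        by (rule sum.swap)
      also have "\<dots> = (\<Sum>j\<in>J. cdot (w i) (w j) *s cw j)"
        by (simp add: cdot_def vec.scale_sum_left)
      also have "\<dots> = (\<Sum>j\<in>J. if j = i then cw i else 0)"
        using on that by (intro sum.cong) (auto simp: orthonormal_on_def)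
      also have "\<dots> = cw i" using on that by simp
      finally have "cw i = (\<Sum>k\<in>UNIV. cnj (w i $ k) *s row k P)" ..
      also have "\<dots> \<in> vec.span (rows P)"
        by (auto simp: rows_def intro!: vec.span_sum vec.span_scale intro: vec.span_base)
      finally show ?thesis .
    qed
    then show "vec.span (cw ` J) \<subseteq> vec.span (rows P)"
      by (intro vec.span_minimal[OF _ vec.subspace_span]) auto
  qed
  then have "rank P = vec.dim (cw ` J)"
    unfolding row_rank_def_gen by (metis vec.dim_span)
  also have "\<dots> = card (cw ` J)"
    by (rule vec.dim_eq_card_independent[OF orthonormal_card_le(1)[OF ocw on(2)]])
  also have "\<dots> = card J" by (rule card_image[OF orthonormal_card_le(2)[OF ocw on(2)]])
  finally show ?thesis .
qed

end

lemma sum_outer_in_projectors: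
  fixes w :: "'i \<Rightarrow> complex^'N"
  assumes "orthonormal_on w J" "finite J"
  shows "(\<Sum>i\<in>J. outer (w i) (w i)) \<in> projectors (card J)"
  using sum_outer_ct[OF assms refl] sum_outer_idem[OF assms refl] sum_outer_rank[OF assms refl]
  by (simp add: projectors_def orth_projector_def hermitian_def)

lemma projector_decomp:
  fixes R :: "complex^'N^'N"
  assumes R: "ct R = R" "R ** R = R"
  obtains w :: "nat \<Rightarrow> complex^'N" and J where "orthonormal_on w {1..CARD('N)}"
    "J \<subseteq> {1..CARD('N)}" "R = (\<Sum>i\<in>J. outer (w i) (w i))"
proof -
  let ?I = "{1..CARD('N)}"
  have "hermitian R" using R by (simp add: hermitian_def)
  then obtain w :: "nat \<Rightarrow> complex^'N" where w: "orthonormal_on w ?I"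
    "\<And>i. i \<in> ?I \<Longrightarrow> R *v w i = of_real (eigval R i) *s w i"
    using hermitian_sorted_eigenbasis[of R] by metis
  have l01: "eigval R i = 0 \<or> eigval R i = 1" if "i \<in> ?I" for i
  proof -
    let ?l = "complex_of_real (eigval R i)"
    have "R *v (R *v w i) = R *v w i" by (simp add: matrix_vector_mul_assoc R)
    then have "(?l * ?l) *s w i = ?l *s w i"
      using w(2)[OF that] by (simp add: vec.scale)
    moreover have "w i \<noteq> 0" using orthonormal_norm[OF w(1) that] by force
    ultimately have "?l * ?l = ?l" by simp
    then show ?thesis by simp
  qed
  let ?J = "{i\<in>?I. eigval R i = 1}"
  have "R = R ** (\<Sum>i\<in>?I. outer (w i) (w i))"
    using orthonormal_sum_outer[OF w(1)] by simp
  also have "\<dots> = (\<Sum>i\<in>?I. outer (of_real (eigval R i) *s w i) (w i))"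
    by (simp add: mm.sum_right mm_outer w(2))
  also have "\<dots> = (\<Sum>i\<in>?J. outer (of_real (eigval R i) *s w i) (w i))"
  proof (rule sum.mono_neutral_right)
    show "\<forall>i\<in>?I - ?J. outer (of_real (eigval R i) *s w i) (w i) = 0"
      using l01 by (auto simp: outer_def vec_eq_iff Ball_def)
  qed auto
  also have "\<dots> = (\<Sum>i\<in>?J. outer (w i) (w i))" by (intro sum.cong) auto
  finally show thesis using w(1) by (intro that[of w ?J]) auto
qed

lemma rank_projector:
  fixes R :: "complex^'N^'N"
  assumes "ct R = R" "R ** R = R" shows "rtr R = rank R"
proof -
  obtain w :: "nat \<Rightarrow> complex^'N" and J where w: "orthonormal_on w {1..CARD('N)}"
    "J \<subseteq> {1..CARD('N)}" "R = (\<Sum>i\<in>J. outer (w i) (w i))"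
    using projector_decomp[OF assms] by metis
  have "orthonormal_on w J" "finite J" using w by (auto intro: orthonormal_on_subset finite_subset)
  from sum_outer_rtr[OF this w(3)] sum_outer_rank[OF this w(3)] show ?thesis by simp
qed

text \<open>Trading the rank for the trace replaces a discontinuous condition by a closed one;
  compactness of \<open>projectors n\<close> and the measurability of the exceptional set rest on
  this form.\<close>

lemma projectors_iff: "Q \<in> projectors n \<longleftrightarrow> ct Q = Q \<and> Q ** Q = Q \<and> rtr Q = n"
  using rank_projector[of Q] by (auto simp: projectors_def orth_projector_def hermitian_def)

lemma projectors_ct: "Q \<in> projectors n \<Longrightarrow> ct Q = Q"
  and projectors_idem: "Q \<in> projectors n \<Longrightarrow> Q ** Q = Q"
  and projectors_rtr: "Q \<in> projectors n \<Longrightarrow> rtr Q = n"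
  by (simp_all add: projectors_iff)

lemma projectors_norm: "Q \<in> projectors n \<Longrightarrow> (norm Q)\<^sup>2 = n"
  by (simp add: norm_rtr projectors_iff)

lemma compact_projectors: "compact (projectors n :: (complex^'N^'N) set)"
proof -
  have "projectors n = {Q::complex^'N^'N. ct Q = Q} \<inter> {Q. Q ** Q = Q} \<inter> {Q. rtr Q = n}"
    by (auto simp: projectors_iff)
  moreover have "closed {Q::complex^'N^'N. ct Q = Q}" "closed {Q::complex^'N^'N. Q ** Q = Q}"
      "closed {Q::complex^'N^'N. rtr Q = n}"
    by (intro closed_Collect_eq continuous_on_ct mm.continuous_on continuous_on_rtr
        continuous_on_id continuous_on_const)+
  ultimately have "closed (projectors n :: (complex^'N^'N) set)" by auto
  moreover have "norm Q \<le> sqrt n" if "Q \<in> projectors n" for Q :: "complex^'N^'N"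
    using projectors_norm[OF that] real_le_rsqrt by auto
  then have "bounded (projectors n :: (complex^'N^'N) set)"
    unfolding bounded_iff by blast
  ultimately show ?thesis by (simp add: compact_eq_bounded_closed)
qed

text \<open>With equal traces both sides are \<open>2 * (n - rtr (P ** Q))\<close>. Distances
  between projectors thereby reduce to the part of \<open>P\<close> outside the range of
  \<open>Q\<close>.\<close>

lemma norm_diff_projectors:
  assumes P: "P \<in> projectors n" and Q: "Q \<in> projectors n"
  shows "(norm (P - Q))\<^sup>2 = 2 * (norm ((mat 1 - Q) ** P))\<^sup>2"
proof -
  note r = projectors_ct[OF P] projectors_ct[OF Q] projectors_idem[OF P] projectors_idem[OF Q]
  note r' = r(3)[THEN mm_absorb] r(4)[THEN mm_absorb]
  have 1: "rtr (P ** Q ** P) = rtr (P ** Q)" "rtr (Q ** P) = rtr (P ** Q)"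
    using rtr_commute[of "P ** Q" P] rtr_commute[of Q P] by (simp_all add: mm_simps r r')
  show ?thesis
    unfolding norm_rtr
    by (simp add: ct_simps r r' mm_simps rtr_diff rtr_add 1 projectors_rtr[OF P] projectors_rtr[OF Q])
qed

lemma projectors_eqI:
  assumes "P \<in> projectors n" "Q \<in> projectors n" "Q ** P = P" shows "P = Q"
  using norm_diff_projectors[OF assms(1,2)] assms(3) by (simp add: mm_simps)

text \<open>Equal traces allow a permutation of the indices that sends \<open>J\<close> to
  \<open>K\<close> and complement to complement; it matches the two adapted bases. The unitary later
  transports frames and off-diagonal blocks from one projector to another.\<close>

lemma projectors_unitary_equiv:
  fixes Q U :: "complex^'N^'N"
  assumes Q: "Q \<in> projectors n" and U: "U \<in> projectors n"
  obtains R where "ct R ** R = mat 1" "R ** ct R = mat 1" "R ** Q = U ** R"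
proof -
  let ?I = "{1..CARD('N)}"
  obtain w :: "nat \<Rightarrow> complex^'N" and J where w: "orthonormal_on w ?I"
    "J \<subseteq> ?I" "Q = (\<Sum>i\<in>J. outer (w i) (w i))"
    using projector_decomp[of Q] Q by (metis projectors_iff)
  obtain v :: "nat \<Rightarrow> complex^'N" and K where v: "orthonormal_on v ?I"
    "K \<subseteq> ?I" "U = (\<Sum>i\<in>K. outer (v i) (v i))"
    using projector_decomp[of U] U by (metis projectors_iff)
  have fin: "finite J" "finite K" using w v by (auto intro: finite_subset)
  have "orthonormal_on w J" "orthonormal_on v K"
    using w v by (auto intro: orthonormal_on_subset)
  then have "rtr Q = card J" "rtr U = card K"
    using sum_outer_rtr[OF _ fin(1) w(3)] sum_outer_rtr[OF _ fin(2) v(3)] by auto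
  then have card: "card J = card K" using Q U by (simp add: projectors_iff)
  obtain p where p: "bij_betw p J K" using finite_same_card_bij[OF fin card] by blast
  have "card (?I - J) = card (?I - K)" using card w v fin by (simp add: card_Diff_subset)
  then obtain q where q: "bij_betw q (?I - J) (?I - K)"
    using finite_same_card_bij[of "?I - J" "?I - K"] by auto
  define s where "s i = (if i \<in> J then p i else q i)" for i
  have s1: "bij_betw s J K" using p by (rule bij_betw_cong[THEN iffD1, rotated]) (simp add: s_def)
  have s2: "bij_betw s (?I - J) (?I - K)"
    using q by (rule bij_betw_cong[THEN iffD1, rotated]) (simp add: s_def)
  have s: "bij_betw s ?I ?I"
    using bij_betw_combine[OF s1 s2] w(2) v(2) by (simp add: Un_absorb1)
  have sI: "i \<in> ?I \<Longrightarrow> s i \<in> ?I" for i using s by (auto simp: bij_betw_def)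
  have inj: "i \<in> ?I \<Longrightarrow> j \<in> ?I \<Longrightarrow> s i = s j \<longleftrightarrow> i = j" for i j
    using s unfolding bij_betw_def by (meson inj_on_eq_iff)
  define R where "R = (\<Sum>i\<in>?I. outer (v (s i)) (w i))"
  have ctR: "ct R = (\<Sum>i\<in>?I. outer (w i) (v (s i)))"
    by (simp add: R_def linear_sum[OF linear_ct] ct_outer)
  have Rw: "R *v w i = v (s i)" if "i \<in> ?I" for i
  proof -
    have "R *v w i = (\<Sum>j\<in>?I. if j = i then v (s i) else 0)"
      unfolding R_def mv.sum_left outer_mv using w(1) that
      by (intro sum.cong) (auto simp: orthonormal_on_def)
    also have "\<dots> = v (s i)" using that by (subst sum.delta) simp_all
    finally show ?thesis .
  qed
  have "R ** ct R = (\<Sum>i\<in>?I. outer (v (s i)) (v (s i)))"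
    unfolding ctR mm.sum_right mm_outer by (intro sum.cong) (simp_all add: Rw)
  also have "\<dots> = (\<Sum>i\<in>?I. outer (v i) (v i))"
    by (rule sum.reindex_bij_betw[OF s])
  also have "\<dots> = mat 1" by (rule orthonormal_sum_outer[OF v(1)]) simp_all
  finally have RR: "R ** ct R = mat 1" .
  then have R1: "ct R ** R = mat 1" using matrix_left_right_inverse by blast
  have "R ** Q ** ct R = (\<Sum>i\<in>J. outer (R *v w i) (w i)) ** ct R"
    by (simp add: w(3) mm.sum_right mm_outer)
  also have "\<dots> = (\<Sum>i\<in>J. outer (v (s i)) (v (s i)))"
    unfolding mm.sum_left outer_mm' ct_ct using w(2) by (intro sum.cong) (auto simp: Rw)
  also have "\<dots> = U" unfolding v(3) by (rule sum.reindex_bij_betw[OF s1])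
  finally have "R ** Q ** ct R ** R = U ** R" by simp
  then have "R ** Q = U ** R" by (simp add: mm_absorb[OF R1])
  with R1 RR show thesis by (rule that)
qed

section \<open>Adaptive compression\<close>

definition pos_def :: "complex^'N^'N \<Rightarrow> bool" where
  "pos_def M \<longleftrightarrow> ct M = M \<and> (\<forall>v. v \<noteq> 0 \<longrightarrow> 0 < Re (cdot v (M *v v)))"

lemma neg_def_pos_def: "neg_def B \<longleftrightarrow> pos_def (- B)"
  by (auto simp: neg_def_def pos_def_def hermitian_def ct_simps mv.minus_left cdot_def sum_negf)

lemma pos_def_ct: "pos_def M \<Longrightarrow> ct M = M"
  by (simp add: pos_def_def)

lemma pos_def_coercive:
  assumes "pos_def M"
  obtains m where "m > 0" "\<And>v. m * (norm v)\<^sup>2 \<le> Re (cdot v (M *v v))"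
proof -
  let ?S = "sphere (0::complex^'N) 1" and ?f = "\<lambda>v. inner v (M *v v)"
  have "?S \<noteq> {}" by simp
  moreover have "continuous_on ?S ?f"
    by (intro continuous_on_inner continuous_on_id mv.continuous_on continuous_on_const)
  ultimately obtain u where u: "u \<in> ?S" "\<And>y. y \<in> ?S \<Longrightarrow> ?f u \<le> ?f y"
    using continuous_attains_inf[OF compact_sphere[of "0::complex^'N" 1]] by blast
  show thesis
  proof
    have "u \<noteq> 0" using u(1) by auto
    then show "?f u > 0" using assms by (simp add: pos_def_def inner_cdot)
    fix v
    show "?f u * (norm v)\<^sup>2 \<le> Re (cdot v (M *v v))"
    proof (cases "v = 0")
      case False
      let ?z = "(1 / norm v) *\<^sub>R v"
      have "?f u \<le> ?f ?z" using False by (intro u(2)) simp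
      also have "?f ?z = ?f v / (norm v)\<^sup>2" by (simp add: mv.scaleR_right power2_eq_square)
      finally show ?thesis using False by (simp add: pos_le_divide_eq inner_cdot)
    qed (simp add: cdot_simps)
  qed
qed

lemma norm_matrix_columns: "(norm (X :: complex^'N^'N))\<^sup>2 = (\<Sum>j\<in>UNIV. (norm (X *v axis j 1))\<^sup>2)"
proof -
  have "X = (\<Sum>j\<in>UNIV. outer (X *v axis j 1) (axis j 1))"
  proof -
    have "mat 1 = (\<Sum>j\<in>UNIV. outer (axis j 1) (axis j (1::complex)) :: complex^'N^'N)"
      by (simp add: vec_eq_iff outer_def mat_def axis_def if_distrib[of cnj] cong: if_cong)
        (auto simp: if_distrib[of "\<lambda>x. x * _"] cong: if_cong)
    then have "X = X ** (\<Sum>j\<in>UNIV. outer (axis j 1) (axis j 1))" by (metis matrix_mul_rid)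
    then show ?thesis by (simp add: mm.sum_right mm_outer)
  qed
  then have "rtr (ct X ** X) = rtr (ct X ** (\<Sum>j\<in>UNIV. outer (X *v axis j 1) (axis j 1)))" by simp
  also have "\<dots> = (\<Sum>j\<in>UNIV. (norm (X *v axis j 1))\<^sup>2)"
    by (simp add: mm.sum_right mm_outer rtr_sum rtr_outer cdot_ct[symmetric] cdot_self)
  finally show ?thesis by (simp add: norm_rtr)
qed

lemma inner_matrix_columns:
  "inner (X :: complex^'N^'N) Y = (\<Sum>j\<in>UNIV. inner (X *v axis j 1) (Y *v axis j 1))"
proof -
  have "inner X Y = ((norm (X + Y))\<^sup>2 - (norm X)\<^sup>2 - (norm Y)\<^sup>2) / 2"
    by (simp add: dot_norm)
  also have "\<dots> = (\<Sum>j\<in>UNIV. ((norm (X *v axis j 1 + Y *v axis j 1))\<^sup>2 -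
      (norm (X *v axis j 1))\<^sup>2 - (norm (Y *v axis j 1))\<^sup>2) / 2)"
    unfolding norm_matrix_columns sum_divide_distrib[symmetric] sum_subtractf mv.add_left ..
  also have "\<dots> = (\<Sum>j\<in>UNIV. inner (X *v axis j 1) (Y *v axis j 1))" by (simp add: dot_norm)
  finally show ?thesis .
qed

lemma coercive_matrix:
  fixes M X :: "complex^'N^'N"
  assumes "\<And>v. m * (norm v)\<^sup>2 \<le> Re (cdot v (M *v v))"
  shows "m * (norm X)\<^sup>2 \<le> rtr (ct X ** M ** X)"
proof -
  have "m * (norm X)\<^sup>2 = (\<Sum>j\<in>UNIV. m * (norm (X *v axis j 1))\<^sup>2)"
    by (simp add: norm_matrix_columns sum_distrib_left)
  also have "\<dots> \<le> (\<Sum>j\<in>UNIV. inner (X *v axis j 1) (M *v (X *v axis j 1)))"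
    by (intro sum_mono) (simp add: assms inner_cdot)
  also have "\<dots> = inner X (M ** X)"
    by (simp add: inner_matrix_columns matrix_vector_mul_assoc)
  finally show ?thesis by (simp add: inner_rtr matrix_mul_assoc)
qed

lemma pos_def_ker: "pos_def M \<Longrightarrow> M *v v = 0 \<Longrightarrow> v = 0"
  unfolding pos_def_def by (metis cdot_zero_right less_irrefl zero_complex.simps(1))

lemma pos_def_cancel:
  fixes M X :: "complex^'N^'N"
  assumes "pos_def M" "M ** X = M ** Y" shows "X = Y"
proof -
  have "X - Y = 0"
  proof (rule matrix_eq_zeroI)
    fix v
    have "M *v ((X - Y) *v v) = 0"
      using assms(2) by (simp add: matrix_vector_mul_assoc mm.diff_right)
    then show "(X - Y) *v v = 0" by (rule pos_def_ker[OF assms(1)])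
  qed
  then show ?thesis by simp
qed

text \<open>The projector onto the range of \<open>Q\<close> that is self-adjoint for the inner
  product \<open>cdot x (M *v y)\<close>, encoded by equations that are closed in all three
  matrices; the measurability argument uses this relation, computations use the explicit solution
  \<open>mproj\<close>.\<close>

definition is_mproj :: "complex^'N^'N \<Rightarrow> complex^'N^'N \<Rightarrow> complex^'N^'N \<Rightarrow> bool" where
  "is_mproj M Q E \<longleftrightarrow> E ** Q = Q \<and> Q ** E = E \<and> M ** E = ct E ** M"

text \<open>For a frame \<open>V\<close> with \<open>Q = V ** ct V\<close> this is
  \<open>V (ct V M V)^-1 ct V M\<close>. Adding \<open>mat 1 - Q\<close> fills the kernel of
  \<open>Q ** M ** Q\<close>, so an ordinary inverse of a full square matrix suffices and the
  dependence on \<open>Q\<close> is rational.\<close>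

definition mproj :: "complex^'N^'N \<Rightarrow> complex^'N^'N \<Rightarrow> complex^'N^'N" where
  "mproj M Q = Q ** matrix_inv (Q ** M ** Q + mat 1 - Q) ** Q ** M"

text \<open>Projectors with the same range absorb each other, \<open>E ** E' = E'\<close> and
  \<open>E' ** E = E\<close>, and adjoints in the \<open>M\<close>-inner product reverse the order
  of such a product.\<close>

lemma is_mproj_unique:
  fixes M :: "complex^'N^'N"
  assumes M: "pos_def M" and 1: "is_mproj M Q E" and 2: "is_mproj M Q E'"
  shows "E = E'"
proof (rule pos_def_cancel[OF M])
  note d = 1[unfolded is_mproj_def] 2[unfolded is_mproj_def]
  have a: "E' ** E = E" using d by (metis matrix_mul_assoc)
  have b: "E ** E' = E'" using d by (metis matrix_mul_assoc)
  have "M ** E = M ** E' ** E" by (simp add: a matrix_mul_assoc[symmetric])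
  also have "\<dots> = ct E' ** (M ** E)" unfolding matrix_mul_assoc using d by simp
  also have "\<dots> = ct E' ** (ct E ** M)" using d by simp
  also have "\<dots> = ct (E ** E') ** M" by (simp add: matrix_mul_assoc ct_mult)
  also have "\<dots> = M ** E'" using b d by simp
  finally show "M ** E = M ** E'" .
qed

context
  fixes M Q :: "complex^'N^'N"
  assumes M: "pos_def M" and Q: "ct Q = Q" "Q ** Q = Q"
begin

abbreviation (input) "gram \<equiv> Q ** M ** Q + mat 1 - Q"

lemma gram_ker: "gram *v v = 0 \<Longrightarrow> v = 0"
proof -
  assume v: "gram *v v = 0"
  have "(mat 1 - Q) ** gram = mat 1 - Q" by (simp add: mm_simps Q Q(2)[THEN mm_absorb])
  then have "(mat 1 - Q) *v v = 0" by (metis v matrix_vector_mul_assoc mv.zero_right)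
  then have vQ: "Q *v v = v" by (simp add: mv.diff_left)
  have "Q ** gram = Q ** M ** Q" by (simp add: mm_simps Q Q(2)[THEN mm_absorb])
  then have "(Q ** M ** Q) *v v = 0" by (metis v matrix_vector_mul_assoc mv.zero_right)
  then have "Q *v (M *v v) = 0" by (metis matrix_vector_mul_assoc vQ)
  then have "cdot v (M *v v) = 0"
    by (metis Q(1) cdot_ct cdot_zero_right vQ)
  then show "v = 0" using M unfolding pos_def_def by (metis less_irrefl zero_complex.simps(1))
qed

lemma gram_inv: "gram ** matrix_inv gram = mat 1" "matrix_inv gram ** gram = mat 1"
  using inj_mm_invertible[OF gram_ker] by auto

lemma gram_inv_commute: "matrix_inv gram ** Q = Q ** matrix_inv gram"
  by (rule matrix_inv_commute[OF gram_inv]) (simp add: mm_simps Q Q(2)[THEN mm_absorb])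

lemma gram_inv_ct: "ct (matrix_inv gram) = matrix_inv gram"
proof -
  have "ct gram = gram" using pos_def_ct[OF M] by (simp add: ct_simps Q mm_simps)
  then have "ct (matrix_inv gram) ** gram = mat 1" by (metis ct_mult ct_mat1 gram_inv(1))
  then have "ct (matrix_inv gram) ** (gram ** matrix_inv gram) = matrix_inv gram"
    by (simp add: matrix_mul_assoc)
  then show ?thesis by (simp add: gram_inv)
qed

lemma gram_inv_QMQ: "matrix_inv gram ** (Q ** M ** Q) = Q" "Q ** M ** Q ** matrix_inv gram = Q"
proof -
  have g: "Q ** M ** Q = gram ** Q" by (simp add: mm_simps Q Q(2)[THEN mm_absorb])
  show "matrix_inv gram ** (Q ** M ** Q) = Q"
    by (subst g) (simp add: matrix_mul_assoc gram_inv)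
  have "Q ** M ** Q = Q ** gram" by (simp add: mm_simps Q Q(2)[THEN mm_absorb])
  then show "Q ** M ** Q ** matrix_inv gram = Q"
    by (metis matrix_mul_assoc gram_inv(1) matrix_mul_rid)
qed

lemma is_mproj_mproj: "is_mproj M Q (mproj M Q)"
proof -
  have "mproj M Q ** Q = Q ** (matrix_inv gram ** (Q ** M ** Q))"
    by (simp add: mproj_def matrix_mul_assoc)
  then have 1: "mproj M Q ** Q = Q" by (simp add: gram_inv_QMQ Q)
  have 2: "Q ** mproj M Q = mproj M Q" by (simp add: mproj_def matrix_mul_assoc Q)
  have 3: "ct (mproj M Q) ** M = M ** mproj M Q"
    by (simp add: mproj_def ct_mult gram_inv_ct Q pos_def_ct[OF M] matrix_mul_assoc)
  show ?thesis using 1 2 3 by (simp add: is_mproj_def)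
qed

end

section \<open>The pseudoinverse in the adaptive compression\<close>

lemma pinv_eqI:
  fixes A X :: "complex^'N^'N"
  assumes X: "A ** X ** A = A" "X ** A ** X = X" "hermitian (A ** X)" "hermitian (X ** A)"
  shows "pinv A = X"
  unfolding pinv_def
proof (rule the_equality)
  show "A ** X ** A = A \<and> X ** A ** X = X \<and> hermitian (A ** X) \<and> hermitian (X ** A)"
    using X by simp
  fix Y assume Y: "A ** Y ** A = A \<and> Y ** A ** Y = Y \<and> hermitian (A ** Y) \<and> hermitian (Y ** A)"
  have "A ** X = ct (A ** X)" using X by (simp add: hermitian_def)
  also have "\<dots> = ct ((A ** Y) ** (A ** X))" using Y by (simp add: matrix_mul_assoc)
  also have "\<dots> = A ** X ** (A ** Y)" using X Y by (subst ct_mult) (simp add: hermitian_def)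
  also have "\<dots> = A ** Y" using X by (simp add: matrix_mul_assoc)
  finally have 1: "A ** X = A ** Y" .
  have "X ** A = ct (X ** A)" using X by (simp add: hermitian_def)
  also have "\<dots> = ct ((X ** A) ** (Y ** A))" using Y by (metis matrix_mul_assoc)
  also have "\<dots> = Y ** A ** (X ** A)" using X Y by (subst ct_mult) (simp add: hermitian_def)
  also have "\<dots> = Y ** A" using X by (metis matrix_mul_assoc)
  finally have 2: "X ** A = Y ** A" .
  have "Y = Y ** A ** Y" using Y by simp
  also have "\<dots> = X ** A ** X" using 1 2 by (metis matrix_mul_assoc)
  finally show "Y = X" using X by simp
qed

text \<open>Both products of \<open>Q ** B ** Q\<close> with \<open>- (Q ** Gi ** Q)\<close> equal
  \<open>Q\<close>, from which all four Penrose equations follow. This is the only place where the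
  pseudoinverse is computed.\<close>

lemma adaptive_compression_eq:
  fixes B Q :: "complex^'N^'N"
  assumes B: "neg_def B" and Q: "ct Q = Q" "Q ** Q = Q"
  shows "adaptive_compression B Q = - (- B ** mproj (- B) Q)"
proof -
  define M where "M = - B"
  have M: "pos_def M" and BM: "B = - M" using B by (simp_all add: M_def neg_def_pos_def)
  define Gi where "Gi = matrix_inv (Q ** M ** Q + mat 1 - Q)"
  note g = gram_inv_QMQ[OF M Q, folded Gi_def] gram_inv_commute[OF M Q, folded Gi_def]
  have "pinv (Q ** B ** Q) = - (Q ** Gi ** Q)"
  proof (rule pinv_eqI)
    have a: "Q ** B ** Q ** - (Q ** Gi ** Q) = Q"
    proof -
      have "Q ** B ** Q ** - (Q ** Gi ** Q) = Q ** M ** Q ** Gi ** Q"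
        by (simp add: BM mm_simps Q(2)[THEN mm_absorb])
      then show ?thesis by (simp add: g Q)
    qed
    have b: "- (Q ** Gi ** Q) ** (Q ** B ** Q) = Q"
    proof -
      have "- (Q ** Gi ** Q) ** (Q ** B ** Q) = Q ** (Gi ** (Q ** M ** Q))"
        by (simp add: BM mm_simps Q(2)[THEN mm_absorb])
      then show ?thesis by (simp add: g Q)
    qed
    show "Q ** B ** Q ** - (Q ** Gi ** Q) ** (Q ** B ** Q) = Q ** B ** Q"
      unfolding a by (simp add: matrix_mul_assoc Q)
    show "- (Q ** Gi ** Q) ** (Q ** B ** Q) ** - (Q ** Gi ** Q) = - (Q ** Gi ** Q)"
      unfolding b by (simp add: mm_simps Q)
    show "hermitian (Q ** B ** Q ** - (Q ** Gi ** Q))" "hermitian (- (Q ** Gi ** Q) ** (Q ** B ** Q))"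
      unfolding a b by (simp_all add: hermitian_def Q)
  qed
  then show ?thesis
    by (simp add: adaptive_compression_def mproj_def M_def[symmetric] Gi_def BM mm_simps)
qed

section \<open>Variational principle and spectral projectors\<close>

text \<open>Bathtub principle: with \<open>d\<close> the indicator of the first \<open>n\<close>
  indices, each \<open>(l i - l n) * (r i - d i)\<close> is nonnegative, and the subtracted level
  \<open>l n\<close> cancels because \<open>r\<close> and \<open>d\<close> have the same
  sum.\<close>

lemma sum_mono_weights_le:
  fixes l r :: "nat \<Rightarrow> real"
  assumes mono: "\<And>i j. 1 \<le> i \<Longrightarrow> i \<le> j \<Longrightarrow> j \<le> N \<Longrightarrow> l i \<le> l j"
    and r: "\<And>i. i \<in> {1..N} \<Longrightarrow> 0 \<le> r i" "\<And>i. i \<in> {1..N} \<Longrightarrow> r i \<le> 1"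
    and s: "(\<Sum>i\<in>{1..N}. r i) = n" and n: "1 \<le> n" "n \<le> N"
  shows "(\<Sum>i\<in>{1..n}. l i) \<le> (\<Sum>i\<in>{1..N}. l i * r i)"
proof -
  define d where "d i = (if i \<le> n then 1 else 0::real)" for i
  have sub: "{1..N} \<inter> {i. i \<le> n} = {1..n}" using n by auto
  have "0 \<le> (\<Sum>i\<in>{1..N}. (l i - l n) * (r i - d i))"
  proof (rule sum_nonneg)
    fix i assume i: "i \<in> {1..N}"
    show "0 \<le> (l i - l n) * (r i - d i)"
    proof (cases "i \<le> n")
      case True
      then have "l i \<le> l n" using mono[of i n] i n by simp
      then show ?thesis using True r(2)[OF i] by (simp add: d_def mult_nonpos_nonpos)
    next
      case False
      then have "l n \<le> l i" using mono[of n i] i n by simp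
      then show ?thesis using False r(1)[OF i] by (simp add: d_def)
    qed
  qed
  also have "\<dots> = (\<Sum>i\<in>{1..N}. l i * r i) - (\<Sum>i\<in>{1..N}. l i * d i) - l n * ((\<Sum>i\<in>{1..N}. r i) - (\<Sum>i\<in>{1..N}. d i))"
    by (simp add: algebra_simps sum.distrib sum_subtractf sum_distrib_left)
  also have "(\<Sum>i\<in>{1..N}. d i) = n"
    unfolding d_def using sub by (simp add: sum.If_cases)
  also have "(\<Sum>i\<in>{1..N}. l i * d i) = (\<Sum>i\<in>{1..n}. l i)"
    unfolding d_def using sub by (simp add: if_distrib[of "\<lambda>x. _ * x"] sum.If_cases cong: if_cong)
  finally show ?thesis using s by simp
qed

text \<open>The diagonal entries of \<open>R\<close> in an eigenbasis of \<open>H\<close> lie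
  between 0 and 1 and add up to \<open>n\<close>, so \<open>sum_mono_weights_le\<close> applies to
  them.\<close>

lemma Ky_Fan:
  fixes H R :: "complex^'N^'N"
  assumes H: "hermitian H" and n: "1 \<le> n" "n \<le> CARD('N)" and R: "R \<in> projectors n"
  shows "(\<Sum>i\<in>{1..n}. eigval H i) \<le> rtr (R ** H)"
proof -
  let ?I = "{1..CARD('N)}"
  obtain w :: "nat \<Rightarrow> complex^'N" where w: "orthonormal_on w ?I"
    "\<And>i. i \<in> ?I \<Longrightarrow> H *v w i = of_real (eigval H i) *s w i"
    "\<And>i j. 1 \<le> i \<Longrightarrow> i \<le> j \<Longrightarrow> j \<le> CARD('N) \<Longrightarrow> eigval H i \<le> eigval H j"
    using hermitian_sorted_eigenbasis[OF H] by metis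
  define r where "r i = (norm (R *v w i))\<^sup>2" for i
  have one: "(\<Sum>i\<in>?I. outer (w i) (w i)) = mat 1"
    by (rule orthonormal_sum_outer[OF w(1)]) simp_all
  have cd: "Re (cdot x (R *v x)) = (norm (R *v x))\<^sup>2" for x
  proof -
    have "cdot x (R *v x) = cdot (R *v x) (R *v x)"
      by (simp add: cdot_ct projectors_ct[OF R] matrix_vector_mul_assoc projectors_idem[OF R])
    then show ?thesis by (simp add: cdot_self)
  qed
  have rt: "rtr (R ** X) = (\<Sum>i\<in>?I. Re (cdot (w i) (R *v (X *v w i))))" for X
  proof -
    have "R ** X = R ** X ** (\<Sum>i\<in>?I. outer (w i) (w i))" unfolding one by simp
    also have "\<dots> = (\<Sum>i\<in>?I. outer (R *v (X *v w i)) (w i))"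
      by (simp add: mm.sum_right mm_outer matrix_vector_mul_assoc)
    finally show ?thesis by (simp only: rtr_sum rtr_outer)
  qed
  have "real n = rtr (R ** mat 1)" using R by (simp add: projectors_rtr)
  also have "\<dots> = (\<Sum>i\<in>?I. r i)" unfolding rt[of "mat 1"] by (simp add: cd r_def)
  finally have sr: "(\<Sum>i\<in>?I. r i) = n" by simp
  have r1: "r i \<le> 1" if "i \<in> ?I" for i
  proof -
    have "r i = Re (cdot (w i) (R *v w i))" by (simp add: cd r_def)
    also have "\<dots> \<le> norm (w i) * norm (R *v w i)"
      using norm_cauchy_schwarz[of "w i" "R *v w i"] by (simp add: inner_cdot)
    also have "\<dots> = norm (R *v w i)" using orthonormal_norm[OF w(1) that] by simp
    finally have "norm (R *v w i) * norm (R *v w i) \<le> norm (R *v w i)"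
      by (simp add: r_def power2_eq_square)
    then have "norm (R *v w i) \<le> 1"
      by (cases "norm (R *v w i) = 0") (simp_all add: mult_le_cancel_left1)
    then show ?thesis by (simp add: r_def power_le_one)
  qed
  have "(\<Sum>i\<in>{1..n}. eigval H i) \<le> (\<Sum>i\<in>?I. eigval H i * r i)"
    by (rule sum_mono_weights_le[OF w(3) _ r1 sr n]) (simp_all add: r_def)
  also have "\<dots> = rtr (R ** H)"
    unfolding rt by (intro sum.cong refl) (simp add: w(2) vec.scale cdot_simps cd r_def)
  finally show ?thesis .
qed

text \<open>Variational substitute for the density matrix: it makes sense when the gap closes, holds
  for every admissible choice of eigenvectors, and survives limits.\<close>

definition ground_projector :: "nat \<Rightarrow> complex^'N^'N \<Rightarrow> complex^'N^'N \<Rightarrow> bool" where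
  "ground_projector n H P \<longleftrightarrow> P \<in> projectors n \<and> H ** P = P ** H \<and>
     (\<forall>R\<in>projectors n. rtr (P ** H) \<le> rtr (R ** H))"

lemma ground_projector_sum_outer:
  fixes H :: "complex^'N^'N"
  assumes H: "hermitian H" and n: "1 \<le> n" "n \<le> CARD('N)"
    and u: "orthonormal_on u {1..n}"
      "\<And>i. i \<in> {1..n} \<Longrightarrow> H *v u i = of_real (eigval H i) *s u i"
  shows "ground_projector n H (\<Sum>i\<in>{1..n}. outer (u i) (u i))" (is "ground_projector n H ?P")
proof -
  have ou: "?P \<in> projectors n" using sum_outer_in_projectors[OF u(1)] by simp
  have 1: "H ** ?P = (\<Sum>i\<in>{1..n}. outer (of_real (eigval H i) *s u i) (u i))"
    by (simp add: mm.sum_right mm_outer u(2))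
  have 2: "?P ** H = (\<Sum>i\<in>{1..n}. outer (of_real (eigval H i) *s u i) (u i))"
    using H by (simp add: mm.sum_left outer_mm' hermitian_def u(2))
      (simp add: outer_def vec_eq_iff mult_ac)
  have "rtr (?P ** H) = (\<Sum>i\<in>{1..n}. eigval H i)"
    unfolding 2 rtr_sum rtr_outer using u(1)
    by (intro sum.cong) (auto simp: cdot_simps orthonormal_on_def)
  then show ?thesis
    unfolding ground_projector_def using ou 1 2 Ky_Fan[OF H n] by auto
qed

lemma density_matrix_exists:
  fixes H :: "complex^'N^'N"
  assumes H: "hermitian H" and n: "1 \<le> n" "n < CARD('N)" and gap: "eigval H n < eigval H (n + 1)"
    and w: "orthonormal_on w {1..CARD('N)}"
      "\<And>i. i \<in> {1..CARD('N)} \<Longrightarrow> H *v w i = of_real (eigval H i) *s w i"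
      "\<And>i j. 1 \<le> i \<Longrightarrow> i \<le> j \<Longrightarrow> j \<le> CARD('N) \<Longrightarrow> eigval H i \<le> eigval H j"
  shows "is_density_matrix n H (\<Sum>i\<in>{1..n}. outer (w i) (w i))" (is "is_density_matrix n H ?P")
proof -
  have sub: "{1..n} \<subseteq> {1..CARD('N)}" using n by auto
  have ow: "orthonormal_on w {1..n}" by (rule orthonormal_on_subset[OF w(1) sub])
  have "?P \<in> projectors n" using sum_outer_in_projectors[OF ow] by simp
  then have "orth_projector ?P" by (simp add: projectors_def)
  moreover have "range (\<lambda>v. ?P *v v) = vec.span (w ` {1..n})"
    by (rule sum_outer_range[OF ow]) simp_all
  moreover have "vec.span (w ` {1..n}) = vec.span (\<Union>i\<in>{1..n}. eigenspace H (eigval H i))"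
  proof
    show "vec.span (w ` {1..n}) \<subseteq> vec.span (\<Union>i\<in>{1..n}. eigenspace H (eigval H i))"
      using w(2) sub by (intro vec.span_mono) (auto simp: eigenspace_def)
    have "eigenspace H (eigval H i) \<subseteq> vec.span (w ` {1..n})" if i: "i \<in> {1..n}" for i
    proof -
      have "eigenspace H (eigval H i) = vec.span (w ` {j\<in>{1..CARD('N)}. eigval H j = eigval H i})"
        by (rule eigenspace_span[OF w(1)]) (simp_all add: w(2))
      also have "\<dots> \<subseteq> vec.span (w ` {1..n})"
      proof (intro vec.span_mono image_mono subsetI)
        fix j assume j: "j \<in> {j\<in>{1..CARD('N)}. eigval H j = eigval H i}"
        \<comment> \<open>By the strict gap a basis vector that shares one of the first
          \<open>n\<close> eigenvalues has itself an index at most \<open>n\<close>, whatever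
          coincidences occur below the gap.\<close>
        have "eigval H j < eigval H (n + 1)" using j w(3)[of i n] i n gap by auto
        then have "\<not> n + 1 \<le> j" using w(3)[of "n + 1" j] j n by force
        then show "j \<in> {1..n}" using j by auto
      qed
      finally show ?thesis .
    qed
    then show "vec.span (\<Union>i\<in>{1..n}. eigenspace H (eigval H i)) \<subseteq> vec.span (w ` {1..n})"
      by (intro vec.span_minimal[OF _ vec.subspace_span]) blast
  qed
  ultimately show ?thesis using gap by (simp add: is_density_matrix_def)
qed

section \<open>Matrices and projectors commuting with a matrix of simple spectrum\<close>

lemma simple_eigenvector:
  fixes w :: "nat \<Rightarrow> complex^'N"
  assumes w: "orthonormal_on w {1..CARD('N)}"
      "\<And>i. i \<in> {1..CARD('N)} \<Longrightarrow> K *v w i = of_real (eigval K i) *s w i"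
    and simple: "inj_on (eigval K) {1..CARD('N)}"
    and i: "i \<in> {1..CARD('N)}" and v: "K *v v = of_real (eigval K i) *s v"
  shows "\<exists>c. v = c *s w i"
proof -
  have "v \<in> eigenspace K (eigval K i)" using v by (simp add: eigenspace_def)
  also have "eigenspace K (eigval K i) = vec.span (w ` {j\<in>{1..CARD('N)}. eigval K j = eigval K i})"
    by (rule eigenspace_span[OF w(1)]) (simp_all add: w(2))
  also have "{j\<in>{1..CARD('N)}. eigval K j = eigval K i} = {i}"
    using inj_onD[OF simple _ _ i] i by blast
  finally show ?thesis by (auto simp: vec.span_singleton)
qed

lemma commuting_eigenvector:
  fixes w :: "nat \<Rightarrow> complex^'N"
  assumes w: "orthonormal_on w {1..CARD('N)}"
      "\<And>i. i \<in> {1..CARD('N)} \<Longrightarrow> K *v w i = of_real (eigval K i) *s w i"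
    and simple: "inj_on (eigval K) {1..CARD('N)}"
    and i: "i \<in> {1..CARD('N)}" and Y: "K ** Y = Y ** K"
  shows "\<exists>c. Y *v w i = c *s w i"
proof (rule simple_eigenvector[OF w simple i])
  have "K *v (Y *v w i) = Y *v (K *v w i)" by (simp add: matrix_vector_mul_assoc Y)
  then show "K *v (Y *v w i) = of_real (eigval K i) *s (Y *v w i)"
    by (simp add: w(2)[OF i] vec.scale)
qed

text \<open>The eigenspaces of \<open>K\<close> are lines, so each \<open>w i\<close> is an
  eigenvector of \<open>Q\<close>; idempotency leaves only the eigenvalues 0 and 1.\<close>

lemma simple_commuting_projector:
  fixes w :: "nat \<Rightarrow> complex^'N"
  assumes w: "orthonormal_on w {1..CARD('N)}"
      "\<And>i. i \<in> {1..CARD('N)} \<Longrightarrow> K *v w i = of_real (eigval K i) *s w i"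
    and simple: "inj_on (eigval K) {1..CARD('N)}"
    and Q: "Q \<in> projectors n" "K ** Q = Q ** K"
  shows "\<exists>J\<subseteq>{1..CARD('N)}. card J = n \<and> Q = (\<Sum>i\<in>J. outer (w i) (w i))"
proof -
  let ?I = "{1..CARD('N)}"
  have c01: "Q *v w i = 0 \<or> Q *v w i = w i" if i: "i \<in> ?I" for i
  proof -
    obtain c where c: "Q *v w i = c *s w i"
      using commuting_eigenvector[OF w simple i Q(2)] by blast
    have "Q *v (Q *v w i) = Q *v w i"
      by (simp add: matrix_vector_mul_assoc projectors_idem[OF Q(1)])
    then have "(c * c) *s w i = c *s w i" by (simp add: c vec.scale)
    moreover have "w i \<noteq> 0" using orthonormal_norm[OF w(1) i] by force
    ultimately have "c * c = c" by simp
    then show ?thesis using c by auto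
  qed
  let ?J = "{i\<in>?I. Q *v w i = w i}"
  have "Q = Q ** (\<Sum>i\<in>?I. outer (w i) (w i))"
    using orthonormal_sum_outer[OF w(1)] by simp
  also have "\<dots> = (\<Sum>i\<in>?I. outer (Q *v w i) (w i))" by (simp add: mm.sum_right mm_outer)
  also have "\<dots> = (\<Sum>i\<in>?J. outer (Q *v w i) (w i))"
  proof (rule sum.mono_neutral_right)
    show "\<forall>i\<in>?I - ?J. outer (Q *v w i) (w i) = 0"
    proof
      fix i assume "i \<in> ?I - ?J"
      then have "Q *v w i = 0" using c01 by auto
      then show "outer (Q *v w i) (w i) = 0" by (simp add: outer_def vec_eq_iff)
    qed
  qed auto
  also have "\<dots> = (\<Sum>i\<in>?J. outer (w i) (w i))" by (intro sum.cong) auto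
  finally have eq: "Q = (\<Sum>i\<in>?J. outer (w i) (w i))" .
  have "rtr Q = card ?J"
    by (rule sum_outer_rtr[OF _ _ eq]) (auto intro: orthonormal_on_subset[OF w(1)])
  then have "card ?J = n" using projectors_rtr[OF Q(1)] by simp
  with eq show ?thesis by (intro exI[of _ ?J]) auto
qed

lemma finite_commuting_projectors:
  fixes K :: "complex^'N^'N"
  assumes K: "hermitian K" and simple: "inj_on (eigval K) {1..CARD('N)}"
  shows "finite {Q \<in> projectors n. K ** Q = Q ** K}"
proof -
  obtain w :: "nat \<Rightarrow> complex^'N" where w: "orthonormal_on w {1..CARD('N)}"
    "\<And>i. i \<in> {1..CARD('N)} \<Longrightarrow> K *v w i = of_real (eigval K i) *s w i"
    using hermitian_sorted_eigenbasis[OF K] by metis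
  have "{Q \<in> projectors n. K ** Q = Q ** K} \<subseteq>
      (\<lambda>J. \<Sum>i\<in>J. outer (w i) (w i)) ` Pow {1..CARD('N)}"
  proof clarify
    fix Q assume "Q \<in> projectors n" "K ** Q = Q ** K"
    from simple_commuting_projector[OF w simple this]
    show "Q \<in> (\<lambda>J. \<Sum>i\<in>J. outer (w i) (w i)) ` Pow {1..CARD('N)}" by blast
  qed
  then show ?thesis by (rule finite_subset) simp
qed

text \<open>\<open>Q\<close> and \<open>Y\<close> are both diagonal in the eigenbasis of
  \<open>K\<close> and hence commute, while the off-diagonal form gives \<open>Y ** Q = Y\<close>
  and \<open>Q ** Y = 0\<close>. This is the nondegeneracy of the energy at a commuting
  projector.\<close>

lemma simple_commuting_offdiag_zero:
  fixes K :: "complex^'N^'N"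
  assumes K: "hermitian K" and simple: "inj_on (eigval K) {1..CARD('N)}"
    and Q: "Q \<in> projectors n" "K ** Q = Q ** K"
    and Y: "(mat 1 - Q) ** Y ** Q = Y" "K ** Y = Y ** K"
  shows "Y = 0"
proof -
  let ?I = "{1..CARD('N)}"
  obtain w :: "nat \<Rightarrow> complex^'N" where w: "orthonormal_on w ?I"
    "\<And>i. i \<in> ?I \<Longrightarrow> K *v w i = of_real (eigval K i) *s w i"
    using hermitian_sorted_eigenbasis[OF K] by metis
  note q = projectors_idem[OF Q(1)]
  have QY: "Q ** Y = 0" by (subst Y(1)[symmetric]) (simp add: mm_simps q)
  have YQ: "Y ** Q = Y" by (subst (1 2) Y(1)[symmetric]) (simp add: mm_simps q mm_absorb[OF q])
  have "Y *v w i = 0" if i: "i \<in> ?I" for i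
  proof -
    obtain c where c: "Y *v w i = c *s w i" using commuting_eigenvector[OF w simple i Y(2)] by blast
    obtain d where d: "Q *v w i = d *s w i" using commuting_eigenvector[OF w simple i Q(2)] by blast
    have "Y *v w i = (Y ** Q) *v w i" by (simp add: YQ)
    also have "\<dots> = (d * c) *s w i" by (simp add: matrix_vector_mul_assoc[symmetric] d c vec.scale)
    also have "\<dots> = (Q ** Y) *v w i"
      by (simp add: matrix_vector_mul_assoc[symmetric] d c vec.scale mult.commute)
    finally show ?thesis by (simp add: QY)
  qed
  then have "Y ** (\<Sum>i\<in>?I. outer (w i) (w i)) = 0"
    unfolding mm.sum_right mm_outer by (intro sum.neutral) (simp add: outer_def vec_eq_iff)
  then show ?thesis using orthonormal_sum_outer[OF w(1)] by simp
qed

text \<open>A commuting projector other than the lowest one occupies some level \<open>i\<close>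
  above \<open>n\<close> and leaves empty some level \<open>j\<close> at most \<open>n\<close>.
  Moving \<open>w i\<close> towards \<open>w j\<close> lowers the energy to second order, at the
  rate \<open>eigval K j - eigval K i\<close>.\<close>

lemma saddle_direction:
  fixes K :: "complex^'N^'N"
  assumes w: "orthonormal_on w {1..CARD('N)}"
      "\<And>i. i \<in> {1..CARD('N)} \<Longrightarrow> K *v w i = of_real (eigval K i) *s w i"
      "\<And>i j. 1 \<le> i \<Longrightarrow> i \<le> j \<Longrightarrow> j \<le> CARD('N) \<Longrightarrow> eigval K i \<le> eigval K j"
    and K: "hermitian K" and simple: "inj_on (eigval K) {1..CARD('N)}" and n: "n \<le> CARD('N)"
    and Q: "Q \<in> projectors n" "K ** Q = Q ** K" and ne: "Q \<noteq> (\<Sum>i\<in>{1..n}. outer (w i) (w i))"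
  shows "\<exists>Y. (mat 1 - Q) ** Y ** Q = Y \<and> inner Y (K ** Y - Y ** K) < 0"
proof -
  obtain J where J: "J \<subseteq> {1..CARD('N)}" "card J = n" "Q = (\<Sum>i\<in>J. outer (w i) (w i))"
    using simple_commuting_projector[OF w(1,2) simple Q] by blast
  have fJ: "finite J" using J(1) by (rule finite_subset) simp
  have "J \<noteq> {1..n}" using ne J(3) by blast
  then have "\<not> J \<subseteq> {1..n}" using J(2) card_subset_eq[of "{1..n}" J] by auto
  then obtain i where i: "i \<in> J" "i \<notin> {1..n}" by blast
  have "\<not> {1..n} \<subseteq> J" using \<open>J \<noteq> {1..n}\<close> J(2) fJ card_subset_eq[of J "{1..n}"] by auto
  then obtain j where j: "j \<in> {1..n}" "j \<notin> J" by blast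
  have iI: "i \<in> {1..CARD('N)}" and jI: "j \<in> {1..CARD('N)}" using i j J n by auto
  have "eigval K j \<le> eigval K i" using w(3)[of j i] i j iI by auto
  moreover have "eigval K j \<noteq> eigval K i" using simple iI jI i j unfolding inj_on_def by metis
  ultimately have lt: "eigval K j < eigval K i" by simp
  note on = orthonormal_on_subset[OF w(1) J(1)]
  have Qi: "Q *v w i = w i" by (rule sum_outer_fix[OF on fJ J(3) i(1)])
  have Qj: "Q *v w j = 0"
  proof (rule sum_outer_orth[OF on fJ J(3)])
    fix k assume "k \<in> J"
    then show "cdot (w k) (w j) = 0"
      using w(1) jI j(2) J(1) unfolding orthonormal_on_def by (metis subsetD)
  qed
  define Y where "Y = outer (w j) (w i)"
  have "(mat 1 - Q) ** Y ** Q = Y"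
    unfolding Y_def mm_outer outer_mm' projectors_ct[OF Q(1)] by (simp add: Qi Qj mv.diff_left)
  moreover have "inner Y (K ** Y - Y ** K) = eigval K j - eigval K i"
  proof -
    have nw: "cdot (w i) (w i) = 1" "cdot (w j) (w j) = 1"
      using w(1) iI jI by (simp_all add: orthonormal_on_def)
    have KY: "K ** Y = eigval K j *\<^sub>R Y"
      unfolding Y_def mm_outer w(2)[OF jI] by (simp add: outer_def vec_eq_iff scaleR_conv_of_real[where 'a = complex])
    have YK: "Y ** K = eigval K i *\<^sub>R Y"
      unfolding Y_def outer_mm' K[unfolded hermitian_def] w(2)[OF iI]
      by (simp add: outer_def vec_eq_iff scaleR_conv_of_real[where 'a = complex])
    have "inner Y Y = 1"
      unfolding Y_def inner_rtr ct_outer outer_mm by (simp add: nw rtr_outer)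
    then show ?thesis unfolding KY YK by (simp add: inner_diff_right)
  qed
  ultimately show ?thesis using lt by (intro exI[of _ Y]) simp
qed

text \<open>Away from small balls around the zeros, \<open>\<bar>g\<bar>\<close> has a positive
  minimum by compactness, so the sequence is eventually confined to these balls; its steps become
  too short to jump from one ball to another.\<close>

lemma tendsto_of_finite_limit_set:
  fixes x :: "nat \<Rightarrow> 'a::euclidean_space" and g :: "'a \<Rightarrow> real"
  assumes D: "compact D" and x: "\<And>k. x k \<in> D" and step: "(\<lambda>k. dist (x (Suc k)) (x k)) \<longlonglongrightarrow> 0"
    and g: "continuous_on D g" "(\<lambda>k. g (x k)) \<longlonglongrightarrow> 0"
    and fin: "finite {q\<in>D. g q = 0}"
  shows "\<exists>L\<in>D. g L = 0 \<and> x \<longlonglongrightarrow> L"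
proof -
  let ?Z = "{q\<in>D. g q = 0}"
  obtain L r where L: "L \<in> D" "strict_mono (r :: nat \<Rightarrow> nat)" "(x \<circ> r) \<longlonglongrightarrow> L"
    using D x unfolding compact_def by metis
  have "(\<lambda>k. g (x (r k))) \<longlonglongrightarrow> g L"
    using continuous_on_tendsto_compose[OF g(1) L(3) L(1)] x by (simp add: o_def)
  moreover have "(\<lambda>k. g (x (r k))) \<longlonglongrightarrow> 0"
    using LIMSEQ_subseq_LIMSEQ[OF g(2) L(2)] by (simp add: o_def)
  ultimately have gL: "g L = 0" by (rule LIMSEQ_unique)
  obtain s where s: "s > 0" "\<And>q. q \<in> ?Z \<Longrightarrow> q \<noteq> L \<Longrightarrow> s \<le> dist L q"
    using finite_set_avoid[OF fin, of L] by auto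
  have "x \<longlonglongrightarrow> L"
    unfolding lim_sequentially
  proof (intro allI impI)
    fix e :: real assume "e > 0"
    \<comment> \<open>The divisor 3: an iterate within \<open>d\<close> of \<open>L\<close>, a step
      below \<open>d\<close> and a next ball of radius \<open>d\<close> around \<open>q\<close> give
      \<open>dist L q < 3 * d\<close>, which forces \<open>q = L\<close>.\<close>
    define d where "d = min e (s / 3)"
    have d: "d > 0" "d \<le> e" "3 * d \<le> s" using \<open>e > 0\<close> s(1) by (auto simp: d_def)
    let ?D = "D - (\<Union>q\<in>?Z. ball q d)"
    have cD: "compact ?D" by (rule compact_diff[OF D]) auto
    have "\<forall>\<^sub>F k in sequentially. x k \<in> (\<Union>q\<in>?Z. ball q d)"
    proof (cases "?D = {}")
      case True
      then show ?thesis using x by (intro always_eventually) blast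
    next
      case False
      have "continuous_on ?D (\<lambda>y. \<bar>g y\<bar>)"
        using g(1) by (intro continuous_intros continuous_on_subset[OF g(1)]) auto
      then obtain y where y: "y \<in> ?D" "\<And>z. z \<in> ?D \<Longrightarrow> \<bar>g y\<bar> \<le> \<bar>g z\<bar>"
        using continuous_attains_inf[OF cD False, of "\<lambda>y. \<bar>g y\<bar>"] by meson
      have "g y \<noteq> 0" using y(1) d(1) by auto
      then have "\<forall>\<^sub>F k in sequentially. dist (g (x k)) 0 < \<bar>g y\<bar>"
        using g(2) by (intro tendstoD) auto
      then show ?thesis
      proof (rule eventually_mono)
        fix k assume "dist (g (x k)) 0 < \<bar>g y\<bar>"
        then have "x k \<notin> ?D" using y(2)[of "x k"] by auto
        then show "x k \<in> (\<Union>q\<in>?Z. ball q d)" using x[of k] by blast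
      qed
    qed
    moreover have "\<forall>\<^sub>F k in sequentially. dist (x (Suc k)) (x k) < d"
      using tendstoD[OF step d(1)] by simp
    ultimately obtain k0 where k0: "\<And>k. k \<ge> k0 \<Longrightarrow> x k \<in> (\<Union>q\<in>?Z. ball q d)"
        "\<And>k. k \<ge> k0 \<Longrightarrow> dist (x (Suc k)) (x k) < d"
      unfolding eventually_sequentially by (metis (no_types, lifting) le_cases order_trans)
    have "\<forall>\<^sub>F k in sequentially. dist ((x \<circ> r) k) L < d" using tendstoD[OF L(3) d(1)] .
    then obtain k1 where k1: "\<And>k. k \<ge> k1 \<Longrightarrow> dist (x (r k)) L < d"
      unfolding eventually_sequentially by auto
    define m where "m = r (max k0 k1)"
    have m: "m \<ge> k0" "dist (x m) L < d"
      using k1[of "max k0 k1"] seq_suble[OF L(2), of "max k0 k1"] by (auto simp: m_def)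
    have "dist (x k) L < d" if "k \<ge> m" for k
      using that
    proof (induction k rule: dec_induct)
      case base
      show ?case by (rule m)
    next
      case (step k)
      have "Suc k \<ge> k0" "k \<ge> k0" using step m by auto
      then obtain q where q: "q \<in> ?Z" "dist q (x (Suc k)) < d" using k0(1) by fastforce
      have "dist L q \<le> dist (x k) L + (dist (x (Suc k)) (x k) + dist q (x (Suc k)))"
        using dist_triangle[of L q "x k"] dist_triangle[of "x k" q "x (Suc k)"]
        by (simp add: dist_commute)
      also have "\<dots> < 3 * d" using step.IH q(2) k0(2)[OF \<open>k \<ge> k0\<close>] by simp
      finally have "q = L" using s(2)[OF q(1)] d(3) by fastforce
      then show ?case using q(2) by (simp add: dist_commute)
    qed
    then show "\<exists>no. \<forall>k\<ge>no. dist (x k) L < e" using d(2) by (meson less_le_trans)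
  qed
  then show ?thesis using L(1) gL by blast
qed

lemma mm_norm_bound:
  obtains k where "k > 0" "\<And>(a :: complex^'N^'N) (b :: complex^'N^'N). norm (a ** b) \<le> norm a * norm b * k"
proof -
  have "\<exists>k>0. \<forall>(a :: complex^'N^'N) (b :: complex^'N^'N). norm (a ** b) \<le> norm a * norm b * k" by (rule mm.pos_bounded)
  then show thesis using that by metis
qed

section \<open>Energy decrease and convergence of orbits\<close>

text \<open>\<open>M\<close> plays the role of \<open>- B\<close>. The locale is also entered with
  \<open>A = 0\<close>, to borrow its facts about the dependence of \<open>mproj M\<close> on the
  projector.\<close>

locale scf =
  fixes A M :: "complex^'N^'N" and n :: nat
  assumes A: "ct A = A" and M: "pos_def M"
begin

abbreviation (input) D where "D \<equiv> projectors n :: (complex^'N^'N) set"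
abbreviation (input) E where "E \<equiv> mproj M"

definition K where "K = A - M"
definition S where "S Q = M - M ** E Q"
definition H where "H Q = A - M ** E Q"

lemma H_eq: "H Q = K + S Q"
  by (simp add: H_def K_def S_def)

lemma ctM: "ct M = M" by (rule pos_def_ct[OF M])

lemma ctK: "ct K = K"
  by (simp add: K_def ct_simps A ctM)

lemma
  assumes "Q \<in> D"
  shows E_Q: "E Q ** Q = Q" and Q_E: "Q ** E Q = E Q" and M_E: "ct (E Q) ** M = M ** E Q"
  using is_mproj_mproj[OF M projectors_ct[OF assms] projectors_idem[OF assms]]
  by (simp_all add: is_mproj_def)

lemma E_E: "Q \<in> D \<Longrightarrow> E Q ** E Q = E Q"
  by (metis E_Q Q_E matrix_mul_assoc)

lemma ct_ME: "Q \<in> D \<Longrightarrow> ct (M ** E Q) = M ** E Q"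
  by (simp add: ct_mult ctM M_E)

lemma S_eq: "Q \<in> D \<Longrightarrow> S Q = ct (mat 1 - E Q) ** M ** (mat 1 - E Q)"
  by (simp add: S_def ct_simps mm_simps M_E mm_absorb[OF E_E])

lemma S_Q: "Q \<in> D \<Longrightarrow> S Q ** Q = 0"
  by (simp add: S_def mm_simps mm_absorb[OF E_Q])

lemma ct_S: "Q \<in> D \<Longrightarrow> ct (S Q) = S Q"
  by (simp add: S_def ct_diff ctM ct_ME)

lemma Q_S: "Q \<in> D \<Longrightarrow> Q ** S Q = 0"
  using S_Q[of Q] ct_S[of Q] projectors_ct[of Q n] by (metis ct_mult ct_zero)

lemma ct_H: "Q \<in> D \<Longrightarrow> ct (H Q) = H Q"
  by (simp add: H_eq ct_add ctK ct_S)

text \<open>A first-order formula without remainder. It holds because \<open>E Q\<close> and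
  \<open>E R\<close> fix their ranges and \<open>M\<close>-self-adjointness exchanges
  \<open>E R ** E Q\<close> with \<open>E Q ** E R\<close>. It yields the Lipschitz bound as well as
  limits of difference quotients with both end points moving.\<close>

lemma mproj_diff:
  assumes Q: "Q \<in> D" and R: "R \<in> D"
  shows "M ** E R - M ** E Q = M ** (mat 1 - E R) ** (R - Q) ** E Q + ct (M ** (mat 1 - E Q) ** (R - Q) ** E R)"
proof -
  have 1: "(mat 1 - E R) ** (R - Q) ** E Q = E R ** E Q - E Q"
    by (simp add: mm_simps E_Q[OF R] mm_absorb[OF Q_E[OF Q]] Q_E[OF Q])
  have 2: "(mat 1 - E Q) ** (R - Q) ** E R = E R - E Q ** E R"
    by (simp add: mm_simps E_Q[OF Q] mm_absorb[OF Q_E[OF R]] Q_E[OF R])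
  have "M ** (mat 1 - E R) ** (R - Q) ** E Q = M ** ((mat 1 - E R) ** (R - Q) ** E Q)"
    by (simp add: matrix_mul_assoc)
  moreover have "ct (M ** (mat 1 - E Q) ** (R - Q) ** E R) = ct ((mat 1 - E Q) ** (R - Q) ** E R) ** M"
    by (simp add: matrix_mul_assoc[symmetric] ct_mult ctM)
  moreover have "ct (E R) ** ct (E Q) ** M = M ** E R ** E Q"
    by (metis M_E[OF Q] M_E[OF R] matrix_mul_assoc)
  ultimately show ?thesis
    unfolding 1 2 by (simp add: mm_simps ct_simps M_E[OF R])
qed

text \<open>Coercivity bounds \<open>m * (norm (E Q))\<^sup>2\<close> by
  \<open>rtr (M ** E Q)\<close>, which is at most \<open>rtr M\<close> because \<open>S Q\<close> is
  positive semidefinite. The summand 1 makes the constant positive.\<close>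

lemma E_bounded:
  obtains C where "C > 0" "\<And>Q. Q \<in> D \<Longrightarrow> norm (E Q) \<le> C"
proof -
  obtain m where m: "m > 0" "\<And>v. m * (norm v)\<^sup>2 \<le> Re (cdot v (M *v v))"
    using pos_def_coercive[OF M] by blast
  have "norm (E Q) \<le> sqrt (rtr M / m) + 1" if Q: "Q \<in> D" for Q
  proof -
    have "m * (norm (E Q))\<^sup>2 \<le> rtr (ct (E Q) ** M ** E Q)" by (rule coercive_matrix[OF m(2)])
    also have "\<dots> = rtr (M ** E Q)" by (simp add: M_E[OF Q] mm_absorb[OF E_E[OF Q]])
    also have "0 \<le> m * (norm (mat 1 - E Q))\<^sup>2" using m by simp
    then have "0 \<le> rtr (S Q)" unfolding S_eq[OF Q] using coercive_matrix[OF m(2)] order_trans by blast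
    then have "rtr (M ** E Q) \<le> rtr M" by (simp add: S_def rtr_diff)
    finally have "(norm (E Q))\<^sup>2 \<le> rtr M / m" using m(1) by (simp add: field_simps)
    then show ?thesis using real_le_rsqrt by fastforce
  qed
  moreover have "sqrt (rtr M / m) + 1 > 0"
  proof -
    have "0 \<le> m * (norm (mat 1 :: complex^'N^'N))\<^sup>2" using m by simp
    also have "\<dots> \<le> rtr M" using coercive_matrix[OF m(2), of "mat 1"] by (simp add: ct_mat1)
    finally have "0 \<le> sqrt (rtr M / m)" using m(1) by simp
    then show ?thesis by linarith
  qed
  ultimately show thesis by (intro that) auto
qed

lemma M_inv: "matrix_inv M ** (M ** X) = X"
proof -
  have "matrix_inv M ** M = mat 1" by (rule inj_mm_invertible(2)[OF pos_def_ker[OF M]])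
  then show ?thesis by (simp add: matrix_mul_assoc)
qed

lemma E_lipschitz:
  obtains C where "\<And>Q R. Q \<in> D \<Longrightarrow> R \<in> D \<Longrightarrow> norm (E R - E Q) \<le> C * norm (R - Q)"
proof -
  obtain C where C: "C > 0" "\<And>Q. Q \<in> D \<Longrightarrow> norm (E Q) \<le> C" using E_bounded by blast
  obtain k where k: "k > 0" "\<And>(a :: complex^'N^'N) (b :: complex^'N^'N). norm (a ** b) \<le> norm a * norm b * k"
    by (rule mm_norm_bound) blast
  define c where "c = norm M * (norm (mat 1 :: complex^'N^'N) + C) * k"
  have b: "norm (M ** (mat 1 - E Q) ** X ** E R) \<le> c * norm X * k * C * k"
    if "Q \<in> D" "R \<in> D" for Q R X
  proof -
    have "norm (mat 1 - E Q) \<le> norm (mat 1 :: complex^'N^'N) + C"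
      using norm_triangle_ineq4[of "mat 1" "E Q"] C(2)[OF that(1)] by linarith
    then have 1: "norm (M ** (mat 1 - E Q)) \<le> c"
      unfolding c_def using k by (intro order_trans[OF k(2)] mult_right_mono mult_left_mono) auto
    have "norm (M ** (mat 1 - E Q) ** X) \<le> norm (M ** (mat 1 - E Q)) * norm X * k"
      by (rule k(2))
    also have "\<dots> \<le> c * norm X * k" using k(1) 1 by (intro mult_right_mono) auto
    finally have 2: "norm (M ** (mat 1 - E Q) ** X) \<le> c * norm X * k" .
    have "norm (M ** (mat 1 - E Q) ** X ** E R) \<le> norm (M ** (mat 1 - E Q) ** X) * norm (E R) * k"
      by (rule k(2))
    also have "\<dots> \<le> c * norm X * k * C * k"
      using k(1) 2 C(2)[OF that(2)] order_trans[OF norm_ge_zero 2] by (intro mult_right_mono mult_mono) auto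
    finally show ?thesis .
  qed
  show thesis
  proof (rule that)
    fix Q R assume Q: "Q \<in> D" and R: "R \<in> D"
    have "norm (M ** E R - M ** E Q) \<le> c * norm (R - Q) * k * C * k + c * norm (R - Q) * k * C * k"
      unfolding mproj_diff[OF Q R]
      by (rule order_trans[OF norm_triangle_ineq]) (intro add_mono b Q R, simp add: norm_ct b Q R)
    then have 1: "norm (M ** (E R - E Q)) \<le> 2 * (c * norm (R - Q) * k * C * k)"
      unfolding mm.diff_right mult_2 .
    have "norm (E R - E Q) = norm (matrix_inv M ** (M ** (E R - E Q)))" by (simp only: M_inv)
    also have "\<dots> \<le> norm (matrix_inv M) * norm (M ** (E R - E Q)) * k" by (rule k(2))
    also have "\<dots> \<le> norm (matrix_inv M) * (2 * (c * norm (R - Q) * k * C * k)) * k"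
      using 1 k(1) by (intro mult_right_mono mult_left_mono) auto
    finally show "norm (E R - E Q) \<le> (norm (matrix_inv M) * (2 * c * k * C * k) * k) * norm (R - Q)"
      by (simp add: mult_ac)
  qed
qed

lemma E_tendsto:
  assumes Q: "\<And>j. Q j \<in> D" "Q \<longlonglongrightarrow> P" and P: "P \<in> D"
  shows "(\<lambda>j. E (Q j)) \<longlonglongrightarrow> E P"
proof -
  obtain C where C: "\<And>Q R. Q \<in> D \<Longrightarrow> R \<in> D \<Longrightarrow> norm (E R - E Q) \<le> C * norm (R - Q)"
    using E_lipschitz by blast
  have "(\<lambda>j. Q j - P) \<longlonglongrightarrow> 0" using Q(2) by (simp add: LIM_zero)
  then have "(\<lambda>j. E (Q j) - E P) \<longlonglongrightarrow> 0"
    by (rule tendsto_0_le[where K = C]) (use C[OF P Q(1)] in \<open>simp add: mult.commute\<close>)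
  then show ?thesis by (simp add: LIM_zero_iff)
qed

lemma H_tendsto:
  assumes "\<And>j. Q j \<in> D" "Q \<longlonglongrightarrow> P" "P \<in> D"
  shows "(\<lambda>j. H (Q j)) \<longlonglongrightarrow> H P"
  unfolding H_def by (intro tendsto_intros mm.tendsto E_tendsto assms)

lemma one_minus_Q_E: "Q \<in> D \<Longrightarrow> (mat 1 - Q) ** (mat 1 - E Q) = mat 1 - Q"
  by (simp add: mm_simps Q_E)

lemma commutator_H: "Q \<in> D \<Longrightarrow> H Q ** Q - Q ** H Q = K ** Q - Q ** K"
  by (simp add: H_eq mm_simps S_Q Q_S)

text \<open>\<open>P\<close> is compared with \<open>Q\<close> itself, where the correction
  vanishes: \<open>rtr (Q ** H Q) = rtr (Q ** K)\<close>. The correction left over at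
  \<open>P\<close> is at least \<open>m * (norm ((mat 1 - E Q) ** P))\<^sup>2\<close>, and it
  controls the step because \<open>(mat 1 - Q) ** (mat 1 - E Q) = mat 1 - Q\<close>.\<close>

lemma energy_decrease:
  obtains c where "c > 0" "\<And>Q P. Q \<in> D \<Longrightarrow> ground_projector n (H Q) P \<Longrightarrow>
    rtr (P ** K) + c * (norm (P - Q))\<^sup>2 \<le> rtr (Q ** K)"
proof -
  obtain m where m: "m > 0" "\<And>v. m * (norm v)\<^sup>2 \<le> Re (cdot v (M *v v))"
    using pos_def_coercive[OF M] by blast
  have "bounded D" by (rule compact_imp_bounded[OF compact_projectors])
  then obtain b where b: "\<And>Q. Q \<in> D \<Longrightarrow> norm Q \<le> b" unfolding bounded_iff by blast
  obtain k where k: "k > 0" "\<And>(a :: complex^'N^'N) (b :: complex^'N^'N). norm (a ** b) \<le> norm a * norm b * k"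
    by (rule mm_norm_bound) blast
  \<comment> \<open>The square bounds multiplication by \<open>mat 1 - Q\<close>, the factor 2 comes
    from \<open>norm_diff_projectors\<close>, and the summand 1 makes \<open>a\<close>
    positive.\<close>
  define a where "a = ((norm (mat 1 :: complex^'N^'N) + \<bar>b\<bar>) * k)\<^sup>2 * 2 + 1"
  have a: "a > 0" by (simp add: a_def add_nonneg_pos)
  show thesis
  proof (rule that[of "m / a"])
    show "m / a > 0" using m a by simp
    fix Q P assume Q: "Q \<in> D" and g: "ground_projector n (H Q) P"
    have P: "P \<in> D" and min: "rtr (P ** H Q) \<le> rtr (Q ** H Q)"
      using g Q unfolding ground_projector_def by auto
    let ?X = "(mat 1 - E Q) ** P"
    have "norm ((mat 1 - Q) ** P) = norm ((mat 1 - Q) ** ?X)"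
      by (simp add: matrix_mul_assoc one_minus_Q_E Q)
    also have "\<dots> \<le> norm (mat 1 - Q) * norm ?X * k" by (rule k(2))
    also have "\<dots> \<le> (norm (mat 1 :: complex^'N^'N) + \<bar>b\<bar>) * norm ?X * k"
      using k(1) b[OF Q] norm_triangle_ineq4[of "mat 1" Q] by (intro mult_right_mono) auto
    finally have "(norm ((mat 1 - Q) ** P))\<^sup>2 \<le> ((norm (mat 1 :: complex^'N^'N) + \<bar>b\<bar>) * norm ?X * k)\<^sup>2"
      by (rule power_mono) simp
    then have "(norm (P - Q))\<^sup>2 \<le> 2 * ((norm (mat 1 :: complex^'N^'N) + \<bar>b\<bar>) * norm ?X * k)\<^sup>2"
      unfolding norm_diff_projectors[OF P Q] by simp
    also have "\<dots> = (a - 1) * (norm ?X)\<^sup>2" by (simp add: a_def power_mult_distrib)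
    also have "\<dots> \<le> a * (norm ?X)\<^sup>2" by (intro mult_right_mono) simp_all
    finally have "m / a * (norm (P - Q))\<^sup>2 \<le> m / a * (a * (norm ?X)\<^sup>2)"
      using m a by (intro mult_left_mono) auto
    also have "\<dots> = m * (norm ?X)\<^sup>2" using a by simp
    also have "\<dots> \<le> rtr (ct ?X ** M ** ?X)" by (rule coercive_matrix[OF m(2)])
    also have "ct ?X ** M ** ?X = P ** S Q ** P"
      by (simp add: S_eq[OF Q] ct_mult projectors_ct[OF P] matrix_mul_assoc)
    also have "rtr (P ** S Q ** P) = rtr (P ** (P ** S Q))" by (rule rtr_commute)
    also have "P ** (P ** S Q) = P ** S Q" by (simp add: matrix_mul_assoc projectors_idem[OF P])
    finally have 1: "m / a * (norm (P - Q))\<^sup>2 \<le> rtr (P ** S Q)" .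
    have 2: "rtr (P ** H Q) = rtr (P ** K) + rtr (P ** S Q)"
      by (simp add: H_eq mm.add_right rtr_add)
    have 3: "rtr (Q ** H Q) = rtr (Q ** K)" by (simp add: H_eq mm.add_right Q_S[OF Q])
    show "rtr (P ** K) + m / a * (norm (P - Q))\<^sup>2 \<le> rtr (Q ** K)" using 1 2 3 min by linarith
  qed
qed

theorem orbit_converges:
  assumes fin: "finite {Q \<in> D. K ** Q = Q ** K}"
    and x: "x 0 \<in> D" "\<And>k. x k \<in> D \<Longrightarrow> ground_projector n (H (x k)) (x (Suc k))"
  shows "\<exists>L\<in>D. K ** L = L ** K \<and> ground_projector n (H L) L \<and> x \<longlonglongrightarrow> L"
proof -
  have xD: "x k \<in> D" for k
    by (induction k) (use x in \<open>auto simp: ground_projector_def\<close>)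
  have gp: "ground_projector n (H (x k)) (x (Suc k))" for k by (rule x(2)[OF xD])
  obtain c where c: "c > 0" "\<And>Q P. Q \<in> D \<Longrightarrow> ground_projector n (H Q) P \<Longrightarrow>
    rtr (P ** K) + c * (norm (P - Q))\<^sup>2 \<le> rtr (Q ** K)" using energy_decrease by blast
  define e where "e k = rtr (x k ** K)" for k
  have dec: "e (Suc k) + c * (norm (x (Suc k) - x k))\<^sup>2 \<le> e k" for k
    unfolding e_def by (rule c(2)[OF xD gp])
  have "bounded ((\<lambda>Q. rtr (Q ** K)) ` D)"
    by (intro compact_imp_bounded compact_continuous_image continuous_on_rtr mm.continuous_on
        continuous_on_id continuous_on_const compact_projectors)
  then obtain b where b0: "\<And>Q. Q \<in> D \<Longrightarrow> \<bar>rtr (Q ** K)\<bar> \<le> b"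
    unfolding bounded_iff by auto
  have b: "\<bar>e k\<bar> \<le> b" for k unfolding e_def by (rule b0[OF xD])
  have "decseq e"
  proof (rule decseq_SucI)
    fix k
    have "0 \<le> c * (norm (x (Suc k) - x k))\<^sup>2" using c(1) by simp
    then show "e (Suc k) \<le> e k" using dec[of k] by linarith
  qed
  moreover have "- b \<le> e k" for k using b[of k] by linarith
  ultimately obtain l where l: "e \<longlonglongrightarrow> l" using decseq_convergent[of e "- b"] by metis
  have "(\<lambda>k. (e k - e (Suc k)) / c) \<longlonglongrightarrow> (l - l) / c"
    by (intro tendsto_intros l LIMSEQ_Suc) (use c(1) in auto)
  then have lim0: "(\<lambda>k. (e k - e (Suc k)) / c) \<longlonglongrightarrow> 0" by simp
  have "(norm (x (Suc k) - x k))\<^sup>2 \<le> (e k - e (Suc k)) / c" for k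
    using dec[of k] c(1) by (simp add: pos_le_divide_eq mult.commute)
  then have "(\<lambda>k. (norm (x (Suc k) - x k))\<^sup>2) \<longlonglongrightarrow> 0"
    by (intro tendsto_sandwich[OF _ _ tendsto_const lim0] always_eventually allI) simp_all
  then have "(\<lambda>k. sqrt ((norm (x (Suc k) - x k))\<^sup>2)) \<longlonglongrightarrow> sqrt 0" by (intro tendsto_real_sqrt)
  then have step: "(\<lambda>k. norm (x (Suc k) - x k)) \<longlonglongrightarrow> 0" by simp
  then have step0: "(\<lambda>k. x k - x (Suc k)) \<longlonglongrightarrow> 0"
    by (simp add: norm_minus_commute tendsto_norm_zero_iff)
  obtain C where C: "C > 0" "\<And>Q. Q \<in> D \<Longrightarrow> norm (E Q) \<le> C" using E_bounded by blast
  obtain k where k: "k > 0" "\<And>(a :: complex^'N^'N) (b :: complex^'N^'N). norm (a ** b) \<le> norm a * norm b * k"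
    by (rule mm_norm_bound) blast
  have Hb: "norm (H Q) \<le> norm A + norm M * C * k" if "Q \<in> D" for Q
  proof -
    have "norm (M ** E Q) \<le> norm M * C * k"
      using k C(2)[OF that] by (intro order_trans[OF k(2)] mult_right_mono mult_left_mono) auto
    then show ?thesis unfolding H_def using norm_triangle_ineq4[of A "M ** E Q"] by linarith
  qed
  \<comment> \<open>As \<open>x (Suc j)\<close> commutes with \<open>H (x j)\<close>, the commutator
    of \<open>K\<close> with \<open>x j\<close> equals that of \<open>H (x j)\<close> with the step
    \<open>x j - x (Suc j)\<close>; the first factor is bounded and the second tends to
    zero.\<close>
  have com: "K ** x j - x j ** K = H (x j) ** (x j - x (Suc j)) - (x j - x (Suc j)) ** H (x j)" for j
    using gp[of j] unfolding commutator_H[OF xD, symmetric] ground_projector_def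
    by (simp add: mm_simps)
  have z1: "(\<lambda>j. H (x j) ** (x j - x (Suc j))) \<longlonglongrightarrow> 0"
  proof (rule tendsto_0_le[OF step0, where K = "(norm A + norm M * C * k) * k"], intro always_eventually allI)
    fix j show "norm (H (x j) ** (x j - x (Suc j))) \<le> norm (x j - x (Suc j)) * ((norm A + norm M * C * k) * k)"
    proof -
      have "norm (H (x j) ** (x j - x (Suc j))) \<le> norm (H (x j)) * norm (x j - x (Suc j)) * k"
        by (rule k(2))
      also have "\<dots> \<le> (norm A + norm M * C * k) * norm (x j - x (Suc j)) * k"
        using Hb[OF xD] k(1) by (intro mult_right_mono) auto
      finally show ?thesis by (simp only: mult_ac)
    qed
  qed
  have z2: "(\<lambda>j. (x j - x (Suc j)) ** H (x j)) \<longlonglongrightarrow> 0"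
  proof (rule tendsto_0_le[OF step0, where K = "(norm A + norm M * C * k) * k"], intro always_eventually allI)
    fix j show "norm ((x j - x (Suc j)) ** H (x j)) \<le> norm (x j - x (Suc j)) * ((norm A + norm M * C * k) * k)"
    proof -
      have "norm ((x j - x (Suc j)) ** H (x j)) \<le> norm (x j - x (Suc j)) * norm (H (x j)) * k"
        by (rule k(2))
      also have "\<dots> \<le> norm (x j - x (Suc j)) * (norm A + norm M * C * k) * k"
        using Hb[OF xD] k(1) by (intro mult_right_mono mult_left_mono) auto
      finally show ?thesis by (simp only: mult_ac)
    qed
  qed
  have "(\<lambda>j. K ** x j - x j ** K) \<longlonglongrightarrow> 0" unfolding com using tendsto_diff[OF z1 z2] by simp
  then have g0: "(\<lambda>j. norm (K ** x j - x j ** K)) \<longlonglongrightarrow> 0" by (rule tendsto_norm_zero)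
  have "\<exists>L\<in>D. norm (K ** L - L ** K) = 0 \<and> x \<longlonglongrightarrow> L"
    by (rule tendsto_of_finite_limit_set[OF compact_projectors xD _ _ g0])
      (use step fin in \<open>auto simp: dist_norm intro!: continuous_intros mm.continuous_on\<close>)
  then obtain L where L: "L \<in> D" "K ** L = L ** K" "x \<longlonglongrightarrow> L" by auto
  have HL: "H L ** L = L ** H L" using commutator_H[OF L(1)] L(2) by simp
  \<comment> \<open>The limit minimises for its own matrix; this later supplies the nonnegative
    second variation at a saddle.\<close>
  have "rtr (L ** H L) \<le> rtr (R ** H L)" if R: "R \<in> D" for R
  proof (rule LIMSEQ_le)
    show "(\<lambda>k. rtr (x (Suc k) ** H (x k))) \<longlonglongrightarrow> rtr (L ** H L)"
      by (intro tendsto_rtr mm.tendsto H_tendsto xD L LIMSEQ_Suc)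
    show "(\<lambda>k. rtr (R ** H (x k))) \<longlonglongrightarrow> rtr (R ** H L)"
      by (intro tendsto_rtr mm.tendsto H_tendsto xD L tendsto_const)
    show "\<exists>N. \<forall>k\<ge>N. rtr (x (Suc k) ** H (x k)) \<le> rtr (R ** H (x k))"
      using gp R unfolding ground_projector_def by blast
  qed
  then have "ground_projector n (H L) L" using L HL by (simp add: ground_projector_def)
  then show ?thesis using L by blast
qed

end

section \<open>Local analysis of the iteration\<close>

text \<open>Exchanging one occupied unit vector for an unoccupied one gives a competitor of the same
  rank, so the quadratic form of \<open>h\<close> on the range of \<open>P\<close> lies below that
  on the kernel. One number separates the two, and it is tested column by column: the columns of
  \<open>ct Y\<close> lie in the range, those of \<open>Y\<close> in the kernel.\<close>

lemma ground_projector_second_variation: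
  fixes h P Y :: "complex^'N^'N"
  assumes g: "ground_projector n h P" and Y: "(mat 1 - P) ** Y ** P = Y"
  shows "0 \<le> inner Y (h ** Y - Y ** h)"
proof (cases "Y = 0")
  case False
  have P: "P \<in> projectors n" and min: "\<And>R. R \<in> projectors n \<Longrightarrow> rtr (P ** h) \<le> rtr (R ** h)"
    using g by (auto simp: ground_projector_def)
  note p = projectors_ct[OF P] projectors_idem[OF P]
  have PY: "P ** Y = 0" by (subst Y[symmetric]) (simp add: mm_simps p)
  have YP: "Y ** P = Y" by (subst (1 2) Y[symmetric]) (simp add: mm_simps p mm_absorb[OF p(2)])
  have swap: "inner x (h *v x) \<le> inner y (h *v y)"
    if x: "P *v x = x" "norm x = 1" and y: "P *v y = 0" "norm y = 1" for x y
  proof -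
    have cx: "cdot x x = 1" "cdot y y = 1" using x y by (simp_all add: cdot_self)
    have "cdot x y = cdot (P *v x) y" by (simp add: x)
    also have "\<dots> = 0" by (simp add: cdot_ct p y cdot_simps)
    finally have xy: "cdot x y = 0" "cdot y x = 0" by (simp_all add: cdot_commute[of y x])
    let ?R = "P - outer x x + outer y y"
    have o0: "outer 0 v = 0" "outer v 0 = 0" for v :: "complex^'N" by (simp_all add: outer_def vec_eq_iff)
    have "?R \<in> projectors n"
      unfolding projectors_iff
      by (simp add: ct_simps ct_outer p mm_simps mm_outer outer_mm' outer_mv x y cx xy o0 rtr_add rtr_diff rtr_outer
          projectors_rtr[OF P] cdot_simps
          mv.add_left mv.diff_left)
    from min[OF this] have "rtr (outer x x ** h) \<le> rtr (outer y y ** h)"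
      by (simp add: mm.add_left mm.diff_left rtr_add rtr_diff)
    moreover have "rtr (outer v v ** h) = inner v (h *v v)" for v
      unfolding rtr_commute[of _ h] mm_outer rtr_outer by (simp add: inner_cdot)
    ultimately show ?thesis by simp
  qed
  obtain j where "Y *v axis j 1 \<noteq> 0"
    using False norm_matrix_columns[of Y] by fastforce
  define y0 where "y0 = (1 / norm (Y *v axis j 1)) *\<^sub>R (Y *v axis j 1)"
  have y0: "P *v y0 = 0" "norm y0 = 1"
    using \<open>Y *v axis j 1 \<noteq> 0\<close>
    by (simp_all add: y0_def mv.scaleR_right matrix_vector_mul_assoc PY)
  let ?X = "{inner x (h *v x) | x. P *v x = x \<and> norm x = 1}"
  \<comment> \<open>The separating number: finite because a unit vector of the kernel such as
    \<open>y0\<close> bounds the set, and below all values on the kernel by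
    \<open>swap\<close>.\<close>
  define \<mu> where "\<mu> = Sup ?X"
  have bdd: "bdd_above ?X" using swap y0 by (intro bdd_aboveI[of _ "inner y0 (h *v y0)"]) auto
  have up: "inner x (h *v x) \<le> \<mu> * (norm x)\<^sup>2" if x: "P *v x = x" for x
  proof (cases "x = 0")
    case False
    let ?z = "(1 / norm x) *\<^sub>R x"
    have "inner ?z (h *v ?z) \<le> \<mu>"
      unfolding \<mu>_def using False x by (intro cSup_upper bdd) (auto simp: mv.scaleR_right intro!: exI[of _ ?z])
    moreover have "inner ?z (h *v ?z) = inner x (h *v x) / (norm x)\<^sup>2"
      by (simp add: mv.scaleR_right power2_eq_square)
    ultimately have "inner x (h *v x) / (norm x)\<^sup>2 \<le> \<mu>" by argo
    then show ?thesis using False by (simp add: pos_divide_le_eq)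
  qed simp
  have "ct Y \<noteq> 0" using False by (metis ct_ct ct_zero)
  then obtain i where i: "ct Y *v axis i 1 \<noteq> 0"
    using norm_matrix_columns[of "ct Y"] by fastforce
  have PcY: "P ** ct Y = ct Y" using YP p by (metis ct_mult)
  let ?x0 = "(1 / norm (ct Y *v axis i 1)) *\<^sub>R (ct Y *v axis i 1)"
  have x0: "P *v ?x0 = ?x0" "norm ?x0 = 1"
    using i by (simp_all add: mv.scaleR_right matrix_vector_mul_assoc PcY)
  then have ne: "?X \<noteq> {}" by blast
  have lo: "\<mu> * (norm y)\<^sup>2 \<le> inner y (h *v y)" if y: "P *v y = 0" for y
  proof (cases "y = 0")
    case False
    let ?z = "(1 / norm y) *\<^sub>R y"
    have z: "P *v ?z = 0" "norm ?z = 1" using False y by (simp_all add: mv.scaleR_right)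
    have "\<mu> \<le> inner ?z (h *v ?z)"
      unfolding \<mu>_def by (rule cSup_least[OF ne]) (use swap z in blast)
    moreover have "inner ?z (h *v ?z) = inner y (h *v y) / (norm y)\<^sup>2"
      by (simp add: mv.scaleR_right power2_eq_square)
    ultimately have "\<mu> \<le> inner y (h *v y) / (norm y)\<^sup>2" by argo
    then show ?thesis using False by (simp add: pos_le_divide_eq)
  qed simp
  have "inner Y (Y ** h) = inner (ct Y) (h ** ct Y)"
  proof -
    have "rtr (ct Y ** (Y ** h)) = rtr (Y ** h ** ct Y)" by (rule rtr_commute)
    then show ?thesis by (simp add: inner_rtr matrix_mul_assoc)
  qed
  also have "\<dots> = (\<Sum>j\<in>UNIV. inner (ct Y *v axis j 1) (h *v (ct Y *v axis j 1)))"
    by (simp add: inner_matrix_columns matrix_vector_mul_assoc)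
  also have "\<dots> \<le> (\<Sum>j\<in>UNIV. \<mu> * (norm (ct Y *v axis j 1))\<^sup>2)"
    by (intro sum_mono up) (simp add: matrix_vector_mul_assoc PcY)
  also have "\<dots> = \<mu> * (norm (ct Y))\<^sup>2"
    unfolding norm_matrix_columns[of "ct Y"] sum_distrib_left ..
  also have "\<dots> = \<mu> * (norm Y)\<^sup>2" by (simp add: norm_ct)
  also have "\<dots> = (\<Sum>j\<in>UNIV. \<mu> * (norm (Y *v axis j 1))\<^sup>2)"
    unfolding norm_matrix_columns[of Y] sum_distrib_left ..
  also have "\<dots> \<le> (\<Sum>j\<in>UNIV. inner (Y *v axis j 1) (h *v (Y *v axis j 1)))"
    by (intro sum_mono lo) (simp add: matrix_vector_mul_assoc PY)
  also have "\<dots> = inner Y (h ** Y)"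
    by (simp add: inner_matrix_columns matrix_vector_mul_assoc)
  finally show ?thesis by (simp add: inner_diff_right)
qed simp

text \<open>The equation \<open>X = P ** X + X ** P\<close> kills the diagonal blocks, and Hermitian
  symmetry determines one off-diagonal block by the other.\<close>

lemma hermitian_tangent_eq_0:
  fixes X :: "complex^'N^'N"
  assumes P: "P ** P = P" "ct P = P" and X: "X = P ** X + X ** P" "ct X = X" "(mat 1 - P) ** X ** P = 0"
  shows "X = 0"
proof -
  have 1: "X ** P = P ** X ** P" using X(3) by (simp add: mm_simps)
  have 2: "P ** X = P ** X ** P" using arg_cong[OF 1, of ct] by (simp add: ct_mult P X(2) matrix_mul_assoc)
  have "P ** X ** P = P ** (P ** X + X ** P) ** P" using X(1) by simp
  also have "\<dots> = P ** X ** P + P ** X ** P"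
    by (simp add: mm_simps P mm_absorb[OF P(1)])
  finally have "P ** X ** P = 0" by simp
  then show ?thesis using X(1) 1 2 by simp
qed

text \<open>Nondegeneracy of the differential at \<open>P\<close> of the map \<open>Q \<mapsto> [M ** mproj M Q, U]\<close>.\<close>

definition noncritical :: "complex^'N^'N \<Rightarrow> complex^'N^'N \<Rightarrow> complex^'N^'N \<Rightarrow> bool" where
  "noncritical P U E \<longleftrightarrow>
     (\<forall>C. C ** (U ** E ** U + mat 1 - U) + ct (U ** E ** U + mat 1 - U) ** C = C \<longrightarrow> C = 0) \<and>
     (\<exists>J. (E ** U ** P + mat 1 - P) ** J = mat 1)"

section \<open>Secant limits, lower bound for one step, growth of the quadratic form\<close>

context scf
begin

text \<open>The exact identities \<open>R - Q = Q ** (R - Q) + (R - Q) ** R\<close> and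
  \<open>mproj_diff\<close> pass to the limit after scaling, so no curve has to be differentiated
  and \<open>Q\<close>, \<open>R\<close> may both move.\<close>

lemma tangent_limit:
  assumes Q: "\<And>j. Q j \<in> D" "Q \<longlonglongrightarrow> P" and R: "\<And>j. R j \<in> D" "R \<longlonglongrightarrow> P" and P: "P \<in> D"
    and d: "(\<lambda>j. t j *\<^sub>R (R j - Q j)) \<longlonglongrightarrow> d"
  shows "d = P ** d + d ** P" "ct d = d"
    "(\<lambda>j. t j *\<^sub>R (M ** E (R j) - M ** E (Q j))) \<longlonglongrightarrow>
       M ** (mat 1 - E P) ** d ** E P + ct (M ** (mat 1 - E P) ** d ** E P)"
proof -
  let ?d = "\<lambda>j. t j *\<^sub>R (R j - Q j)"
  have "?d j = Q j ** ?d j + ?d j ** R j" for j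
  proof -
    have "R j - Q j = Q j ** (R j - Q j) + (R j - Q j) ** R j"
      using projectors_idem[OF Q(1)[of j]] projectors_idem[OF R(1)[of j]] by (simp add: mm_simps)
    then show ?thesis
      unfolding mm.scaleR_right mm.scaleR_left scaleR_add_right[symmetric] by (rule arg_cong)
  qed
  then have "(\<lambda>j. Q j ** ?d j + ?d j ** R j) \<longlonglongrightarrow> d" using d by simp
  moreover have "(\<lambda>j. Q j ** ?d j + ?d j ** R j) \<longlonglongrightarrow> P ** d + d ** P"
    by (intro tendsto_add mm.tendsto d Q R)
  ultimately show "d = P ** d + d ** P" by (rule LIMSEQ_unique)
  have "ct (?d j) = ?d j" for j
    by (simp add: ct_simps projectors_ct[OF Q(1)] projectors_ct[OF R(1)])
  then have "?d \<longlonglongrightarrow> ct d" using tendsto_ct[OF d] by simp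
  then show "ct d = d" using d LIMSEQ_unique by blast
  have "(\<lambda>j. M ** (mat 1 - E (R j)) ** ?d j ** E (Q j) + ct (M ** (mat 1 - E (Q j)) ** ?d j ** E (R j)))
     \<longlonglongrightarrow> M ** (mat 1 - E P) ** d ** E P + ct (M ** (mat 1 - E P) ** d ** E P)"
    by (intro tendsto_add tendsto_ct mm.tendsto tendsto_diff tendsto_const d E_tendsto Q R P)
  moreover have "t j *\<^sub>R (M ** E (R j) - M ** E (Q j)) =
      M ** (mat 1 - E (R j)) ** ?d j ** E (Q j) + ct (M ** (mat 1 - E (Q j)) ** ?d j ** E (R j))" for j
    unfolding mproj_diff[OF Q(1) R(1)]
    by (simp add: mm.scaleR_right mm.scaleR_left ct_scaleR scaleR_add_right)
  ultimately show "(\<lambda>j. t j *\<^sub>R (M ** E (R j) - M ** E (Q j))) \<longlonglongrightarrow>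
       M ** (mat 1 - E P) ** d ** E P + ct (M ** (mat 1 - E P) ** d ** E P)" by simp
qed

text \<open>With \<open>a = (mat 1 - E P) ** x ** E P\<close> the derivative \<open>d\<close> is
  \<open>M ** a\<close> plus its adjoint. If \<open>d\<close> commutes with \<open>U\<close>, then
  \<open>d ** U\<close> solves the matrix equation in \<open>noncritical\<close>; hence it vanishes,
  and \<open>a ** U = 0\<close> follows. The second condition makes \<open>E P\<close> map the range
  of \<open>U\<close> onto the range of \<open>P\<close>, so \<open>a\<close> vanishes altogether,
  and with it the off-diagonal block of \<open>x\<close>.\<close>

lemma noncritical_tangent:
  assumes P: "P \<in> D" and U: "U \<in> D" and nc: "noncritical P U (E P)"
    and x: "x = P ** x + x ** P" "ct x = x"
    and d: "d = M ** (mat 1 - E P) ** x ** E P + ct (M ** (mat 1 - E P) ** x ** E P)"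
    and com: "d ** U = U ** d"
  shows "x = 0"
proof -
  note p = projectors_ct[OF P] projectors_idem[OF P]
  note u = projectors_ct[OF U] projectors_idem[OF U]
  define a where "a = (mat 1 - E P) ** x ** E P"
  have d': "d = M ** a + ct a ** M"
    unfolding d a_def by (simp add: ct_simps ctM matrix_mul_assoc mm_simps)
  have aE: "a ** E P = a" by (simp add: a_def mm_absorb[OF E_E[OF P]])
  have Ea: "E P ** a = 0" by (simp add: a_def mm_simps E_E[OF P])
  have ctd: "ct d = d" by (simp add: d' ct_simps ctM add.commute)
  have dE: "d ** E P = M ** a"
  proof -
    have "ct a ** M ** E P = ct (E P ** a) ** M"
      by (simp add: ct_mult matrix_mul_assoc[symmetric] M_E[OF P])
    then show ?thesis by (simp add: d' mm.add_left Ea ct_zero matrix_mul_assoc[symmetric] aE)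
  qed
  define T where "T = U ** E P ** U + mat 1 - U"
  let ?C = "d ** U"
  have CT: "?C ** T = U ** (M ** a) ** U"
  proof -
    have "?C ** T = d ** U ** E P ** U" by (simp add: T_def mm_simps mm_absorb[OF u(2)])
    also have "\<dots> = U ** (d ** E P) ** U" by (simp add: com matrix_mul_assoc)
    finally show ?thesis by (simp add: dE)
  qed
  have ctC: "ct ?C = ?C" by (simp add: ct_mult ctd u com)
  have "ct T ** ?C = ct (?C ** T)" by (simp add: ct_mult ctC[unfolded ct_mult] ctC)
  also have "\<dots> = U ** (ct a ** M) ** U"
    by (simp add: CT ct_mult u ctM matrix_mul_assoc)
  finally have TC: "ct T ** ?C = U ** (ct a ** M) ** U" .
  have "?C ** T + ct T ** ?C = U ** d ** U"
    unfolding CT TC by (simp add: d' mm_simps)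
  also have "\<dots> = ?C" by (simp add: com[symmetric] mm_absorb[OF u(2)])
  finally have C0: "?C = 0" using nc unfolding noncritical_def T_def by blast
  have "ct a ** M ** U = ct (d ** E P) ** U" by (simp add: dE ct_mult ctM)
  also have "\<dots> = ct (E P) ** ?C" by (simp add: ct_mult ctd matrix_mul_assoc)
  also have "\<dots> = 0" by (simp add: C0)
  finally have "M ** a ** U = 0" using C0 by (simp add: d' mm.add_left)
  then have "M ** (a ** U) = M ** 0" by (simp add: matrix_mul_assoc)
  then have aU: "a ** U = 0" by (rule pos_def_cancel[OF M])
  obtain J where J: "(E P ** U ** P + mat 1 - P) ** J = mat 1"
    using nc unfolding noncritical_def by blast
  have "P = P ** ((E P ** U ** P + mat 1 - P) ** J)" by (simp add: J)
  also have "\<dots> = P ** (E P ** U ** P + mat 1 - P) ** J" by (simp add: matrix_mul_assoc)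
  also have "P ** (E P ** U ** P + mat 1 - P) = E P ** U ** P"
    by (simp add: mm_simps p Q_E[OF P])
  finally have "a ** P = a ** E P ** U ** P ** J" by (metis matrix_mul_assoc)
  also have "\<dots> = 0" by (simp add: aE aU)
  finally have "a = 0" by (metis aE Q_E[OF P] matrix_mul_assoc mm.zero_left)
  then have "(mat 1 - P) ** ((mat 1 - E P) ** x ** E P) ** P = 0" by (simp add: a_def)
  then have "(mat 1 - P) ** x ** P = 0"
    by (simp add: matrix_mul_assoc one_minus_Q_E[OF P] mm_absorb[OF E_Q[OF P]])
  then show ?thesis by (rule hermitian_tangent_eq_0[OF p(2,1) x])
qed

lemma unit_direction_subsequence:
  fixes y :: "nat \<Rightarrow> 'a::euclidean_space"
  assumes "\<And>j. y j \<noteq> 0"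
  obtains r d where "strict_mono (r :: nat \<Rightarrow> nat)" "norm d = 1"
    "(\<lambda>j. (1 / norm (y (r j))) *\<^sub>R y (r j)) \<longlonglongrightarrow> d"
proof -
  let ?z = "\<lambda>j. (1 / norm (y j)) *\<^sub>R y j"
  have "\<exists>d\<in>sphere 0 1. \<exists>r. strict_mono (r :: nat \<Rightarrow> nat) \<and> (?z \<circ> r) \<longlonglongrightarrow> d"
    by (rule compact_sphere[of "0::'a" 1, unfolded compact_def, rule_format]) (use assms in simp)
  then obtain d r where "d \<in> sphere 0 1" "strict_mono (r :: nat \<Rightarrow> nat)" "(?z \<circ> r) \<longlonglongrightarrow> d"
    by blast
  then show thesis by (intro that[of r d]) (simp_all add: o_def)
qed

text \<open>Blow-up: a failing sequence has a unit secant limit at \<open>P\<close> along which the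
  derivative of \<open>M ** E Q\<close> commutes with \<open>U\<close>, against
  \<open>noncritical_tangent\<close>. Allowing every \<open>V\<close> that commutes with
  \<open>H R\<close> covers all choices of the fixed point map, also where the gap closes.\<close>

lemma lower_Lipschitz_step:
  assumes P: "P \<in> D" and U: "U \<in> D" "H P ** U = U ** H P" and nc: "noncritical P U (E P)"
  shows "\<exists>c>0. \<forall>R\<in>D. \<forall>V\<in>D. norm (R - P) < c \<longrightarrow> H R ** V = V ** H R \<longrightarrow>
           c * norm (R - P) \<le> norm (V - U)"
proof (rule ccontr)
  assume "\<not> ?thesis"
  then have "\<forall>c>0. \<exists>R V. R \<in> D \<and> V \<in> D \<and> norm (R - P) < c \<and> H R ** V = V ** H R \<and>
      norm (V - U) < c * norm (R - P)" by (meson linorder_not_less)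
  then have "\<forall>j. \<exists>R V. R \<in> D \<and> V \<in> D \<and> norm (R - P) < inverse (real (Suc j)) \<and> H R ** V = V ** H R \<and>
      norm (V - U) < inverse (real (Suc j)) * norm (R - P)" by simp
  then obtain R V where RV: "\<And>j. R j \<in> D" "\<And>j. V j \<in> D" "\<And>j. norm (R j - P) < inverse (real (Suc j))"
    "\<And>j. H (R j) ** V j = V j ** H (R j)" "\<And>j. norm (V j - U) < inverse (real (Suc j)) * norm (R j - P)"
    by metis
  have "R j - P \<noteq> 0" for j using RV(5)[of j] by auto
  then obtain r x where r: "strict_mono (r :: nat \<Rightarrow> nat)" "norm x = 1"
    "(\<lambda>j. (1 / norm (R (r j) - P)) *\<^sub>R (R (r j) - P)) \<longlonglongrightarrow> x"
    by (rule unit_direction_subsequence)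
  let ?t = "\<lambda>j. 1 / norm (R (r j) - P)"
  have "(\<lambda>j. R j - P) \<longlonglongrightarrow> 0"
    by (rule Lim_null_comparison[OF _ LIMSEQ_inverse_real_of_nat])
      (use RV(3) in \<open>auto intro!: always_eventually less_imp_le\<close>)
  then have "R \<longlonglongrightarrow> P" by (simp add: LIM_zero_iff)
  then have RP: "(\<lambda>j. R (r j)) \<longlonglongrightarrow> P" using LIMSEQ_subseq_LIMSEQ[OF _ r(1)] by (auto simp: o_def)
  note tl = tangent_limit[OF P tendsto_const RV(1) RP P r(3)]
  have v0: "(\<lambda>j. ?t j *\<^sub>R (V (r j) - U)) \<longlonglongrightarrow> 0"
  proof (rule Lim_null_comparison)
    show "(\<lambda>j. inverse (real (Suc (r j)))) \<longlonglongrightarrow> 0"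
      using LIMSEQ_subseq_LIMSEQ[OF LIMSEQ_inverse_real_of_nat r(1)] by (simp add: o_def)
    have "norm (?t j *\<^sub>R (V (r j) - U)) \<le> inverse (real (Suc (r j)))" for j
      using RV(5)[of "r j"] \<open>\<And>j. R j - P \<noteq> 0\<close>[of "r j"] by (simp add: pos_divide_le_eq)
    then show "\<forall>\<^sub>F j in sequentially. norm (?t j *\<^sub>R (V (r j) - U)) \<le> inverse (real (Suc (r j)))"
      by (intro always_eventually) blast
  qed
  let ?d = "M ** (mat 1 - E P) ** x ** E P + ct (M ** (mat 1 - E P) ** x ** E P)"
  let ?dj = "\<lambda>j. ?t j *\<^sub>R (M ** E (R (r j)) - M ** E P)"
  \<comment> \<open>Subtracting the two commutation relations expresses the commutator of
    \<open>U\<close> with the change of \<open>H\<close> through \<open>V (r j) - U\<close>, which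
    is of smaller order than \<open>R (r j) - P\<close>.\<close>
  have rel: "?dj j ** U - U ** ?dj j =
      H (R (r j)) ** (?t j *\<^sub>R (V (r j) - U)) - (?t j *\<^sub>R (V (r j) - U)) ** H (R (r j))" for j
  proof -
    have "(M ** E (R (r j)) - M ** E P) ** U - U ** (M ** E (R (r j)) - M ** E P) =
        (H P - H (R (r j))) ** U - U ** (H P - H (R (r j)))"
      by (simp add: H_def)
    also have "\<dots> = H (R (r j)) ** (V (r j) - U) - (V (r j) - U) ** H (R (r j))"
      using RV(4)[of "r j"] U(2) by (simp add: mm.diff_left mm.diff_right)
    finally show ?thesis
      by (simp add: mm.scaleR_right mm.scaleR_left scaleR_diff_right[symmetric])
  qed
  have "(\<lambda>j. ?dj j ** U - U ** ?dj j) \<longlonglongrightarrow> ?d ** U - U ** ?d"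
    by (intro tendsto_diff mm.tendsto tl(3) tendsto_const)
  moreover have "(\<lambda>j. ?dj j ** U - U ** ?dj j) \<longlonglongrightarrow> H P ** 0 - 0 ** H P"
    unfolding rel by (intro tendsto_diff mm.tendsto H_tendsto v0 RV RP P)
  ultimately have "?d ** U - U ** ?d = H P ** 0 - 0 ** H P" by (rule LIMSEQ_unique)
  then have "?d ** U = U ** ?d" by simp
  then have "x = 0" by (rule noncritical_tangent[OF P U(1) nc tl(1,2) refl])
  then show False using r(2) by simp
qed

text \<open>Minus the second-order change of \<open>rtr (Q ** K)\<close> when a projector commuting
  with \<open>K\<close> is tilted along an off-diagonal \<open>X\<close>; positive values mark
  directions of descent.\<close>

definition J where "J X = - inner X (K ** X - X ** K)"

lemma K_self_adjoint: "inner X (K ** Y - Y ** K) = inner (K ** X - X ** K) Y"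
proof -
  have "rtr (ct X ** (Y ** K)) = rtr (K ** (ct X ** Y))"
    using rtr_commute[of "ct X ** Y" K] by (simp add: matrix_mul_assoc)
  then show ?thesis
    by (simp add: inner_diff_right inner_diff_left inner_rtr ct_simps ctK matrix_mul_assoc
        mm.diff_left mm.diff_right rtr_diff)
qed

lemma J_tendsto:
  assumes "f \<longlonglongrightarrow> X" shows "(\<lambda>j. J (f j)) \<longlonglongrightarrow> J X"
  unfolding J_def by (intro tendsto_minus tendsto_inner tendsto_diff mm.tendsto assms tendsto_const)

lemma J_scaleR: "J (t *\<^sub>R X) = t\<^sup>2 * J X"
  by (simp add: J_def mm.scaleR_left mm.scaleR_right inner_diff_right power2_eq_square algebra_simps)

text \<open>Linearised step: \<open>J\<close> increases strictly along \<open>S x = (S + K) y - y K\<close>, because the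
  second variation of the energy is nonnegative at a ground projector.\<close>

lemma J_linear_increase:
  assumes P: "P \<in> D" and com: "K ** P = P ** K" and g: "ground_projector n (H P) P"
    and nd: "\<And>Y. (mat 1 - P) ** Y ** P = Y \<Longrightarrow> K ** Y = Y ** K \<Longrightarrow> Y = 0"
    and x: "(mat 1 - P) ** x ** P = x" and y: "(mat 1 - P) ** y ** P = y"
    and rel: "S P ** x = S P ** y + (K ** y - y ** K)" and le: "J y \<le> J x"
  shows "x = 0 \<and> y = 0"
proof -
  define z where "z = x - y"
  have z: "(mat 1 - P) ** z ** P = z" 
    unfolding z_def by (simp only: mm.diff_right[of "mat 1 - P"] mm.diff_left[of "(mat 1 - P) ** x"] x y)
  have Sz: "S P ** z = K ** y - y ** K" using rel by (simp add: z_def mm.diff_right)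
  have "0 \<le> inner z (H P ** z - z ** H P)"
    by (rule ground_projector_second_variation[OF g z])
  moreover have "z ** S P = 0" by (subst z[symmetric]) (simp add: matrix_mul_assoc[symmetric] Q_S[OF P])
  ultimately have 1: "0 \<le> inner z (S P ** z) + inner z (K ** z - z ** K)"
    by (simp add: H_eq mm.add_left mm.add_right inner_diff_right inner_add_right)
  \<comment> \<open>Polarisation at \<open>x = y + z\<close>: the commutator with \<open>K\<close>
    is self-adjoint, so the mixed terms merge into \<open>2 * inner z (S P ** z)\<close>. The second
    variation absorbs one copy, the other one is left as the strict gain.\<close>
  have "J x = J y - 2 * inner z (K ** y - y ** K) - inner z (K ** z - z ** K)"
  proof -
    have "x = y + z" by (simp add: z_def)
    moreover have "inner y (K ** z - z ** K) = inner z (K ** y - y ** K)"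
      by (metis K_self_adjoint inner_commute)
    ultimately show ?thesis
      by (simp add: J_def mm.add_left mm.add_right inner_add_left inner_add_right inner_diff_right)
  qed
  then have "inner z (S P ** z) \<le> 0" using 1 le unfolding Sz[symmetric] by linarith
  moreover obtain m where m: "m > 0" "\<And>v. m * (norm v)\<^sup>2 \<le> Re (cdot v (M *v v))"
    using pos_def_coercive[OF M] by blast
  have "inner z (S P ** z) = rtr (ct ((mat 1 - E P) ** z) ** M ** ((mat 1 - E P) ** z))"
    by (simp add: inner_rtr S_eq[OF P] ct_mult matrix_mul_assoc)
  then have "m * (norm ((mat 1 - E P) ** z))\<^sup>2 \<le> inner z (S P ** z)"
    using coercive_matrix[OF m(2), of "(mat 1 - E P) ** z"] by simp
  ultimately have "m * (norm ((mat 1 - E P) ** z))\<^sup>2 \<le> 0" by simp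
  then have "(mat 1 - E P) ** z = 0" using m(1) by (simp add: mult_le_0_iff)
  then have "(mat 1 - P) ** ((mat 1 - E P) ** z) = 0" by simp
  then have "(mat 1 - P) ** z = 0" by (simp add: matrix_mul_assoc one_minus_Q_E[OF P])
  then have z0: "z = 0" using z by (metis mm.zero_left)
  then have "K ** y = y ** K" using Sz by simp
  then have "y = 0" by (rule nd[OF y])
  then show ?thesis using z0 by (simp add: z_def)
qed

lemma tangent_zero:
  assumes P: "P \<in> D" and "d = P ** d + d ** P" "ct d = d" "(mat 1 - P) ** d ** P = 0"
  shows "d = 0"
  using hermitian_tangent_eq_0[OF projectors_idem projectors_ct] assms by blast

text \<open>Near \<open>P\<close> the off-diagonal block at \<open>P\<close> serves as a coordinate.
  A failing sequence would have a unit tangent vector with vanishing block as secant limit.\<close>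

lemma offdiag_bound:
  assumes P: "P \<in> D"
  shows "\<exists>c>0. \<forall>Q\<in>D. \<forall>R\<in>D. norm (Q - P) < c \<longrightarrow> norm (R - P) < c \<longrightarrow>
    c * norm (R - Q) \<le> norm ((mat 1 - P) ** (R - Q) ** P)"
proof (rule ccontr)
  assume "\<not> ?thesis"
  then have "\<forall>c>0. \<exists>Q R. Q \<in> D \<and> R \<in> D \<and> norm (Q - P) < c \<and> norm (R - P) < c \<and>
      norm ((mat 1 - P) ** (R - Q) ** P) < c * norm (R - Q)" by (meson linorder_not_less)
  then have "\<forall>j. \<exists>Q R. Q \<in> D \<and> R \<in> D \<and> norm (Q - P) < inverse (real (Suc j)) \<and>
      norm (R - P) < inverse (real (Suc j)) \<and>
      norm ((mat 1 - P) ** (R - Q) ** P) < inverse (real (Suc j)) * norm (R - Q)" by simp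
  then obtain Q R where QR: "\<And>j. Q j \<in> D" "\<And>j. R j \<in> D" "\<And>j. norm (Q j - P) < inverse (real (Suc j))"
    "\<And>j. norm (R j - P) < inverse (real (Suc j))"
    "\<And>j. norm ((mat 1 - P) ** (R j - Q j) ** P) < inverse (real (Suc j)) * norm (R j - Q j)"
    by metis
  have ne: "R j - Q j \<noteq> 0" for j using QR(5)[of j] by auto
  then obtain r x where r: "strict_mono (r :: nat \<Rightarrow> nat)" "norm x = 1"
    "(\<lambda>j. (1 / norm (R (r j) - Q (r j))) *\<^sub>R (R (r j) - Q (r j))) \<longlonglongrightarrow> x"
    by (rule unit_direction_subsequence)
  have lim: "(\<lambda>j. f (r j)) \<longlonglongrightarrow> P" if "\<And>j. norm (f j - P) < inverse (real (Suc j))" for f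
  proof -
    have "(\<lambda>j. f j - P) \<longlonglongrightarrow> 0"
      by (rule Lim_null_comparison[OF _ LIMSEQ_inverse_real_of_nat])
        (use that in \<open>auto intro!: always_eventually less_imp_le\<close>)
    then have "f \<longlonglongrightarrow> P" by (simp add: LIM_zero_iff)
    then show ?thesis using LIMSEQ_subseq_LIMSEQ[OF _ r(1)] by (auto simp: o_def)
  qed
  note tl = tangent_limit[OF QR(1) lim[OF QR(3)] QR(2) lim[OF QR(4)] P r(3)]
  have "(\<lambda>j. (mat 1 - P) ** ((1 / norm (R (r j) - Q (r j))) *\<^sub>R (R (r j) - Q (r j))) ** P) \<longlonglongrightarrow> 0"
  proof (rule Lim_null_comparison)
    show "(\<lambda>j. inverse (real (Suc (r j)))) \<longlonglongrightarrow> 0"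
      using LIMSEQ_subseq_LIMSEQ[OF LIMSEQ_inverse_real_of_nat r(1)] by (simp add: o_def)
    have "norm ((mat 1 - P) ** ((1 / norm (R (r j) - Q (r j))) *\<^sub>R (R (r j) - Q (r j))) ** P) \<le> inverse (real (Suc (r j)))" for j
      using QR(5)[of "r j"] ne[of "r j"] by (simp add: pos_divide_le_eq mm.scaleR_left mm.scaleR_right)
    then show "\<forall>\<^sub>F j in sequentially. norm ((mat 1 - P) ** ((1 / norm (R (r j) - Q (r j))) *\<^sub>R (R (r j) - Q (r j))) ** P) \<le> inverse (real (Suc (r j)))"
      by (intro always_eventually) blast
  qed
  moreover have "(\<lambda>j. (mat 1 - P) ** ((1 / norm (R (r j) - Q (r j))) *\<^sub>R (R (r j) - Q (r j))) ** P)
      \<longlonglongrightarrow> (mat 1 - P) ** x ** P"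
    by (intro mm.tendsto tendsto_const r)
  ultimately have "(mat 1 - P) ** x ** P = 0" using LIMSEQ_unique by blast
  then have "x = 0" by (rule tangent_zero[OF P tl(1,2)])
  then show False using r(2) by simp
qed

text \<open>Finite-difference form of \<open>J_linear_increase\<close>, uniform near
  \<open>P\<close>, again by blow-up. The gain in both differences is what later turns monotonicity
  along orbits into unbounded growth.\<close>

lemma J_increase:
  assumes P: "P \<in> D" and com: "K ** P = P ** K" and g: "ground_projector n (H P) P"
    and nd: "\<And>Y. (mat 1 - P) ** Y ** P = Y \<Longrightarrow> K ** Y = Y ** K \<Longrightarrow> Y = 0"
  shows "\<exists>c>0. \<forall>Q\<in>D. \<forall>R\<in>D. \<forall>Q'\<in>D. \<forall>R'\<in>D. norm (Q - P) < c \<longrightarrow> norm (R - P) < c \<longrightarrow>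
    norm (Q' - P) < c \<longrightarrow> norm (R' - P) < c \<longrightarrow>
    H Q ** Q' = Q' ** H Q \<longrightarrow> H R ** R' = R' ** H R \<longrightarrow>
    J ((mat 1 - P) ** (R - Q) ** P) + c * ((norm (R - Q))\<^sup>2 + (norm (R' - Q'))\<^sup>2)
      \<le> J ((mat 1 - P) ** (R' - Q') ** P)"
proof (rule ccontr)
  let ?p = "\<lambda>X. (mat 1 - P) ** X ** P"
  let ?B = "\<lambda>c Q R Q' R'. Q \<in> D \<and> R \<in> D \<and> Q' \<in> D \<and> R' \<in> D \<and> norm (Q - P) < c \<and> norm (R - P) < c \<and>
    norm (Q' - P) < c \<and> norm (R' - P) < c \<and> H Q ** Q' = Q' ** H Q \<and> H R ** R' = R' ** H R \<and>
    J (?p (R' - Q')) < J (?p (R - Q)) + c * ((norm (R - Q))\<^sup>2 + (norm (R' - Q'))\<^sup>2)"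
  assume "\<not> ?thesis"
  then have "\<forall>c>0. \<exists>Q R Q' R'. ?B c Q R Q' R'" by (meson linorder_not_less)
  then have "\<forall>j. \<exists>Q R Q' R'. ?B (inverse (real (Suc j))) Q R Q' R'" by simp
  then obtain Q R Q' R' where QR: "\<And>j. ?B (inverse (real (Suc j))) (Q j) (R j) (Q' j) (R' j)"
    by metis
  have in_D: "\<And>j. Q j \<in> D" "\<And>j. R j \<in> D" "\<And>j. Q' j \<in> D" "\<And>j. R' j \<in> D" using QR by blast+
  have near: "\<And>j. norm (Q j - P) < inverse (real (Suc j))" "\<And>j. norm (R j - P) < inverse (real (Suc j))"
     "\<And>j. norm (Q' j - P) < inverse (real (Suc j))" "\<And>j. norm (R' j - P) < inverse (real (Suc j))"
    using QR by blast+
  have comm: "\<And>j. H (Q j) ** Q' j = Q' j ** H (Q j)" "\<And>j. H (R j) ** R' j = R' j ** H (R j)"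
    using QR by blast+
  have Jlt: "\<And>j. J (?p (R' j - Q' j)) < J (?p (R j - Q j)) +
      inverse (real (Suc j)) * ((norm (R j - Q j))\<^sup>2 + (norm (R' j - Q' j))\<^sup>2)"
    using QR by blast
  \<comment> \<open>The differences before and after the step are normalised jointly, since neither
    is known to bound the other. In the limit one component may vanish, but not both.\<close>
  define y where "y j = (R j - Q j, R' j - Q' j)" for j
  have "y j \<noteq> 0" for j
  proof
    assume "y j = 0"
    then have "R j = Q j" "R' j = Q' j" by (simp_all add: y_def zero_prod_def)
    then show False using Jlt[of j] by (simp add: J_def)
  qed
  then obtain r d where r: "strict_mono (r :: nat \<Rightarrow> nat)" "norm d = 1"
    "(\<lambda>j. (1 / norm (y (r j))) *\<^sub>R y (r j)) \<longlonglongrightarrow> d"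
    by (rule unit_direction_subsequence)
  define t where "t j = 1 / norm (y (r j))" for j
  have d1: "(\<lambda>j. t j *\<^sub>R (R (r j) - Q (r j))) \<longlonglongrightarrow> fst d"
    using tendsto_fst[OF r(3)] by (simp add: t_def y_def)
  have d2: "(\<lambda>j. t j *\<^sub>R (R' (r j) - Q' (r j))) \<longlonglongrightarrow> snd d"
    using tendsto_snd[OF r(3)] by (simp add: t_def y_def)
  have lim: "(\<lambda>j. f (r j)) \<longlonglongrightarrow> P" if "\<And>j. norm (f j - P) < inverse (real (Suc j))" for f
  proof -
    have "(\<lambda>j. f j - P) \<longlonglongrightarrow> 0"
      by (rule Lim_null_comparison[OF _ LIMSEQ_inverse_real_of_nat])
        (use that in \<open>auto intro!: always_eventually less_imp_le\<close>)
    then have "f \<longlonglongrightarrow> P" by (simp add: LIM_zero_iff)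
    then show ?thesis using LIMSEQ_subseq_LIMSEQ[OF _ r(1)] by (auto simp: o_def)
  qed
  note t1 = tangent_limit[OF in_D(1) lim[OF near(1)] in_D(2) lim[OF near(2)] P d1]
  note t2 = tangent_limit[OF in_D(3) lim[OF near(3)] in_D(4) lim[OF near(4)] P d2]
  let ?dj = "\<lambda>j. t j *\<^sub>R (M ** E (R (r j)) - M ** E (Q (r j)))"
  let ?ej = "\<lambda>j. t j *\<^sub>R (R' (r j) - Q' (r j))"
  let ?d = "M ** (mat 1 - E P) ** fst d ** E P + ct (M ** (mat 1 - E P) ** fst d ** E P)"
  have rel: "?dj j ** R' (r j) - R' (r j) ** ?dj j = H (Q (r j)) ** ?ej j - ?ej j ** H (Q (r j))" for j
  proof -
    have "(M ** E (R (r j)) - M ** E (Q (r j))) ** R' (r j) - R' (r j) ** (M ** E (R (r j)) - M ** E (Q (r j)))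
       = (H (Q (r j)) - H (R (r j))) ** R' (r j) - R' (r j) ** (H (Q (r j)) - H (R (r j)))"
      by (simp add: H_def)
    also have "\<dots> = H (Q (r j)) ** (R' (r j) - Q' (r j)) - (R' (r j) - Q' (r j)) ** H (Q (r j))"
      using comm(1)[of "r j"] comm(2)[of "r j"] by (simp add: mm.diff_left mm.diff_right)
    finally show ?thesis
      by (simp add: mm.scaleR_right mm.scaleR_left scaleR_diff_right[symmetric])
  qed
  have "(\<lambda>j. ?dj j ** R' (r j) - R' (r j) ** ?dj j) \<longlonglongrightarrow> ?d ** P - P ** ?d"
    by (intro tendsto_diff mm.tendsto t1(3) lim[OF near(4)])
  moreover have "(\<lambda>j. ?dj j ** R' (r j) - R' (r j) ** ?dj j) \<longlonglongrightarrow> H P ** snd d - snd d ** H P"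
    unfolding rel by (intro tendsto_diff mm.tendsto d2 H_tendsto in_D lim[OF near(1)] P)
  ultimately have lr: "?d ** P - P ** ?d = H P ** snd d - snd d ** H P" by (rule LIMSEQ_unique)
  note p = projectors_idem[OF P]
  have PS: "P ** S P = 0" "S P ** P = 0" using Q_S[OF P] S_Q[OF P] by auto
  have SS: "M ** (mat 1 - E P) = S P" by (simp add: S_def mm_simps)
  have dP: "?d ** P = S P ** fst d ** P"
    unfolding SS by (simp add: mm.add_left ct_mult t1(2) ct_S[OF P] mm_absorb[OF E_Q[OF P]]
        mm_absorb[OF PS(2)]) (simp add: matrix_mul_assoc mm_absorb[OF PS(2)])
  \<comment> \<open>Passing to the off-diagonal block reduces the limit relation to the hypothesis
    of \<open>J_linear_increase\<close>; commutators with \<open>H P\<close> survive because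
    \<open>H P\<close> commutes with \<open>P\<close>.\<close>
  have "?p (?d ** P - P ** ?d) = S P ** ?p (fst d)"
  proof -
    have "?p (?d ** P - P ** ?d) = (mat 1 - P) ** (?d ** P)"
      by (simp only: mm.diff_left mm.diff_right matrix_mul_lid matrix_mul_assoc mm_absorb[OF p] p) simp
    also have "\<dots> = S P ** fst d ** P"
      unfolding dP by (simp add: mm_simps PS)
    also have "\<dots> = S P ** ?p (fst d)" by (simp add: mm_simps PS)
    finally show ?thesis .
  qed
  moreover have "?p (H P ** snd d - snd d ** H P) = H P ** ?p (snd d) - ?p (snd d) ** H P"
  proof -
    have hp: "P ** H P = H P ** P" using g unfolding ground_projector_def by simp
    have hp': "X ** P ** H P = X ** H P ** P" for X by (metis hp matrix_mul_assoc)
    show ?thesis by (simp add: mm_simps hp hp')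
  qed
  ultimately have eq: "S P ** ?p (fst d) = H P ** ?p (snd d) - ?p (snd d) ** H P"
    unfolding lr by simp
  have "?p (snd d) ** S P = 0" by (simp add: matrix_mul_assoc[symmetric] PS)
  then have rel0: "S P ** ?p (fst d) = S P ** ?p (snd d) + (K ** ?p (snd d) - ?p (snd d) ** K)"
    unfolding eq H_eq mm.add_left[of K] mm.add_right[of _ K] by simp
  have pp: "?p (?p X) = ?p X" for X by (simp add: mm_simps p mm_absorb[OF p])
  have "J (?p (snd d)) \<le> J (?p (fst d)) + 0 * ((norm (fst d))\<^sup>2 + (norm (snd d))\<^sup>2)"
  proof (rule LIMSEQ_le)
    show "(\<lambda>j. J (?p (t j *\<^sub>R (R' (r j) - Q' (r j))))) \<longlonglongrightarrow> J (?p (snd d))"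
      by (intro J_tendsto mm.tendsto d2 tendsto_const)
    show "(\<lambda>j. J (?p (t j *\<^sub>R (R (r j) - Q (r j)))) + inverse (real (Suc (r j))) *
        ((norm (t j *\<^sub>R (R (r j) - Q (r j))))\<^sup>2 + (norm (t j *\<^sub>R (R' (r j) - Q' (r j))))\<^sup>2))
      \<longlonglongrightarrow> J (?p (fst d)) + 0 * ((norm (fst d))\<^sup>2 + (norm (snd d))\<^sup>2)"
      using LIMSEQ_subseq_LIMSEQ[OF LIMSEQ_inverse_real_of_nat r(1)]
      by (intro tendsto_add tendsto_mult tendsto_power tendsto_norm J_tendsto mm.tendsto d1 d2 tendsto_const)
        (simp add: o_def)
    have "J (?p (t j *\<^sub>R (R' (r j) - Q' (r j)))) \<le> J (?p (t j *\<^sub>R (R (r j) - Q (r j)))) + inverse (real (Suc (r j))) *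
        ((norm (t j *\<^sub>R (R (r j) - Q (r j))))\<^sup>2 + (norm (t j *\<^sub>R (R' (r j) - Q' (r j))))\<^sup>2)" for j
    proof -
      have "(t j)\<^sup>2 * J (?p (R' (r j) - Q' (r j))) \<le> (t j)\<^sup>2 * (J (?p (R (r j) - Q (r j))) + inverse (real (Suc (r j))) *
        ((norm (R (r j) - Q (r j)))\<^sup>2 + (norm (R' (r j) - Q' (r j)))\<^sup>2))"
        by (rule mult_left_mono[OF less_imp_le[OF Jlt]]) simp
      also have "\<dots> = (t j)\<^sup>2 * J (?p (R (r j) - Q (r j))) + inverse (real (Suc (r j))) *
        ((norm (t j *\<^sub>R (R (r j) - Q (r j))))\<^sup>2 + (norm (t j *\<^sub>R (R' (r j) - Q' (r j))))\<^sup>2)"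
        by (simp only: norm_scaleR power_mult_distrib power2_abs) (simp only: algebra_simps)
      finally show ?thesis by (simp only: mm.scaleR_left mm.scaleR_right J_scaleR)
    qed
    then show "\<exists>N. \<forall>j\<ge>N. J (?p (t j *\<^sub>R (R' (r j) - Q' (r j)))) \<le> J (?p (t j *\<^sub>R (R (r j) - Q (r j)))) + inverse (real (Suc (r j))) *
        ((norm (t j *\<^sub>R (R (r j) - Q (r j))))\<^sup>2 + (norm (t j *\<^sub>R (R' (r j) - Q' (r j))))\<^sup>2)" by blast
  qed
  then have "J (?p (snd d)) \<le> J (?p (fst d))" by simp
  from J_linear_increase[OF P com g nd pp pp rel0 this]
  have "?p (fst d) = 0" "?p (snd d) = 0" by auto
  then have "fst d = 0" "snd d = 0"
    using tangent_zero[OF P t1(1,2)] tangent_zero[OF P t2(1,2)] by auto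
  then have "d = 0" by (simp add: prod_eq_iff)
  then show False using r(2) by simp
qed

end

section \<open>Null sets in submanifolds\<close>

definition perp :: "'a::euclidean_space set \<Rightarrow> 'a set" where
  "perp V = {w. \<forall>v\<in>V. inner w v = 0}"

definition orthonormal_set :: "'a::euclidean_space set \<Rightarrow> bool" where
  "orthonormal_set B \<longleftrightarrow> finite B \<and> (\<forall>b\<in>B. \<forall>c\<in>B. inner b c = (if b = c then 1 else 0))"

lemma orthonormal_setI:
  assumes "finite B" "pairwise orthogonal B" "\<And>b. b \<in> B \<Longrightarrow> norm b = 1"
  shows "orthonormal_set B"
  using assms unfolding orthonormal_set_def pairwise_def orthogonal_def by (auto simp: dot_square_norm)

lemma orthonormal_set_independent:
  assumes "orthonormal_set B" shows "independent B"
proof (rule pairwise_orthogonal_independent)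
  show "pairwise orthogonal B" using assms by (auto simp: orthonormal_set_def pairwise_def orthogonal_def)
  show "0 \<notin> B"
  proof
    assume "0 \<in> B"
    then have "inner (0::'a) 0 = 1" using assms unfolding orthonormal_set_def by metis
    then show False by simp
  qed
qed

lemma orthonormal_span:
  assumes B: "orthonormal_set B" and x: "x \<in> span B"
  shows "x = (\<Sum>b\<in>B. inner x b *\<^sub>R b)"
proof -
  have fin: "finite B" using B by (simp add: orthonormal_set_def)
  obtain u where u: "x = (\<Sum>b\<in>B. u b *\<^sub>R b)" using x span_finite[OF fin] by auto
  have "inner x c = u c" if c: "c \<in> B" for c
  proof -
    have "inner x c = (\<Sum>b\<in>B. u b * inner b c)" by (simp add: u inner_sum_left)
    also have "\<dots> = (\<Sum>b\<in>B. if b = c then u b else 0)"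
      using B c by (intro sum.cong) (auto simp: orthonormal_set_def)
    also have "\<dots> = u c" using fin c by simp
    finally show ?thesis .
  qed
  then show ?thesis using u by simp
qed

lemma orthonormal_decomposition:
  fixes V :: "'a::euclidean_space set"
  assumes V: "subspace V" and B: "orthonormal_set B" "span B = V"
  obtains C where "orthonormal_set C" "span C = perp V" "B \<inter> C = {}" "orthonormal_set (B \<union> C)"
    "card B = dim V" "card B + card C = DIM('a)" "span (B \<union> C) = UNIV"
proof -
  have "subspace (perp V)"
    by (auto simp: subspace_def perp_def inner_add_left)
  then obtain C where C: "C \<subseteq> perp V" "pairwise orthogonal C" "\<And>x. x \<in> C \<Longrightarrow> norm x = 1"
    "independent C" "span C = perp V"
    by (metis orthonormal_basis_subspace)
  have oC: "orthonormal_set C" using C by (intro orthonormal_setI independent_imp_finite)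
  have BV: "B \<subseteq> V" using B(2) span_superset by blast
  have disj: "B \<inter> C = {}"
  proof (rule ccontr)
    assume "B \<inter> C \<noteq> {}"
    then obtain b where b: "b \<in> B" "b \<in> C" by blast
    then have "b \<in> V" "b \<in> perp V" using BV C(1) by blast+
    then have "inner b b = 0" unfolding perp_def by blast
    then show False using C(3)[OF b(2)] by simp
  qed
  have oBC: "orthonormal_set (B \<union> C)"
    unfolding orthonormal_set_def
  proof (intro conjI ballI)
    show "finite (B \<union> C)" using B(1) oC by (simp add: orthonormal_set_def)
    have bc: "inner c b = 0" "inner b c = 0" if "b \<in> B" "c \<in> C" for b c
    proof -
      have "b \<in> V" "c \<in> perp V" using that BV C(1) by blast+
      then show "inner c b = 0" unfolding perp_def by blast
      then show "inner b c = 0" by (simp add: inner_commute)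
    qed
    fix b c assume "b \<in> B \<union> C" "c \<in> B \<union> C"
    then consider "b \<in> B" "c \<in> B" | "b \<in> C" "c \<in> C" | "b \<in> B" "c \<in> C" | "b \<in> C" "c \<in> B" by blast
    then show "inner b c = (if b = c then 1 else 0)"
    proof cases
      case 1 then show ?thesis using B(1) by (simp add: orthonormal_set_def)
    next
      case 2 then show ?thesis using oC by (simp add: orthonormal_set_def)
    next
      case 3 then show ?thesis using bc disj by (metis disjoint_iff)
    next
      case 4 then show ?thesis using bc disj by (metis disjoint_iff)
    qed
  qed
  have sp: "span (B \<union> C) = UNIV"
  proof -
    have "x \<in> span (B \<union> C)" for x
    proof -
      obtain y z where yz: "y \<in> span V" "\<And>w. w \<in> span V \<Longrightarrow> orthogonal z w" "x = y + z"
        using orthogonal_subspace_decomp_exists[of V x] by metis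
      have "y \<in> span B" using yz(1) B(2) V by (simp add: span_eq_iff[THEN iffD2])
      moreover have "z \<in> span C"
        unfolding C(5) perp_def using yz(2) by (auto simp: orthogonal_def span_base)
      ultimately show ?thesis unfolding yz(3) by (meson Un_upper1 Un_upper2 span_add span_mono subsetD)
    qed
    then show ?thesis by blast
  qed
  have "card B + card C = card (B \<union> C)"
    using disj B(1) oC by (simp add: card_Un_disjoint orthonormal_set_def)
  also have "\<dots> = DIM('a)"
    using dim_eq_card_independent[OF orthonormal_set_independent[OF oBC]] sp by (metis dim_UNIV dim_span)
  finally have "card B + card C = DIM('a)" .
  moreover have "card B = dim V"
    using dim_span_eq_card_independent[OF orthonormal_set_independent[OF B(1)]] B(2) by simp
  ultimately show thesis using that oC C(5) disj oBC sp by blast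
qed

lemma exists_orthonormal_set:
  fixes V :: "'a::euclidean_space set"
  assumes "subspace V" obtains B where "orthonormal_set B" "span B = V"
proof -
  obtain B where "B \<subseteq> V" "pairwise orthogonal B" "\<And>x. x \<in> B \<Longrightarrow> norm x = 1" "independent B"
    "card B = dim V" "span B = V"
    using orthonormal_basis_subspace[OF assms] by metis
  then show thesis using that orthonormal_setI independent_imp_finite by metis
qed

lemma exists_projection:
  fixes V :: "'a::euclidean_space set"
  assumes V: "subspace V"
  obtains p where "linear p" "\<And>z w. z \<in> V \<Longrightarrow> w \<in> perp V \<Longrightarrow> p (z + w) = z" "\<And>x. p x \<in> V"
    "\<And>x. x - p x \<in> perp V"
proof -
  obtain B where B: "orthonormal_set B" "span B = V" by (rule exists_orthonormal_set[OF V])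
  let ?p = "\<lambda>x. \<Sum>b\<in>B. inner x b *\<^sub>R b"
  have BV: "b \<in> B \<Longrightarrow> b \<in> V" for b using B(2) span_base by blast
  show thesis
  proof (rule that)
    show "linear ?p"
      by (rule linearI) (simp_all add: inner_add_left scaleR_left.add sum.distrib scaleR_sum_right)
    show "?p (z + w) = z" if "z \<in> V" "w \<in> perp V" for z w
    proof -
      have "?p (z + w) = ?p z"
        using that(2) BV by (intro sum.cong) (auto simp: inner_add_left perp_def)
      also have "\<dots> = z" using orthonormal_span[OF B(1)] that(1) B(2) by metis
      finally show ?thesis .
    qed
    show "?p x \<in> V" for x
      unfolding B(2)[symmetric] by (intro span_sum span_scale span_base)
    show "x - ?p x \<in> perp V" for x
      unfolding perp_def
    proof (intro CollectI ballI)
      fix v assume "v \<in> V"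
      then have v: "v = (\<Sum>b\<in>B. inner v b *\<^sub>R b)" using orthonormal_span[OF B(1)] B(2) by metis
      have "inner (x - ?p x) c = 0" if c: "c \<in> B" for c
      proof -
        have "inner (?p x) c = (\<Sum>b\<in>B. if b = c then inner x b else 0)"
          unfolding inner_sum_left using B(1) c by (intro sum.cong) (auto simp: orthonormal_set_def)
        also have "\<dots> = inner x c" using B(1) c by (simp add: orthonormal_set_def)
        finally show ?thesis by (simp add: inner_diff_left)
      qed
      then show "inner (x - ?p x) v = 0" by (subst v) (simp add: inner_sum_right)
    qed
  qed
qed

text \<open>The complement of the larger subspace is the smaller one, so it can be covered linearly.
  This aligns the cylinder directions when a set modelled on \<open>V\<close> is mapped into
  \<open>W\<close>.\<close>

lemma exists_perp_surjection:
  fixes V W :: "'a::euclidean_space set"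
  assumes V: "subspace V" and W: "subspace W" and d: "dim V \<le> dim W"
  obtains L :: "'a \<Rightarrow> 'a" where "linear L" "perp W \<subseteq> L ` perp V"
proof -
  obtain B where B: "orthonormal_set B" "span B = V" by (rule exists_orthonormal_set[OF V])
  obtain C where C: "orthonormal_set C" "span C = perp V" "card B = dim V" "card B + card C = DIM('a)"
    by (rule orthonormal_decomposition[OF V B])
  obtain B' where B': "orthonormal_set B'" "span B' = W" by (rule exists_orthonormal_set[OF W])
  obtain C' where C': "orthonormal_set C'" "span C' = perp W" "card B' = dim W" "card B' + card C' = DIM('a)"
    by (rule orthonormal_decomposition[OF W B'])
  have fin: "finite C" "finite C'" using C C' by (simp_all add: orthonormal_set_def)
  have "card C' \<le> card C" using C C' d by linarith
  then obtain h where h: "h ` C' \<subseteq> C" "inj_on h C'" using card_le_inj[OF fin(2,1)] by blast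
  let ?L = "\<lambda>x. \<Sum>c\<in>C'. inner x (h c) *\<^sub>R c"
  show thesis
  proof (rule that)
    show "linear ?L"
      by (rule linearI) (simp_all add: inner_add_left scaleR_left.add sum.distrib scaleR_sum_right)
    show "perp W \<subseteq> ?L ` perp V"
    proof
      fix w assume "w \<in> perp W"
      then have w: "w = (\<Sum>c\<in>C'. inner w c *\<^sub>R c)" using orthonormal_span[OF C'(1)] C'(2) by metis
      let ?v = "\<Sum>c\<in>C'. inner w c *\<^sub>R h c"
      have vV: "?v \<in> perp V" unfolding C(2)[symmetric]
        using h(1) by (intro span_sum span_scale span_base) auto
      have "inner ?v (h c) = inner w c" if c: "c \<in> C'" for c
      proof -
        have "inner ?v (h c) = (\<Sum>b\<in>C'. if b = c then inner w b else 0)"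
          unfolding inner_sum_left using C(1) c h unfolding orthonormal_set_def inj_on_def
          by (intro sum.cong) (auto simp: image_subset_iff)
        also have "\<dots> = inner w c" using fin c by simp
        finally show ?thesis .
      qed
      then have "w = ?L ?v" by (subst w) (rule sum.cong, simp_all)
      then show "w \<in> ?L ` perp V" using vV by (rule image_eqI)
    qed
  qed
qed

text \<open>Nullity of subsets of a \<open>d\<close>-dimensional submanifold, formulated through all pointwise
  Lipschitz maps into subspaces of dimension at least \<open>d\<close>; the orthogonal complement is added
  so that Lebesgue measure of the ambient space can be used. Invariance under Lipschitz maps and
  under inverses of maps that are bounded below is then immediate.\<close>

definition pointwise_lipschitz_on :: "'a::euclidean_space set \<Rightarrow> ('a \<Rightarrow> 'b::euclidean_space) \<Rightarrow> bool" where
  "pointwise_lipschitz_on S f \<longleftrightarrow>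
     (\<forall>x\<in>S. \<exists>B d. d > 0 \<and> (\<forall>y\<in>S. dist y x < d \<longrightarrow> norm (f y - f x) \<le> B * norm (y - x)))"

definition dnull :: "nat \<Rightarrow> 'a::euclidean_space set \<Rightarrow> bool" where
  "dnull d S \<longleftrightarrow> (\<forall>S'\<subseteq>S. \<forall>V (f :: 'a \<Rightarrow> 'a). subspace V \<longrightarrow> d \<le> dim V \<longrightarrow> f ` S' \<subseteq> V \<longrightarrow>
     pointwise_lipschitz_on S' f \<longrightarrow> negligible {f x + w | x w. x \<in> S' \<and> w \<in> perp V})"

lemma pointwise_lipschitz_on_subset:
  "pointwise_lipschitz_on S f \<Longrightarrow> T \<subseteq> S \<Longrightarrow> pointwise_lipschitz_on T f"
  unfolding pointwise_lipschitz_on_def by (meson subset_iff)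

lemma dnull_subset: "dnull d S \<Longrightarrow> T \<subseteq> S \<Longrightarrow> dnull d T"
  unfolding dnull_def by (meson subset_trans)

lemma dnull_UN:
  fixes S :: "'i::countable \<Rightarrow> 'a::euclidean_space set"
  assumes "\<And>i. dnull d (S i)" shows "dnull d (\<Union>i. S i)"
  unfolding dnull_def
proof (intro allI impI)
  fix S' V and f :: "'a \<Rightarrow> 'a"
  assume S': "S' \<subseteq> (\<Union>i. S i)" and V: "subspace V" "d \<le> dim V" "f ` S' \<subseteq> V" "pointwise_lipschitz_on S' f"
  let ?N = "\<lambda>T. {f x + w | x w. x \<in> T \<and> w \<in> perp V}"
  have "negligible (?N (S' \<inter> S i))" for i
  proof (rule assms[of i, unfolded dnull_def, rule_format])
    show "S' \<inter> S i \<subseteq> S i" "subspace V" "d \<le> dim V" "f ` (S' \<inter> S i) \<subseteq> V" using V by auto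
    show "pointwise_lipschitz_on (S' \<inter> S i) f" by (rule pointwise_lipschitz_on_subset[OF V(4)]) simp
  qed
  then have "negligible (\<Union> (range (\<lambda>i. ?N (S' \<inter> S i))))"
    by (intro negligible_countable_Union) auto
  moreover have "?N S' \<subseteq> \<Union> (range (\<lambda>i. ?N (S' \<inter> S i)))" using S' by blast
  ultimately show "negligible (?N S')" by (rule negligible_subset)
qed

lemma dnull_Union_finite:
  fixes \<A> :: "'a::euclidean_space set set"
  assumes "finite \<A>" "\<And>S. S \<in> \<A> \<Longrightarrow> dnull d S" shows "dnull d (\<Union> \<A>)"
proof (cases "\<A> = {}")
  case False
  then obtain g :: "nat \<Rightarrow> 'a set" where "\<A> = range g"
    using assms(1) by (metis countable_finite uncountable_def)
  then show ?thesis using dnull_UN[of d g] assms(2) by auto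
qed (simp add: dnull_def)

lemma dnull_Un: "dnull d S \<Longrightarrow> dnull d T \<Longrightarrow> dnull d (S \<union> T)"
  using dnull_Union_finite[of "{S, T}" d] by auto

text \<open>The map \<open>f \<circ> g\<close> on \<open>V0\<close> is extended to the whole space
  by letting \<open>L\<close> act on the complementary component. The extension carries the cylinder
  over \<open>Z\<close> onto a superset of the target cylinder, and a pointwise Lipschitz map
  preserves negligibility.\<close>

lemma dnull_image_cylinder:
  fixes g :: "'a::euclidean_space \<Rightarrow> 'a"
  assumes V0: "subspace V0" "dim V0 = d" and Z: "Z \<subseteq> V0" and g: "pointwise_lipschitz_on Z g"
    and neg: "negligible {z + w | z w. z \<in> Z \<and> w \<in> perp V0}"
  shows "dnull d (g ` Z)"
  unfolding dnull_def
proof (intro allI impI)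
  fix S' V and f :: "'a \<Rightarrow> 'a"
  assume S': "S' \<subseteq> g ` Z" and V: "subspace V" "d \<le> dim V" "f ` S' \<subseteq> V" and f: "pointwise_lipschitz_on S' f"
  obtain p where p: "linear p" "\<And>z w. z \<in> V0 \<Longrightarrow> w \<in> perp V0 \<Longrightarrow> p (z + w) = z"
    using exists_projection[OF V0(1)] by metis
  obtain L :: "'a \<Rightarrow> 'a" where L: "linear L" "perp V \<subseteq> L ` perp V0"
    using exists_perp_surjection[OF V0(1) V(1)] V(2) V0(2) by metis
  let ?Z = "{z\<in>Z. g z \<in> S'}"
  let ?C = "{z + w | z w. z \<in> ?Z \<and> w \<in> perp V0}"
  define F where "F u = f (g (p u)) + L (u - p u)" for u
  have "negligible (F ` ?C)"
  proof (rule negligible_locally_Lipschitz_image[OF order_refl])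
    show "negligible ?C" by (rule negligible_subset[OF neg]) blast
    fix u assume "u \<in> ?C"
    then obtain z w where u: "u = z + w" "z \<in> Z" "g z \<in> S'" "w \<in> perp V0" by blast
    obtain b1 d1 where b1: "d1 > 0" "\<And>y. y \<in> Z \<Longrightarrow> dist y z < d1 \<Longrightarrow> norm (g y - g z) \<le> b1 * norm (y - z)"
      using g u(2) unfolding pointwise_lipschitz_on_def by metis
    obtain b2 d2 where b2: "d2 > 0" "\<And>y. y \<in> S' \<Longrightarrow> dist y (g z) < d2 \<Longrightarrow> norm (f y - f (g z)) \<le> b2 * norm (y - g z)"
      using f u(3) unfolding pointwise_lipschitz_on_def by metis
    obtain kp where kp: "kp > 0" "\<And>x. norm (p x) \<le> kp * norm x" using linear_bounded_pos[OF p(1)] by blast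
    obtain kl where kl: "kl > 0" "\<And>x. norm (L x) \<le> kl * norm x" using linear_bounded_pos[OF L(1)] by blast
    \<comment> \<open>\<open>p\<close> stretches by at most \<open>kp\<close>, and \<open>g\<close>
      near \<open>z\<close> by at most \<open>\<bar>b1\<bar> + 1\<close>; within distance
      \<open>r\<close> both local Lipschitz estimates apply. Absolute value and summand 1 take care
      of a constant \<open>b1\<close> that is not positive.\<close>
    define r where "r = min (d1 / kp) (d2 / ((\<bar>b1\<bar> + 1) * kp))"
    have r: "r > 0" using b1 b2 kp by (simp add: r_def)
    let ?B = "\<bar>b2\<bar> * (\<bar>b1\<bar> + 1) * kp + kl * (1 + kp)"
    have "norm (F y - F u) \<le> ?B * norm (y - u)" if y: "y \<in> ?C" "dist y u < r" for y
    proof -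
      obtain z' w' where z': "y = z' + w'" "z' \<in> Z" "g z' \<in> S'" "w' \<in> perp V0" using y(1) by blast
      have pz: "p u = z" "p y = z'" using p(2) u z' Z by auto
      have "norm (z' - z) = norm (p (y - u))" by (simp add: linear_diff[OF p(1)] pz)
      also have "\<dots> \<le> kp * norm (y - u)" by (rule kp)
      finally have 1: "norm (z' - z) \<le> kp * norm (y - u)" .
      have "kp * norm (y - u) < kp * r" using y(2) kp by (simp add: dist_norm)
      also have "\<dots> \<le> d1" using kp by (simp add: r_def field_simps min_def)
      finally have "dist z' z < d1" using 1 by (simp add: dist_norm)
      then have "norm (g z' - g z) \<le> b1 * norm (z' - z)" by (rule b1(2)[OF z'(2)])
      also have "\<dots> \<le> (\<bar>b1\<bar> + 1) * norm (z' - z)" by (intro mult_right_mono) auto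
      also have "\<dots> \<le> (\<bar>b1\<bar> + 1) * (kp * norm (y - u))" using 1 by (intro mult_left_mono) auto
      finally have 2: "norm (g z' - g z) \<le> (\<bar>b1\<bar> + 1) * (kp * norm (y - u))" .
      have "(\<bar>b1\<bar> + 1) * (kp * norm (y - u)) < (\<bar>b1\<bar> + 1) * (kp * r)"
        using y(2) kp by (intro mult_strict_left_mono) (auto simp: dist_norm)
      also have "\<dots> = ((\<bar>b1\<bar> + 1) * kp) * r" by simp
      also have "\<dots> \<le> ((\<bar>b1\<bar> + 1) * kp) * (d2 / ((\<bar>b1\<bar> + 1) * kp))"
        using kp by (intro mult_left_mono) (auto simp: r_def)
      also have "\<dots> = d2"
      proof -
        have "(\<bar>b1\<bar> + 1) * kp \<noteq> 0" using kp(1) by auto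
        then show ?thesis by simp
      qed
      finally have "dist (g z') (g z) < d2" using 2 by (simp add: dist_norm)
      then have "norm (f (g z') - f (g z)) \<le> b2 * norm (g z' - g z)" by (rule b2(2)[OF z'(3)])
      also have "\<dots> \<le> \<bar>b2\<bar> * norm (g z' - g z)" by (intro mult_right_mono) auto
      also have "\<dots> \<le> \<bar>b2\<bar> * ((\<bar>b1\<bar> + 1) * (kp * norm (y - u)))" using 2 by (intro mult_left_mono) auto
      finally have 3: "norm (f (g z') - f (g z)) \<le> \<bar>b2\<bar> * (\<bar>b1\<bar> + 1) * kp * norm (y - u)" by (simp add: mult_ac)
      have "norm (L (y - u - (z' - z))) \<le> kl * norm (y - u - (z' - z))" by (rule kl)
      also have "\<dots> \<le> kl * (norm (y - u) + kp * norm (y - u))"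
        using kl 1 norm_triangle_ineq4[of "y - u" "z' - z"] by (intro mult_left_mono) auto
      finally have 4: "norm (L (y - u - (z' - z))) \<le> kl * (1 + kp) * norm (y - u)"
        by (simp add: algebra_simps)
      have "F y - F u = (f (g z') - f (g z)) + L (y - u - (z' - z))"
        by (simp add: F_def pz linear_diff[OF L(1)])
      then have "norm (F y - F u) \<le> norm (f (g z') - f (g z)) + norm (L (y - u - (z' - z)))"
        by (simp add: norm_triangle_ineq)
      also have "\<dots> \<le> ?B * norm (y - u)" using 3 4 by (simp add: distrib_right)
      finally show ?thesis .
    qed
    then show "\<exists>T B. open T \<and> u \<in> T \<and> (\<forall>y\<in>?C \<inter> T. norm (F y - F u) \<le> B * norm (y - u))"
      using r by (intro exI[of _ "ball u r"] exI[of _ ?B]) (auto simp: dist_commute)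
  qed
  moreover have "{f x + w | x w. x \<in> S' \<and> w \<in> perp V} \<subseteq> F ` ?C"
  proof clarify
    fix x w assume "x \<in> S'" "w \<in> perp V"
    then obtain z v where z: "x = g z" "z \<in> Z" "w = L v" "v \<in> perp V0" using S' L(2) by blast
    have "p (z + v) = z" using z Z p(2) by blast
    then have "f x + w = F (z + v)" by (simp add: F_def z)
    moreover have "z + v \<in> ?C" using z \<open>x \<in> S'\<close> by blast
    ultimately show "f x + w \<in> F ` ?C" by blast
  qed
  ultimately show "negligible {f x + w | x w. x \<in> S' \<and> w \<in> perp V}" by (rule negligible_subset)
qed

text \<open>The bound makes \<open>F\<close> injective with a Lipschitz inverse \<open>G\<close>; a
  test map \<open>f\<close> on a subset of \<open>T\<close> becomes the test map
  \<open>f \<circ> G\<close> on its image, with the same cylinder.\<close>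

lemma dnull_lower_lipschitz_image:
  fixes F :: "'a::euclidean_space \<Rightarrow> 'a"
  assumes S: "dnull d (F ` T)" and c: "\<And>x y. x \<in> T \<Longrightarrow> y \<in> T \<Longrightarrow> norm (y - x) \<le> c * norm (F y - F x)"
  shows "dnull d T"
  unfolding dnull_def
proof (intro allI impI)
  fix S' V and f :: "'a \<Rightarrow> 'a"
  assume S': "S' \<subseteq> T" and V: "subspace V" "d \<le> dim V" "f ` S' \<subseteq> V" and f: "pointwise_lipschitz_on S' f"
  have inj: "inj_on F S'"
  proof (rule inj_onI)
    fix x y assume "x \<in> S'" "y \<in> S'" "F x = F y"
    then show "x = y" using c[of x y] S' by auto
  qed
  define G where "G = inv_into S' F"
  have G: "G (F x) = x" if "x \<in> S'" for x using inv_into_f_f[OF inj that] by (simp add: G_def)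
  have "pointwise_lipschitz_on (F ` S') (f \<circ> G)"
    unfolding pointwise_lipschitz_on_def
  proof
    fix u assume "u \<in> F ` S'"
    then obtain x where x: "u = F x" "x \<in> S'" by blast
    obtain b r where b: "r > 0" "\<And>y. y \<in> S' \<Longrightarrow> dist y x < r \<Longrightarrow> norm (f y - f x) \<le> b * norm (y - x)"
      using f x(2) unfolding pointwise_lipschitz_on_def by metis
    have "norm ((f \<circ> G) v - (f \<circ> G) u) \<le> (\<bar>b\<bar> * (\<bar>c\<bar> + 1)) * norm (v - u)"
      if v: "v \<in> F ` S'" "dist v u < r / (\<bar>c\<bar> + 1)" for v
    proof -
      obtain y where y: "v = F y" "y \<in> S'" using v(1) by blast
      have "norm (y - x) \<le> c * norm (v - u)" using c x y S' by auto
      also have "\<dots> \<le> (\<bar>c\<bar> + 1) * norm (v - u)" by (intro mult_right_mono) auto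
      finally have 1: "norm (y - x) \<le> (\<bar>c\<bar> + 1) * norm (v - u)" .
      also have "\<dots> < r" using v(2) by (simp add: dist_norm pos_less_divide_eq mult.commute)
      finally have "norm (f y - f x) \<le> b * norm (y - x)" using b(2)[OF y(2)] by (simp add: dist_norm)
      also have "\<dots> \<le> \<bar>b\<bar> * norm (y - x)" by (intro mult_right_mono) auto
      also have "\<dots> \<le> \<bar>b\<bar> * ((\<bar>c\<bar> + 1) * norm (v - u))" using 1 by (intro mult_left_mono) auto
      finally show ?thesis using x y by (simp add: G mult.assoc)
    qed
    then show "\<exists>B d. d > 0 \<and> (\<forall>y\<in>F ` S'. dist y u < d \<longrightarrow> norm ((f \<circ> G) y - (f \<circ> G) u) \<le> B * norm (y - u))"
      using b(1) by (intro exI[of _ "\<bar>b\<bar> * (\<bar>c\<bar> + 1)"] exI[of _ "r / (\<bar>c\<bar> + 1)"]) simp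
  qed
  moreover have "(f \<circ> G) ` (F ` S') \<subseteq> V" using V(3) G by auto
  moreover have "F ` S' \<subseteq> F ` T" using S' by blast
  ultimately have "negligible {(f \<circ> G) u + w | u w. u \<in> F ` S' \<and> w \<in> perp V}"
    using S V(1,2) unfolding dnull_def by blast
  moreover have "{(f \<circ> G) u + w | u w. u \<in> F ` S' \<and> w \<in> perp V} = {f x + w | x w. x \<in> S' \<and> w \<in> perp V}"
    using G by force
  ultimately show "negligible {f x + w | x w. x \<in> S' \<and> w \<in> perp V}" by simp
qed

text \<open>A map that is bounded below at every point is so uniformly on countably many pieces.\<close>

lemma dnull_preimage:
  fixes F :: "'a::euclidean_space \<Rightarrow> 'a"
  assumes S: "dnull d S" and T: "F ` T \<subseteq> S"
    and c: "\<And>x. x \<in> T \<Longrightarrow> \<exists>c>0. \<forall>y\<in>T. norm (y - x) < c \<longrightarrow> c * norm (y - x) \<le> norm (F y - F x)"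
  shows "dnull d T"
proof -
  obtain D :: "'a set" where D: "countable D" "\<And>X. open X \<Longrightarrow> X \<noteq> {} \<Longrightarrow> \<exists>d\<in>D. d \<in> X"
    using countable_dense_setE by blast
  then have "D \<noteq> {}" using D(2)[of UNIV] by auto
  define e where "e m = inverse (real (Suc m))" for m
  \<comment> \<open>Two points of the piece \<open>(m, k)\<close> are within \<open>e m / 2\<close>
    of the same point of a countable dense set, so they are closer than \<open>e m\<close> and the
    pointwise estimate holds between them.\<close>
  define P where "P = (\<lambda>(m, k). {x\<in>T. norm (x - from_nat_into D k) < e m / 2 \<and>
    (\<forall>y\<in>T. norm (y - x) < e m \<longrightarrow> e m * norm (y - x) \<le> norm (F y - F x))})"
  have e0: "e m > 0" for m by (simp add: e_def)
  have "dnull d (P mk)" for mk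
  proof -
    obtain m k where mk: "mk = (m, k)" by fastforce
    show ?thesis
    proof (rule dnull_lower_lipschitz_image)
      show "dnull d (F ` P mk)" by (rule dnull_subset[OF S]) (use T in \<open>auto simp: P_def mk\<close>)
      fix x y assume xy: "x \<in> P mk" "y \<in> P mk"
      let ?q = "from_nat_into D k"
      have "norm (y - x) \<le> norm (y - ?q) + norm (x - ?q)"
        using norm_triangle_ineq4[of "y - ?q" "x - ?q"] by simp
      also have "\<dots> < e m" using xy by (auto simp: P_def mk)
      finally have "e m * norm (y - x) \<le> norm (F y - F x)" using xy by (auto simp: P_def mk)
      then show "norm (y - x) \<le> (1 / e m) * norm (F y - F x)"
        using e0[of m] by (simp add: pos_le_divide_eq mult.commute)
    qed
  qed
  then have "dnull d (\<Union>mk. P mk)" by (rule dnull_UN)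
  moreover have "T \<subseteq> (\<Union>mk. P mk)"
  proof
    fix x assume x: "x \<in> T"
    obtain c where c: "c > 0" "\<And>y. y \<in> T \<Longrightarrow> norm (y - x) < c \<Longrightarrow> c * norm (y - x) \<le> norm (F y - F x)"
      using c[OF x] by blast
    obtain m where m: "e m < c" unfolding e_def using reals_Archimedean[OF c(1)] by blast
    have "\<exists>q\<in>D. q \<in> ball x (e m / 2)" using e0[of m] by (intro D(2)) auto
    then obtain k where k: "from_nat_into D k \<in> ball x (e m / 2)"
      using from_nat_into_surj[OF D(1)] by metis
    have "e m * norm (y - x) \<le> norm (F y - F x)" if "y \<in> T" "norm (y - x) < e m" for y
    proof -
      have "e m * norm (y - x) \<le> c * norm (y - x)" using m by (intro mult_right_mono) auto
      also have "\<dots> \<le> norm (F y - F x)" using c(2)[OF that(1)] that(2) m by linarith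
      finally show ?thesis .
    qed
    then have "x \<in> P (m, k)" using x k by (simp add: P_def dist_norm)
    then show "x \<in> (\<Union>mk. P mk)" by blast
  qed
  ultimately show ?thesis by (rule dnull_subset)
qed

text \<open>\<open>q\<close> is bounded below and takes values in the part of \<open>V\<close>
  orthogonal to \<open>e\<close>. The cylinder over these values stays in the ambient hyperplane
  orthogonal to \<open>e\<close>, because \<open>e\<close> is orthogonal to
  \<open>perp V\<close>.\<close>

lemma dnull_lipschitz_graph:
  fixes S :: "'a::euclidean_space set" and q :: "'a \<Rightarrow> 'a"
  assumes V: "subspace V" "dim V = d" and e: "e \<in> V" "e \<noteq> 0"
    and q: "\<And>x. x \<in> S \<Longrightarrow> q x \<in> V" "\<And>x. x \<in> S \<Longrightarrow> inner e (q x) = 0"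
    and c: "\<And>x y. x \<in> S \<Longrightarrow> y \<in> S \<Longrightarrow> norm (y - x) \<le> c * norm (q y - q x)"
  shows "dnull d S"
proof -
  have "dnull d (id ` (q ` S))"
  proof (rule dnull_image_cylinder[OF V])
    show "q ` S \<subseteq> V" using q by blast
    show "pointwise_lipschitz_on (q ` S) id"
      unfolding pointwise_lipschitz_on_def by (auto intro!: exI[of _ 1] exI[of _ "1::real"])
    show "negligible {z + w | z w. z \<in> q ` S \<and> w \<in> perp V}"
    proof (rule negligible_subset[OF negligible_hyperplane[of e 0]])
      show "e \<noteq> 0 \<or> 0 \<noteq> (0::real)" using e by simp
      show "{z + w | z w. z \<in> q ` S \<and> w \<in> perp V} \<subseteq> {x. inner e x = 0}"
        using q(2) e(1) by (auto simp: inner_add_right perp_def inner_commute)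
    qed
  qed
  then have "dnull d (q ` S)" by simp
  then show ?thesis using c by (rule dnull_lower_lipschitz_image)
qed

section \<open>Lebesgue measure on subspaces and Fubini arguments\<close>

lemma AE_exists_witness:
  assumes "AE x in M. P x" "emeasure M (space M) \<noteq> 0"
  shows "\<exists>x\<in>space M. P x"
proof -
  have "ae_filter M \<noteq> bot" using assms(2) by (simp add: ae_filter_eq_bot_iff)
  moreover have "AE x in M. x \<in> space M \<and> P x" using assms(1) by (rule AE_conjI[OF AE_space])
  ultimately have "\<exists>x. x \<in> space M \<and> P x" by (rule eventually_happens')
  then show ?thesis by blast
qed

lemma PiM_lborel_nonnull:
  assumes "finite I" shows "emeasure (\<Pi>\<^sub>M i\<in>I. (lborel :: real measure)) (space (\<Pi>\<^sub>M i\<in>I. (lborel :: real measure))) \<noteq> 0"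
proof -
  interpret product_sigma_finite "\<lambda>_::'i. lborel :: real measure" by standard
  have "emeasure (\<Pi>\<^sub>M i\<in>I. (lborel :: real measure)) (\<Pi>\<^sub>E i\<in>I. {0..1}) = 1"
    using assms by (subst emeasure_PiM) auto
  moreover have "emeasure (\<Pi>\<^sub>M i\<in>I. (lborel :: real measure)) (\<Pi>\<^sub>E i\<in>I. {0..1}) \<le>
      emeasure (\<Pi>\<^sub>M i\<in>I. (lborel :: real measure)) (space (\<Pi>\<^sub>M i\<in>I. (lborel :: real measure)))"
    by (rule emeasure_space)
  ultimately show ?thesis by auto
qed

lemma PiM_lborel_reindex:
  fixes b :: "'a \<Rightarrow> 'b"
  assumes b: "bij_betw b I B" and fin: "finite I"
  shows "distr (\<Pi>\<^sub>M i\<in>B. (lborel :: real measure)) (\<Pi>\<^sub>M i\<in>I. lborel) (\<lambda>f. \<lambda>i\<in>I. f (b i)) = (\<Pi>\<^sub>M i\<in>I. lborel)"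
proof -
  interpret I: product_sigma_finite "\<lambda>_::'a. lborel :: real measure" by standard
  interpret B: product_sigma_finite "\<lambda>_::'b. lborel :: real measure" by standard
  have finB: "finite B" using b fin bij_betw_finite by blast
  have bB: "i \<in> I \<Longrightarrow> b i \<in> B" for i using b by (auto simp: bij_betw_def)
  have meas: "(\<lambda>f. \<lambda>i\<in>I. f (b i)) \<in> measurable (\<Pi>\<^sub>M i\<in>B. (lborel :: real measure)) (\<Pi>\<^sub>M i\<in>I. lborel)"
    by (intro measurable_restrict measurable_component_singleton bB)
  show ?thesis
  proof (rule I.PiM_eqI[OF fin])
    fix A assume A: "\<And>i. i \<in> I \<Longrightarrow> A i \<in> sets (lborel :: real measure)"
    define A' where "A' c = A (inv_into I b c)" for c
    have A'b: "A' (b i) = A i" if "i \<in> I" for i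
      using b that by (simp add: A'_def bij_betw_inv_into_left)
    have A': "A' c \<in> sets (lborel :: real measure)" if "c \<in> B" for c
      unfolding A'_def using b that by (intro A) (metis bij_betw_def inv_into_into)
    have "(\<lambda>f. \<lambda>i\<in>I. f (b i)) -` (Pi\<^sub>E I A) \<inter> space (\<Pi>\<^sub>M i\<in>B. (lborel :: real measure)) = Pi\<^sub>E B A'"
    proof -
      have "(\<forall>i\<in>I. f (b i) \<in> A i) \<longleftrightarrow> (\<forall>c\<in>B. f c \<in> A' c)" for f :: "'b \<Rightarrow> real"
        using A'b b by (metis (no_types, lifting) bij_betw_def image_iff)
      then show ?thesis by (auto simp: space_PiM PiE_def Pi_def extensional_def)
    qed
    then have "emeasure (distr (\<Pi>\<^sub>M i\<in>B. (lborel :: real measure)) (\<Pi>\<^sub>M i\<in>I. lborel) (\<lambda>f. \<lambda>i\<in>I. f (b i))) (Pi\<^sub>E I A)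
        = emeasure (\<Pi>\<^sub>M i\<in>B. (lborel :: real measure)) (Pi\<^sub>E B A')"
      using A fin by (subst emeasure_distr[OF meas]) (auto intro!: sets_PiM_I_finite)
    also have "\<dots> = (\<Prod>c\<in>B. emeasure lborel (A' c))"
      using A' finB by (intro B.emeasure_PiM) auto
    also have "\<dots> = (\<Prod>i\<in>I. emeasure lborel (A' (b i)))"
      by (rule prod.reindex_bij_betw[OF b, symmetric])
    also have "\<dots> = (\<Prod>i\<in>I. emeasure lborel (A i))" by (intro prod.cong) (auto simp: A'b)
    finally show "emeasure (distr (\<Pi>\<^sub>M i\<in>B. (lborel :: real measure)) (\<Pi>\<^sub>M i\<in>I. lborel) (\<lambda>f. \<lambda>i\<in>I. f (b i))) (Pi\<^sub>E I A)
      = (\<Prod>i\<in>I. emeasure lborel (A i))" .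
  qed simp
qed

lemma negligible_imp_null_set:
  fixes S :: "'a::euclidean_space set"
  assumes "negligible S"
  obtains N where "N \<in> null_sets lborel" "S \<subseteq> N"
  using assms unfolding negligible_iff_null_sets null_sets_completion_iff2 by blast

lemma negligible_borel_null:
  fixes S :: "'a::euclidean_space set"
  assumes "negligible S" "S \<in> sets borel" shows "S \<in> null_sets lborel"
  using assms unfolding negligible_iff_null_sets by (subst (asm) null_sets_completion_iff) auto

lemma negligible_linear_image_le:
  fixes f :: "'a::euclidean_space \<Rightarrow> 'b::euclidean_space"
  assumes "linear f" "negligible S" "DIM('a) \<le> DIM('b)" shows "negligible (f ` S)"
  by (rule negligible_differentiable_image_negligible[OF assms(3,2)])
    (rule linear_imp_differentiable_on[OF assms(1)])

lemma subspace_lborel_eq: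
  fixes V :: "'a::euclidean_space set"
  assumes V: "subspace V"
  obtains B where "orthonormal_set B" "span B = V"
    "subspace_lborel V = distr (\<Pi>\<^sub>M b\<in>B. (lborel :: real measure)) borel (\<lambda>f. \<Sum>b\<in>B. f b *\<^sub>R b)"
proof -
  define B where "B = (SOME B. orthonormal_basis V B)"
  obtain B0 where B0: "orthonormal_set B0" "span B0 = V" by (rule exists_orthonormal_set[OF V])
  have "orthonormal_basis V B0"
    unfolding orthonormal_basis_def
  proof (intro conjI)
    show "B0 \<subseteq> V" using B0(2) span_superset by blast
    show "pairwise orthogonal B0" using B0(1) by (simp add: orthonormal_set_def pairwise_def orthogonal_def)
    show "\<forall>b\<in>B0. norm b = 1" using B0(1) by (simp add: orthonormal_set_def norm_eq_1)
  qed (rule B0)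
  then have B: "orthonormal_basis V B" unfolding B_def by (rule someI)
  have "0 \<notin> B" using B unfolding orthonormal_basis_def by force
  then have "independent B" using B pairwise_orthogonal_independent unfolding orthonormal_basis_def by blast
  then have "finite B" by (rule independent_imp_finite)
  then have "orthonormal_set B" using B unfolding orthonormal_basis_def by (intro orthonormal_setI) auto
  moreover have "span B = V" using B unfolding orthonormal_basis_def by blast
  ultimately show thesis by (rule that) (simp add: subspace_lborel_def B_def Let_def)
qed

text \<open>Sets invariant under the translations by \<open>perp V\<close> are null in \<open>V\<close> if they are null in the
  ambient space: Fubini in an adapted orthonormal basis.\<close>

lemma AE_subspace_lborel:
  fixes V :: "'a::euclidean_space set"
  assumes V: "subspace V" and S: "negligible S"
    and inv: "\<And>x w. x \<in> S \<Longrightarrow> w \<in> perp V \<Longrightarrow> x + w \<in> S"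
  shows "AE y in subspace_lborel V. y \<in> V \<and> y \<notin> S"
proof -
  obtain B where B: "orthonormal_set B" "span B = V"
    and eqV: "subspace_lborel V = distr (\<Pi>\<^sub>M b\<in>B. (lborel :: real measure)) borel (\<lambda>f. \<Sum>b\<in>B. f b *\<^sub>R b)"
    by (rule subspace_lborel_eq[OF V])
  obtain C where C: "span C = perp V" "B \<inter> C = {}" "orthonormal_set (B \<union> C)"
    "card B + card C = DIM('a)" "span (B \<union> C) = UNIV" "orthonormal_set C"
    using orthonormal_decomposition[OF V B] by metis
  have fin: "finite B" "finite C" using B C by (simp_all add: orthonormal_set_def)
  have "card (Basis :: 'a set) = card (B \<union> C)" using C(2,4) fin by (simp add: card_Un_disjoint)
  then obtain b where b: "bij_betw b (Basis :: 'a set) (B \<union> C)"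
    using finite_same_card_bij[of "Basis :: 'a set" "B \<union> C"] fin by auto
  define I where "I = {i\<in>Basis. b i \<in> B}"
  define J where "J = {i\<in>Basis. b i \<in> C}"
  have IJ: "J \<inter> I = {}" "J \<union> I = Basis" "finite I" "finite J"
    using b C(2) by (auto simp: I_def J_def bij_betw_def)
  have bI: "bij_betw b I B"
    using b unfolding bij_betw_def I_def by (auto simp: inj_on_def)
  have bJ: "i \<in> J \<Longrightarrow> b i \<in> C" for i by (simp add: J_def)
  have bo: "inner (b i) (b j) = (if i = j then 1 else 0)" if "i \<in> Basis" "j \<in> Basis" for i j
  proof -
    have "b i \<in> B \<union> C" "b j \<in> B \<union> C" using b that by (auto simp: bij_betw_def)
    then have "inner (b i) (b j) = (if b i = b j then 1 else 0)"
      using C(3) unfolding orthonormal_set_def by blast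
    also have "b i = b j \<longleftrightarrow> i = j" using b that unfolding bij_betw_def by (meson inj_on_eq_iff)
    finally show ?thesis .
  qed
  \<comment> \<open>The product measures below are not complete, so a Borel null superset is used.
    Only \<open>S\<close> is invariant under \<open>perp V\<close>, not \<open>N\<close>; the end of
    the proof respects this.\<close>
  obtain N where N: "N \<in> null_sets lborel" "S \<subseteq> N" by (rule negligible_imp_null_set[OF S])
  have Nb: "N \<in> sets borel" using N by auto
  \<comment> \<open>\<open>L\<close> rotates the standard basis into the adapted one and
    \<open>L'\<close> inverts it; coordinates then split into directions of \<open>V\<close> and of
    \<open>perp V\<close>.\<close>
  define L where "L x = (\<Sum>i\<in>Basis. inner x i *\<^sub>R b i)" for x :: 'a
  define L' where "L' y = (\<Sum>i\<in>Basis. inner y (b i) *\<^sub>R i)" for y :: 'a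
  have linL': "linear L'"
    unfolding L'_def by (rule linearI) (simp_all add: inner_add_left scaleR_left.add sum.distrib scaleR_sum_right)
  have L'L: "L' (L x) = x" for x
  proof -
    have "inner (L x) (b i) = inner x i" if i: "i \<in> Basis" for i
    proof -
      have "inner (L x) (b i) = (\<Sum>j\<in>Basis. if j = i then inner x j else 0)"
        unfolding L_def inner_sum_left using bo i by (intro sum.cong) auto
      then show ?thesis using i by simp
    qed
    then have "L' (L x) = (\<Sum>i\<in>Basis. inner x i *\<^sub>R i)" unfolding L'_def by (intro sum.cong) auto
    then show ?thesis by (simp add: euclidean_representation)
  qed
  have "L -` N \<subseteq> L' ` N" using L'L by (metis image_eqI subsetI vimageE)
  moreover have "negligible (L' ` N)"
    using N(1) by (intro negligible_linear_image_le linL') (auto simp: negligible_iff_null_sets null_sets_completionI)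
  ultimately have "negligible (L -` N)" by (rule negligible_subset[rotated])
  moreover have Lm: "L \<in> borel_measurable borel" unfolding L_def by measurable
  then have "L -` N \<in> sets borel" using measurable_sets[OF Lm Nb] by simp
  ultimately have "L -` N \<in> null_sets lborel" by (rule negligible_borel_null)
  then have "AE x in lborel. x \<notin> L -` N" by (rule AE_not_in)
  then have "AE x in distr (\<Pi>\<^sub>M i\<in>Basis. lborel) borel (\<lambda>f. \<Sum>i\<in>Basis. f i *\<^sub>R i). L x \<notin> N"
    unfolding lborel_eq[symmetric, where 'a = 'a] by simp
  then have "AE f in (\<Pi>\<^sub>M i\<in>Basis. (lborel :: real measure)). L (\<Sum>i\<in>Basis. f i *\<^sub>R (i::'a)) \<notin> N"
    by (subst (asm) AE_distr_iff) (use Lm Nb in measurable)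
  moreover have "L (\<Sum>i\<in>Basis. f i *\<^sub>R i) = (\<Sum>i\<in>Basis. f i *\<^sub>R b i)" for f
    unfolding L_def by (intro sum.cong) (auto simp: inner_sum_left_Basis)
  ultimately have ae1: "AE f in (\<Pi>\<^sub>M i\<in>J \<union> I. (lborel :: real measure)). (\<Sum>i\<in>J \<union> I. f i *\<^sub>R b i) \<notin> N"
    unfolding IJ(2) by simp
  interpret P: product_sigma_finite "\<lambda>_::'a. lborel :: real measure" by standard
  interpret PI: finite_product_sigma_finite "\<lambda>_::'a. lborel :: real measure" I by standard (rule IJ)
  interpret PJ: finite_product_sigma_finite "\<lambda>_::'a. lborel :: real measure" J by standard (rule IJ)
  interpret PP: pair_sigma_finite "\<Pi>\<^sub>M i\<in>J. (lborel :: real measure)" "\<Pi>\<^sub>M i\<in>I. (lborel :: real measure)" ..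
  have "AE f in distr (Pi\<^sub>M J (\<lambda>_. lborel :: real measure) \<Otimes>\<^sub>M Pi\<^sub>M I (\<lambda>_. lborel)) (Pi\<^sub>M (J \<union> I) (\<lambda>_. lborel)) (merge J I).
      (\<Sum>i\<in>J \<union> I. f i *\<^sub>R b i) \<notin> N"
    unfolding P.distr_merge[OF IJ(1,4,3)] by (rule ae1)
  then have "AE p in Pi\<^sub>M J (\<lambda>_. lborel :: real measure) \<Otimes>\<^sub>M Pi\<^sub>M I (\<lambda>_. lborel).
      (\<Sum>i\<in>J \<union> I. merge J I p i *\<^sub>R b i) \<notin> N"
    by (rule AE_distrD[OF measurable_merge])
  from PP.AE_pair[OF this]
  have "AE x in Pi\<^sub>M J (\<lambda>_. lborel :: real measure). AE y in Pi\<^sub>M I (\<lambda>_. lborel).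
      (\<Sum>i\<in>J \<union> I. merge J I (x, y) i *\<^sub>R b i) \<notin> N" .
  \<comment> \<open>One slice suffices. It sits over a vector \<open>z\<close> of
    \<open>perp V\<close>, and a point \<open>y\<close> of \<open>S\<close> would have
    \<open>y + z\<close> in \<open>S\<close> and hence in \<open>N\<close>.\<close>
  from AE_exists_witness[OF this PiM_lborel_nonnull[OF IJ(4)]]
  obtain x where x: "AE y in Pi\<^sub>M I (\<lambda>_. lborel :: real measure). (\<Sum>i\<in>J \<union> I. merge J I (x, y) i *\<^sub>R b i) \<notin> N"
    by blast
  define z where "z = (\<Sum>i\<in>J. x i *\<^sub>R b i)"
  have z: "z \<in> perp V" unfolding z_def C(1)[symmetric] by (intro span_sum span_scale span_base bJ)
  have "(\<Sum>i\<in>J \<union> I. merge J I (x, y) i *\<^sub>R b i) = (\<Sum>i\<in>I. y i *\<^sub>R b i) + z" for y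
  proof -
    have "(\<Sum>i\<in>J \<union> I. merge J I (x, y) i *\<^sub>R b i)
        = (\<Sum>i\<in>J. merge J I (x, y) i *\<^sub>R b i) + (\<Sum>i\<in>I. merge J I (x, y) i *\<^sub>R b i)"
      by (rule sum.union_disjoint[OF IJ(4,3,1)])
    also have "(\<Sum>i\<in>J. merge J I (x, y) i *\<^sub>R b i) = z"
      unfolding z_def by (intro sum.cong) (auto simp: merge_def)
    also have "(\<Sum>i\<in>I. merge J I (x, y) i *\<^sub>R b i) = (\<Sum>i\<in>I. y i *\<^sub>R b i)"
      using IJ(1) by (intro sum.cong) (auto simp: merge_def)
    finally show ?thesis by simp
  qed
  with x have "AE y in Pi\<^sub>M I (\<lambda>_. lborel :: real measure). (\<Sum>i\<in>I. y i *\<^sub>R b i) + z \<notin> N" by simp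
  then have "AE y in distr (\<Pi>\<^sub>M i\<in>B. (lborel :: real measure)) (\<Pi>\<^sub>M i\<in>I. lborel) (\<lambda>f. \<lambda>i\<in>I. f (b i)).
      (\<Sum>i\<in>I. y i *\<^sub>R b i) + z \<notin> N"
    unfolding PiM_lborel_reindex[OF bI IJ(3)] .
  then have "AE f in (\<Pi>\<^sub>M i\<in>B. (lborel :: real measure)). (\<Sum>i\<in>I. (\<lambda>i\<in>I. f (b i)) i *\<^sub>R b i) + z \<notin> N"
    by (rule AE_distrD[rotated]) (use bI in \<open>auto simp: bij_betw_def intro!: measurable_restrict measurable_component_singleton\<close>)
  moreover have "(\<Sum>i\<in>I. (\<lambda>i\<in>I. f (b i)) i *\<^sub>R b i) = (\<Sum>c\<in>B. f c *\<^sub>R c)" for f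
    using sum.reindex_bij_betw[OF bI, of "\<lambda>c. f c *\<^sub>R c"] by simp
  ultimately have ae2: "AE f in (\<Pi>\<^sub>M i\<in>B. (lborel :: real measure)). (\<Sum>c\<in>B. f c *\<^sub>R c) + z \<notin> N" by simp
  have inV: "(\<Sum>c\<in>B. f c *\<^sub>R c) \<in> V" for f
    unfolding B(2)[symmetric] by (intro span_sum span_scale span_base)
  have "closed V" using V by (rule closed_subspace)
  then have Vb: "V \<in> sets borel" by simp
  have mg: "(\<lambda>f. \<Sum>c\<in>B. f c *\<^sub>R c) \<in> measurable (\<Pi>\<^sub>M i\<in>B. (lborel :: real measure)) borel"
    by (intro borel_measurable_sum borel_measurable_scaleR borel_measurable_const)
      (simp add: measurable_component_singleton[where M = "\<lambda>_. lborel", simplified] measurable_lborel1)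
  have "AE y in subspace_lborel V. y \<in> V \<and> y + z \<notin> N"
    unfolding eqV
  proof (subst AE_distr_iff[OF mg])
    have "{y. y + z \<in> N} \<in> sets borel"
    proof -
      have "(\<lambda>y. y + z) \<in> borel_measurable borel" by measurable
      from measurable_sets[OF this Nb] show ?thesis by (simp add: vimage_def)
    qed
    then show "{x \<in> space borel. x \<in> V \<and> x + z \<notin> N} \<in> sets borel"
      using Vb by (simp add: Collect_conj_eq) (metis (no_types) sets.Int sets.compl_sets space_borel Compl_eq_Diff_UNIV Collect_neg_eq)
    show "AE x in Pi\<^sub>M B (\<lambda>i. lborel). (\<Sum>c\<in>B. x c *\<^sub>R c) \<in> V \<and> (\<Sum>c\<in>B. x c *\<^sub>R c) + z \<notin> N"
      using ae2 inV by simp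
  qed
  then show ?thesis
    by (rule AE_mp) (use inv[OF _ z] N(2) in \<open>auto intro!: AE_I2\<close>)
qed

text \<open>Fubini in the pair of point and dilation factor: for almost every factor
  \<open>s\<close>, the dilated point avoids \<open>S\<close> for almost every \<open>x\<close>. One
  nonzero such \<open>s\<close> is enough, since dilations preserve null sets. Genericity is thus
  reduced to lines through a single point \<open>x0\<close>.\<close>

lemma negligible_star:
  fixes S :: "'a::euclidean_space set"
  assumes S: "S \<in> sets borel" and c: "\<And>x. countable {s::real. x0 + s *\<^sub>R (x - x0) \<in> S}"
  shows "negligible S"
proof -
  let ?f = "\<lambda>p. x0 + fst p *\<^sub>R (snd p - x0)"
  have "(\<lambda>p::'a \<times> real. x0 + snd p *\<^sub>R (fst p - x0)) \<in> measurable (lborel \<Otimes>\<^sub>M lborel) borel"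
    by (simp add: lborel_prod) (intro borel_measurable_continuous_onI continuous_intros)
  from measurable_sets[OF this S]
  have meas: "{p\<in>space (lborel \<Otimes>\<^sub>M lborel). x0 + snd p *\<^sub>R (fst p - x0) \<in> S} \<in> sets ((lborel :: 'a measure) \<Otimes>\<^sub>M (lborel :: real measure))"
    by (simp add: vimage_def Int_def conj_commute)
  then have meas': "{p\<in>space (lborel \<Otimes>\<^sub>M lborel). x0 + snd p *\<^sub>R (fst p - x0) \<notin> S} \<in> sets ((lborel :: 'a measure) \<Otimes>\<^sub>M (lborel :: real measure))"
    by (rule sets.sets_Collect_neg)
  have "AE x in (lborel :: 'a measure). AE s in (lborel :: real measure). x0 + s *\<^sub>R (x - x0) \<notin> S"
  proof (rule AE_I2)
    fix x
    have "{s::real. x0 + s *\<^sub>R (x - x0) \<in> S} \<in> null_sets lborel"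
      by (rule countable_imp_null_set_lborel[OF c])
    from AE_not_in[OF this] show "AE s in (lborel :: real measure). x0 + s *\<^sub>R (x - x0) \<notin> S" by simp
  qed
  then have "AE s in (lborel :: real measure). AE x in (lborel :: 'a measure). x0 + s *\<^sub>R (x - x0) \<notin> S"
    using lborel_pair.AE_commute[of "\<lambda>x s. x0 + s *\<^sub>R (x - x0) \<notin> S"] meas' by simp
  moreover have "AE s in (lborel :: real measure). s \<noteq> 0"
    using AE_lborel_singleton[of "0::real"] .
  ultimately have "AE s in (lborel :: real measure). (AE x in (lborel :: 'a measure). x0 + s *\<^sub>R (x - x0) \<notin> S) \<and> s \<noteq> 0"
    by (rule AE_conjI)
  from AE_exists_witness[OF this] obtain s :: real where
    s: "AE x in (lborel :: 'a measure). x0 + s *\<^sub>R (x - x0) \<notin> S" "s \<noteq> 0" by auto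
  then obtain N where N: "N \<in> null_sets lborel" "{x :: 'a. x0 + s *\<^sub>R (x - x0) \<in> S} \<subseteq> N"
    unfolding eventually_ae_filter by auto
  have "negligible N" using N(1) by (auto simp: negligible_iff_null_sets null_sets_completionI)
  then have "negligible ((\<lambda>x. x0 + s *\<^sub>R (x - x0)) ` N)"
    by (intro negligible_differentiable_image_negligible[OF order_refl]) (auto intro!: derivative_intros)
  moreover have "S \<subseteq> (\<lambda>x. x0 + s *\<^sub>R (x - x0)) ` N"
  proof
    fix y assume y: "y \<in> S"
    let ?x = "x0 + (1 / s) *\<^sub>R (y - x0)"
    have "x0 + s *\<^sub>R (?x - x0) = y" using s(2) by simp
    then show "y \<in> (\<lambda>x. x0 + s *\<^sub>R (x - x0)) ` N" using N(2) y by (metis (mono_tags, lifting) image_eqI mem_Collect_eq subsetD)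
  qed
  ultimately show ?thesis by (rule negligible_subset)
qed

section \<open>Rational dependence and simple spectra\<close>

text \<open>Denominators without real zeros make the functions total. Complex coefficients at a real
  argument keep the class closed under conjugation, which then acts on the coefficients.\<close>

definition rat :: "(real \<Rightarrow> complex) \<Rightarrow> bool" where
  "rat f \<longleftrightarrow> (\<exists>p q. (\<forall>s. poly q (of_real s) \<noteq> 0) \<and> (\<forall>s. f s = poly p (of_real s) / poly q (of_real s)))"

lemma ratI: "(\<And>s. poly q (of_real s) \<noteq> 0) \<Longrightarrow> (\<And>s. f s = poly p (of_real s) / poly q (of_real s)) \<Longrightarrow> rat f"
  unfolding rat_def by blast

lemma rat_const: "rat (\<lambda>s. c)"
  by (rule ratI[of 1 _ "[:c:]"]) simp_all

lemma rat_of_real: "rat of_real"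
  by (rule ratI[of 1 _ "[:0, 1:]"]) simp_all

lemma rat_add: assumes "rat f" "rat g" shows "rat (\<lambda>s. f s + g s)"
proof -
  obtain p q where 1: "\<And>s. poly q (of_real s) \<noteq> 0" "\<And>s. f s = poly p (of_real s) / poly q (of_real s)"
    using assms(1) unfolding rat_def by blast
  obtain p' q' where 2: "\<And>s. poly q' (of_real s) \<noteq> 0" "\<And>s. g s = poly p' (of_real s) / poly q' (of_real s)"
    using assms(2) unfolding rat_def by blast
  show ?thesis
    by (rule ratI[of "q * q'" _ "p * q' + p' * q"]) (simp_all add: 1 2 field_simps)
qed

lemma rat_mult: assumes "rat f" "rat g" shows "rat (\<lambda>s. f s * g s)"
proof -
  obtain p q where 1: "\<And>s. poly q (of_real s) \<noteq> 0" "\<And>s. f s = poly p (of_real s) / poly q (of_real s)"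
    using assms(1) unfolding rat_def by blast
  obtain p' q' where 2: "\<And>s. poly q' (of_real s) \<noteq> 0" "\<And>s. g s = poly p' (of_real s) / poly q' (of_real s)"
    using assms(2) unfolding rat_def by blast
  show ?thesis
    by (rule ratI[of "q * q'" _ "p * p'"]) (simp_all add: 1 2)
qed

lemma rat_minus: "rat f \<Longrightarrow> rat (\<lambda>s. - f s)"
  using rat_mult[OF rat_const[of "-1"]] by simp

lemma rat_diff: "rat f \<Longrightarrow> rat g \<Longrightarrow> rat (\<lambda>s. f s - g s)"
  using rat_add[OF _ rat_minus] by simp

lemma rat_inverse: assumes "rat f" "\<And>s. f s \<noteq> 0" shows "rat (\<lambda>s. inverse (f s))"
proof -
  obtain p q where 1: "\<And>s. poly q (of_real s) \<noteq> 0" "\<And>s. f s = poly p (of_real s) / poly q (of_real s)"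
    using assms(1) unfolding rat_def by blast
  show ?thesis
    by (rule ratI[of p _ q]) (use assms(2) in \<open>simp_all add: 1\<close>)
qed

lemma rat_cnj: assumes "rat f" shows "rat (\<lambda>s. cnj (f s))"
proof -
  obtain p q where 1: "\<And>s. poly q (of_real s) \<noteq> 0" "\<And>s. f s = poly p (of_real s) / poly q (of_real s)"
    using assms unfolding rat_def by blast
  have c: "poly (map_poly cnj r) (of_real s) = cnj (poly r (of_real s))" for r :: "complex poly" and s :: real
    by (induction r) (simp_all add: map_poly_pCons)
  show ?thesis
    by (rule ratI[of "map_poly cnj q" _ "map_poly cnj p"]) (simp_all add: 1 c)
qed

lemma rat_sum: "(\<And>i. i \<in> I \<Longrightarrow> rat (f i)) \<Longrightarrow> rat (\<lambda>s. \<Sum>i\<in>I. f i s)"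
  by (induction I rule: infinite_finite_induct) (simp_all add: rat_const rat_add)

lemma rat_prod: "(\<And>i. i \<in> I \<Longrightarrow> rat (f i)) \<Longrightarrow> rat (\<lambda>s. \<Prod>i\<in>I. f i s)"
  by (induction I rule: infinite_finite_induct) (simp_all add: rat_const rat_mult)

lemma rat_finite_zeros:
  assumes "rat f" "f t \<noteq> 0" shows "finite {s. f s = 0}"
proof -
  obtain p q where 1: "\<And>s. poly q (of_real s) \<noteq> 0" "\<And>s. f s = poly p (of_real s) / poly q (of_real s)"
    using assms(1) unfolding rat_def by blast
  have "p \<noteq> 0" using assms(2) 1(2)[of t] by auto
  then have "finite {z. poly p z = 0}" by (rule poly_roots_finite)
  then have "finite (of_real -` {z. poly p z = 0})" by (rule finite_vimageI) (simp add: inj_of_real)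
  moreover have "{s. f s = 0} \<subseteq> of_real -` {z. poly p z = 0}" by (auto simp: 1)
  ultimately show ?thesis by (rule finite_subset[rotated])
qed

section \<open>Matrix functions with rational entries\<close>

definition ratm :: "(real \<Rightarrow> complex^'n^'m) \<Rightarrow> bool" where
  "ratm F \<longleftrightarrow> (\<forall>i j. rat (\<lambda>s. F s $ i $ j))"

lemma ratm_const: "ratm (\<lambda>s. A)"
  by (simp add: ratm_def rat_const)

lemma ratm_add: "ratm F \<Longrightarrow> ratm G \<Longrightarrow> ratm (\<lambda>s. F s + G s)"
  by (simp add: ratm_def rat_add)

lemma ratm_diff: "ratm F \<Longrightarrow> ratm G \<Longrightarrow> ratm (\<lambda>s. F s - G s)"
  by (simp add: ratm_def rat_diff)

lemma ratm_ct: "ratm F \<Longrightarrow> ratm (\<lambda>s. ct (F s))"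
  by (simp add: ratm_def rat_cnj)

lemma ratm_mult: "ratm F \<Longrightarrow> ratm G \<Longrightarrow> ratm (\<lambda>s. F s ** G s)"
  by (simp add: ratm_def matrix_matrix_mult_def rat_sum rat_mult)

lemma ratm_scaleR: "ratm F \<Longrightarrow> ratm (\<lambda>s. r *\<^sub>R F s)"
  by (simp add: ratm_def scaleR_conv_of_real[where 'a = complex] rat_mult rat_const)

lemma ratm_line: "ratm (\<lambda>s. A + s *\<^sub>R B)"
  by (simp add: ratm_def scaleR_conv_of_real[where 'a = complex] rat_mult rat_const rat_add rat_of_real)

lemma rat_det: "ratm F \<Longrightarrow> rat (\<lambda>s. det (F s))"
  unfolding det_def ratm_def by (intro rat_sum rat_mult rat_const rat_prod) blast

lemma det_ker:
  fixes A :: "complex^'n^'n"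
  shows "det A \<noteq> 0 \<longleftrightarrow> (\<forall>v. A *v v = 0 \<longrightarrow> v = 0)"
  by (metis invertible_det_nz invertible_left_inverse matrix_left_invertible_ker)

text \<open>Cramer's rule writes each entry of the inverse as a quotient of determinants.\<close>

lemma ratm_inv:
  fixes F :: "real \<Rightarrow> complex^'n^'n"
  assumes F: "ratm F" and inj: "\<And>s v. F s *v v = 0 \<Longrightarrow> v = 0"
  shows "ratm (\<lambda>s. matrix_inv (F s))"
  unfolding ratm_def
proof (intro allI)
  fix i j
  have d: "det (F s) \<noteq> 0" for s using inj det_ker by blast
  have "matrix_inv (F s) $ i $ j =
      det (\<chi> k l. if l = i then axis j 1 $ k else F s $ k $ l) * inverse (det (F s))" for s
  proof -
    have "F s *v (matrix_inv (F s) *v axis j 1) = axis j 1"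
      by (simp add: matrix_vector_mul_assoc inj_mm_invertible(1)[OF inj])
    then have "matrix_inv (F s) *v axis j 1 =
        (\<chi> i. det (\<chi> k l. if l = i then axis j 1 $ k else F s $ k $ l) / det (F s))"
      using cramer[OF d] by blast
    then have "(matrix_inv (F s) *v axis j 1) $ i =
        det (\<chi> k l. if l = i then axis j 1 $ k else F s $ k $ l) / det (F s)" by simp
    moreover have "(matrix_inv (F s) *v axis j 1) $ i = matrix_inv (F s) $ i $ j"
      by (simp add: matrix_vector_mult_def axis_def if_distrib cong: if_cong)
    ultimately show ?thesis by (simp add: divide_inverse)
  qed
  moreover have "rat (\<lambda>s. det (\<chi> k l. if l = i then axis j 1 $ k else F s $ k $ l) * inverse (det (F s)))"
  proof (intro rat_mult rat_inverse rat_det d F)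
    have "rat (\<lambda>s. if l = i then axis j 1 $ k else F s $ k $ l)" for k l
      using F by (cases "l = i") (simp_all add: rat_const ratm_def)
    then show "ratm (\<lambda>s. \<chi> k l. if l = i then axis j 1 $ k else F s $ k $ l)"
      by (simp add: ratm_def)
  qed
  ultimately show "rat (\<lambda>s. matrix_inv (F s) $ i $ j)" by simp
qed

lemma continuous_on_det:
  fixes F :: "'a::topological_space \<Rightarrow> complex^'n^'n"
  assumes "continuous_on S F" shows "continuous_on S (\<lambda>x. det (F x))"
  unfolding det_def
  by (intro continuous_on_sum continuous_on_mult continuous_on_const continuous_on_prod
      continuous_on_component assms)

text \<open>The orthogonal projection onto Hermitian matrices. Conditions phrased through it extend
  to all matrices and are invariant in the orthogonal directions, so that ambient Lebesgue measure
  and \<open>AE_subspace_lborel\<close> apply.\<close>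

definition hpart :: "complex^'N^'N \<Rightarrow> complex^'N^'N" where
  "hpart X = (1/2) *\<^sub>R (X + ct X)"

lemma ct_hpart: "ct (hpart X) = hpart X"
  by (simp add: hpart_def ct_simps add.commute)

lemma hpart_id: "ct X = X \<Longrightarrow> hpart X = X"
  by (simp add: hpart_def scaleR_2[symmetric])

lemma hpart_add: "hpart (X + Y) = hpart X + hpart Y"
  by (simp add: hpart_def ct_simps algebra_simps)

lemma continuous_on_hpart: "continuous_on S f \<Longrightarrow> continuous_on S (\<lambda>x. hpart (f x))"
  unfolding hpart_def by (intro continuous_intros continuous_on_ct)

lemma ratm_hpart: "ratm F \<Longrightarrow> ratm (\<lambda>s. hpart (F s))"
  unfolding hpart_def by (intro ratm_scaleR ratm_add ratm_ct)

text \<open>A Hermitian matrix with a cyclic vector has simple spectrum; the determinant of the Krylov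
  matrix turns this into a polynomial condition.\<close>

definition idx :: "'N::finite \<Rightarrow> nat" where
  "idx = (SOME h. bij_betw h UNIV {..<CARD('N)})"

lemma bij_idx: "bij_betw (idx :: 'N::finite \<Rightarrow> nat) UNIV {..<CARD('N)}"
proof -
  have "\<exists>h. bij_betw h (UNIV :: 'N set) {..<CARD('N)}"
    by (rule finite_same_card_bij) simp_all
  then show ?thesis unfolding idx_def by (rule someI_ex)
qed

primrec krow :: "complex^'N^'N \<Rightarrow> nat \<Rightarrow> complex^'N" where
  "krow H 0 = (\<chi> j. 1)"
| "krow H (Suc k) = krow H k v* H"

definition krylov :: "complex^'N^'N \<Rightarrow> complex^'N^'N" where
  "krylov H = (\<chi> i. krow H (idx i))"

lemma krow_eigenvector:
  assumes "H *v x = c *s x"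
  shows "(\<Sum>j\<in>UNIV. krow H k $ j * x $ j) = c ^ k * (\<Sum>j\<in>UNIV. x $ j)"
proof (induction k)
  case (Suc k)
  have "(\<Sum>j\<in>UNIV. krow H (Suc k) $ j * x $ j) = (\<Sum>j\<in>UNIV. \<Sum>i\<in>UNIV. krow H k $ i * (H $ i $ j * x $ j))"
    by (simp add: vector_matrix_mult_def sum_distrib_right mult.assoc mult.left_commute)
  also have "\<dots> = (\<Sum>i\<in>UNIV. \<Sum>j\<in>UNIV. krow H k $ i * (H $ i $ j * x $ j))" by (rule sum.swap)
  also have "\<dots> = (\<Sum>i\<in>UNIV. krow H k $ i * (H *v x) $ i)"
    by (simp add: matrix_vector_mult_def sum_distrib_left)
  also have "\<dots> = c * (\<Sum>i\<in>UNIV. krow H k $ i * x $ i)"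
    by (simp add: assms sum_distrib_left mult.left_commute)
  finally show ?case by (simp add: Suc.IH mult.assoc)
qed simp

lemma krylov_ker:
  assumes "H *v x = c *s x" "(\<Sum>j\<in>UNIV. x $ j) = 0" "det (krylov H) \<noteq> 0"
  shows "x = 0"
proof -
  have "krylov H *v x = 0"
    using krow_eigenvector[OF assms(1)] assms(2)
    by (simp add: vec_eq_iff matrix_vector_mult_def krylov_def)
  then show ?thesis using assms(3) det_ker by blast
qed

text \<open>Two eigenvectors with the same eigenvalue have a combination whose entries sum to zero,
  and the Krylov matrix kills such eigenvectors. If that combination is trivial, the entries of
  \<open>w j\<close> already sum to zero.\<close>

lemma krylov_simple:
  fixes H :: "complex^'N^'N"
  assumes H: "hermitian H" and det: "det (krylov H) \<noteq> 0"
  shows "inj_on (eigval H) {1..CARD('N)}"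
proof (rule inj_onI)
  fix i j assume i: "i \<in> {1..CARD('N)}" and j: "j \<in> {1..CARD('N)}" and eq: "eigval H i = eigval H j"
  obtain w :: "nat \<Rightarrow> complex^'N" where w: "orthonormal_on w {1..CARD('N)}"
    "\<And>i. i \<in> {1..CARD('N)} \<Longrightarrow> H *v w i = of_real (eigval H i) *s w i"
    using hermitian_sorted_eigenbasis[OF H] by metis
  show "i = j"
  proof (rule ccontr)
    assume "i \<noteq> j"
    define a where "a k = (\<Sum>l\<in>UNIV. w k $ l)" for k
    define x where "x = a j *s w i - a i *s w j"
    have "H *v x = of_real (eigval H i) *s x"
      by (simp add: x_def mv.diff_right vec.scale w(2)[OF i] w(2)[OF j] eq vec.scale_right_diff_distrib mult.commute)
    moreover have "(\<Sum>l\<in>UNIV. x $ l) = 0"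
      by (simp add: x_def sum_subtractf a_def sum_distrib_left[symmetric])
    ultimately have "x = 0" using krylov_ker det by blast
    then have "cdot (w i) x = 0" by (simp add: cdot_simps)
    then have "a j = 0" using w(1) i j \<open>i \<noteq> j\<close> by (simp add: x_def cdot_simps orthonormal_on_def)
    then have "w j = 0" using krylov_ker[OF w(2)[OF j]] det by (simp add: a_def)
    then show False using orthonormal_norm[OF w(1) j] by simp
  qed
qed

lemma ratm_krylov:
  assumes "ratm F" shows "ratm (\<lambda>s. krylov (F s))"
proof -
  have "rat (\<lambda>s. krow (F s) k $ j)" for k j
  proof (induction k arbitrary: j)
    case 0
    then show ?case by (simp add: rat_const)
  next
    case (Suc k)
    then show ?case using assms
      by (simp add: vector_matrix_mult_def rat_sum rat_mult ratm_def)
  qed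
  then show ?thesis by (simp add: ratm_def krylov_def)
qed

lemma continuous_on_krylov:
  assumes "continuous_on S F" shows "continuous_on S (\<lambda>x. krylov (F x))"
proof -
  have "continuous_on S (\<lambda>x. krow (F x) k)" for k
  proof (induction k)
    case (Suc k)
    then show ?case
      by (simp add: vector_matrix_mult_def)
        (intro continuous_on_vec_lambda continuous_on_sum continuous_on_mult continuous_on_component assms)
  qed simp
  then show ?thesis unfolding krylov_def by (intro continuous_on_vec_lambda)
qed

text \<open>A Vandermonde matrix with the distinct nodes \<open>idx j\<close>: a kernel vector of
  its transpose is the coefficient vector of a polynomial of degree below \<open>CARD('N)\<close>
  with \<open>CARD('N)\<close> roots.\<close>

lemma krylov_diag:
  fixes H :: "complex^'N^'N"
  defines "H \<equiv> \<chi> i j. if i = j then of_nat (idx i) else 0"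
  shows "det (krylov H) \<noteq> 0"
proof -
  have kr: "krow H k $ j = of_nat (idx j) ^ k" for k j
    by (induction k arbitrary: j)
      (simp_all add: H_def vector_matrix_mult_def mult_delta_right mult.commute)
  have "y = 0" if y: "transpose (krylov H) *v y = 0" for y
  proof -
    define p where "p = (\<Sum>i\<in>(UNIV::'N set). monom (y $ i) (idx i))"
    have inj: "inj (idx :: 'N \<Rightarrow> nat)" and lt: "idx i < CARD('N)" for i :: 'N
      using bij_idx[where 'N = 'N] by (auto simp: bij_betw_def)
    have "poly p (of_nat (idx j)) = 0" for j :: 'N
    proof -
      have "(transpose (krylov H) *v y) $ j = 0" by (simp only: y zero_index)
      then show ?thesis
        by (simp add: p_def poly_sum poly_monom vector_matrix_mult_def krylov_def kr mult.commute)
    qed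
    then have sub: "(\<lambda>j::'N. of_nat (idx j)) ` UNIV \<subseteq> {z. poly p z = 0}" by auto
    have "inj (\<lambda>j::'N. of_nat (idx j) :: complex)" using inj by (simp add: inj_def)
    then have card: "card ((\<lambda>j::'N. of_nat (idx j) :: complex) ` UNIV) = CARD('N)" by (rule card_image)
    have deg: "degree p < CARD('N)"
      unfolding p_def
    proof (rule degree_sum_less)
      show "degree (monom (y $ i) (idx i)) < CARD('N)" for i
        using degree_monom_le[of "y $ i" "idx i"] lt[of i] by linarith
    qed simp
    have "p = 0"
    proof (rule ccontr)
      assume "p \<noteq> 0"
      then have "CARD('N) \<le> card {z. poly p z = 0}"
        unfolding card[symmetric] by (intro card_mono poly_roots_finite sub)
      also have "\<dots> \<le> degree p" by (rule card_poly_roots_bound[OF \<open>p \<noteq> 0\<close>])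
      finally show False using deg by simp
    qed
    then have "coeff p (idx i) = 0" for i :: 'N by simp
    moreover have "coeff p (idx i) = y $ i" for i :: 'N
      using inj by (simp add: p_def coeff_sum inj_eq)
    ultimately show "y = 0" by (simp add: vec_eq_iff)
  qed
  then have "det (transpose (krylov H)) \<noteq> 0" using det_ker by blast
  then show ?thesis by (simp add: det_transpose)
qed

lemma negligible_krylov: "negligible {A :: complex^'N^'N. det (krylov (hpart A)) = 0}"
proof -
  define H0 :: "complex^'N^'N" where "H0 = (\<chi> i j. if i = j then of_nat (idx i) else 0)"
  have h0: "hpart H0 = H0" by (rule hpart_id) (simp add: H0_def vec_eq_iff)
  have k0: "det (krylov H0) \<noteq> 0" unfolding H0_def by (rule krylov_diag)
  show ?thesis
  proof (rule negligible_star)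
    have "closed {A :: complex^'N^'N. det (krylov (hpart A)) = 0}"
      by (intro closed_Collect_eq continuous_on_det continuous_on_krylov continuous_on_hpart continuous_on_id continuous_on_const)
    then show "{A :: complex^'N^'N. det (krylov (hpart A)) = 0} \<in> sets borel" by simp
    fix x
    have "rat (\<lambda>s. det (krylov (hpart (H0 + s *\<^sub>R (x - H0)))))"
      by (intro rat_det ratm_krylov ratm_hpart ratm_line)
    then have "finite {s. det (krylov (hpart (H0 + s *\<^sub>R (x - H0)))) = 0}"
      by (rule rat_finite_zeros[of _ 0]) (simp add: h0 k0)
    then show "countable {s. H0 + s *\<^sub>R (x - H0) \<in> {A. det (krylov (hpart A)) = 0}}"
      by (simp add: countable_finite)
  qed
qed

section \<open>Graph charts of the Grassmannian\<close>

text \<open>Graph coordinates at \<open>Q\<close>: the range of \<open>chart Q Y\<close> is the graph of the off-diagonal block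
  of \<open>Y\<close> over the range of \<open>Q\<close>.\<close>

definition chartW :: "complex^'N^'N \<Rightarrow> complex^'N^'N \<Rightarrow> complex^'N^'N" where
  "chartW Q Y = Q + (mat 1 - Q) ** Y ** Q"

text \<open>With \<open>W = chartW Q Y\<close> this is \<open>W (ct W W)^-1 ct W\<close>. The matrix
  that is inverted agrees with the Gram matrix of \<open>W\<close> on the range of \<open>Q\<close>
  and is positive definite on the whole space, so the chart is defined for every
  \<open>Y\<close>.\<close>

definition chart :: "complex^'N^'N \<Rightarrow> complex^'N^'N \<Rightarrow> complex^'N^'N" where
  "chart Q Y = chartW Q Y **
     matrix_inv (mat 1 + ct ((mat 1 - Q) ** Y ** Q) ** ((mat 1 - Q) ** Y ** Q)) ** ct (chartW Q Y)"

lemma one_plus_gram_ker: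
  fixes Z :: "complex^'N^'N"
  assumes "(mat 1 + ct Z ** Z) *v v = 0" shows "v = 0"
proof -
  have "0 = Re (cdot v ((mat 1 + ct Z ** Z) *v v))" by (simp add: assms cdot_simps)
  also have "\<dots> = (norm v)\<^sup>2 + (norm (Z *v v))\<^sup>2"
    by (simp add: mv.add_left cdot_simps matrix_vector_mul_assoc[symmetric] cdot_ct[symmetric] cdot_self)
  finally show ?thesis using zero_le_power2[of "norm v"] zero_le_power2[of "norm (Z *v v)"]
    by (simp add: add_nonneg_eq_0_iff)
qed

lemma projector_norm_le:
  fixes Q :: "complex^'N^'N"
  assumes "ct Q = Q" "Q ** Q = Q" shows "norm (Q *v x) \<le> norm x"
proof -
  have "(norm (Q *v x))\<^sup>2 = inner x (Q *v x)"
  proof -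
    have "cdot (Q *v x) (Q *v x) = cdot x (Q *v x)"
      by (simp add: cdot_ct assms matrix_vector_mul_assoc)
    then show ?thesis by (simp add: cdot_self inner_cdot flip: of_real_power)
      (metis Re_complex_of_real of_real_power)
  qed
  also have "\<dots> \<le> norm x * norm (Q *v x)" by (rule norm_cauchy_schwarz)
  finally have "norm (Q *v x) * norm (Q *v x) \<le> norm x * norm (Q *v x)" by (simp add: power2_eq_square)
  then show ?thesis by (cases "norm (Q *v x) = 0") (simp_all add: mult_le_cancel_right)
qed

context
  fixes Q :: "complex^'N^'N" and n :: nat
  assumes Q: "Q \<in> projectors n"
begin

lemma chart_props:
  "chart Q Y \<in> projectors n" "chart Q Y ** chartW Q Y = chartW Q Y" "\<exists>L. chart Q Y = chartW Q Y ** L"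
proof -
  note q = projectors_ct[OF Q] projectors_idem[OF Q]
  define Z where "Z = (mat 1 - Q) ** Y ** Q"
  define W where "W = chartW Q Y"
  have W: "W = Q + Z" by (simp add: W_def chartW_def Z_def)
  have ZQ: "Z ** Q = Z" and QZ: "Q ** Z = 0" by (simp_all add: Z_def mm_simps q mm_absorb[OF q(2)])
  have QcZ: "Q ** ct Z = ct Z" using ZQ q by (metis ct_mult)
  have cZQ: "ct Z ** Q = 0" using QZ q by (metis ct_mult ct_zero)
  define N where "N = mat 1 + ct Z ** Z"
  have inv0: "N ** matrix_inv N = mat 1" "matrix_inv N ** N = mat 1"
    using inj_mm_invertible[of N] one_plus_gram_ker[of Z] unfolding N_def by blast+
  define Ni where "Ni = matrix_inv N"
  note inv = inv0[folded Ni_def]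
  have NQ: "N ** Q = Q ** N" by (simp add: N_def mm_simps mm_absorb[OF ZQ] QcZ)
  have NiQ: "Ni ** Q = Q ** Ni" unfolding Ni_def
    by (rule matrix_inv_commute[OF inv0 NQ])
  have ctN: "ct N = N" by (simp add: N_def ct_simps)
  have ctNi: "ct Ni = Ni"
  proof -
    have "ct Ni ** N = mat 1" by (metis ctN ct_mult ct_mat1 inv(1))
    then have "ct Ni ** (N ** Ni) = Ni" by (simp add: matrix_mul_assoc)
    then show ?thesis by (simp add: inv)
  qed
  \<comment> \<open>\<open>N\<close> commutes with \<open>Q\<close>, so \<open>Ni\<close> acts on
    the range of \<open>Q\<close> as the inverse Gram matrix of \<open>W\<close>.\<close>
  have WW: "ct W ** W = N ** Q"
    by (simp add: W ct_simps mm_simps q QZ cZQ N_def mm_absorb[OF ZQ])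
  have WQ: "W ** Q = W" by (simp add: W mm_simps q ZQ)
  have c: "chart Q Y = W ** Ni ** ct W"
    by (simp add: chart_def W_def Ni_def N_def Z_def)
  show fix_W: "chart Q Y ** chartW Q Y = chartW Q Y"
  proof -
    have "chart Q Y ** W = W ** Ni ** (ct W ** W)" by (simp add: c matrix_mul_assoc)
    also have "\<dots> = W ** (Ni ** N) ** Q" unfolding WW by (simp add: matrix_mul_assoc)
    also have "\<dots> = W" by (simp add: inv WQ)
    finally show ?thesis by (simp add: W_def)
  qed
  have idem: "chart Q Y ** chart Q Y = chart Q Y"
  proof -
    have "chart Q Y ** chart Q Y = (chart Q Y ** W) ** Ni ** ct W"
      by (subst (2) c) (simp add: matrix_mul_assoc)
    then show ?thesis using fix_W by (simp add: W_def[symmetric] c)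
  qed
  have "rtr (chart Q Y) = rtr (ct W ** (W ** Ni))"
    unfolding c by (rule rtr_commute)
  also have "ct W ** (W ** Ni) = N ** Q ** Ni" by (simp add: matrix_mul_assoc WW)
  also have "\<dots> = Q" by (simp add: NQ matrix_mul_assoc[symmetric] inv)
  finally have tr: "rtr (chart Q Y) = n" by (simp add: projectors_rtr[OF Q])
  have "ct (chart Q Y) = chart Q Y" by (simp add: c ct_mult ctNi matrix_mul_assoc)
  with idem tr show "chart Q Y \<in> projectors n" by (simp add: projectors_iff)
  show "\<exists>L. chart Q Y = chartW Q Y ** L" using c by (metis W_def matrix_mul_assoc)
qed

text \<open>Among projectors of rank \<open>n\<close> the chart point is the only solution of a
  closed equation; measurability arguments use this equation in place of the formula with the
  inverse.\<close>

lemma chart_unique: "P \<in> projectors n \<Longrightarrow> P ** chartW Q Y = chartW Q Y \<Longrightarrow> P = chart Q Y"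
proof -
  assume P: "P \<in> projectors n" "P ** chartW Q Y = chartW Q Y"
  obtain L where "chart Q Y = chartW Q Y ** L" using chart_props(3) by blast
  then have "P ** chart Q Y = chart Q Y" by (simp add: matrix_mul_assoc P(2))
  then show ?thesis by (rule projectors_eqI[OF chart_props(1) P(1), symmetric])
qed

lemma chart_offdiag: "chart Q ((mat 1 - Q) ** Y ** Q) = chart Q Y"
proof -
  have "(mat 1 - Q) ** ((mat 1 - Q) ** Y ** Q) ** Q = (mat 1 - Q) ** Y ** Q"
    by (simp add: mm_simps projectors_idem[OF Q] mm_absorb[OF projectors_idem[OF Q]])
  then show ?thesis by (simp add: chart_def chartW_def)
qed

text \<open>\<open>mat 1 - chart Q Y'\<close> kills \<open>chartW Q Y'\<close>; applied to
  \<open>chart Q Y = chartW Q Y ** L\<close> it leaves only the difference of the two frames, which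
  is linear in \<open>Y - Y'\<close>. The constant depends on \<open>Y\<close> through
  \<open>L\<close>, but not on \<open>Y'\<close>.\<close>

lemma chart_lipschitz:
  obtains C where "\<And>Y'. norm (chart Q Y' - chart Q Y) \<le> C * norm (Y' - Y)"
proof -
  obtain k where k: "k > 0" "\<And>(a :: complex^'N^'N) (b :: complex^'N^'N). norm (a ** b) \<le> norm a * norm b * k"
    by (rule mm_norm_bound) blast
  obtain L where L: "chart Q Y = chartW Q Y ** L" using chart_props(3) by blast
  define a where "a = norm (mat 1 :: complex^'N^'N) + sqrt n"
  define q where "q = norm (mat 1 - Q)"
  have a: "a \<ge> 0" by (simp add: a_def)
  show thesis
  proof (rule that)
    fix Y'
    have n1: "norm (chart Q Y') = sqrt n"
      using projectors_norm[OF chart_props(1)[of Y']] by (metis norm_ge_zero real_sqrt_unique)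
    have "norm (mat 1 - chart Q Y') \<le> a"
      using norm_triangle_ineq4[of "mat 1" "chart Q Y'"] unfolding a_def n1 by simp
    moreover have eq: "(mat 1 - chart Q Y') ** chart Q Y = (mat 1 - chart Q Y') ** ((mat 1 - Q) ** (Y - Y') ** Q) ** L"
    proof -
      have "(mat 1 - chart Q Y') ** chartW Q Y = (mat 1 - chart Q Y') ** (chartW Q Y - chartW Q Y')"
        by (simp add: mm_simps chart_props(2))
      also have "chartW Q Y - chartW Q Y' = (mat 1 - Q) ** (Y - Y') ** Q"
        by (simp add: chartW_def mm_simps)
      finally show ?thesis by (simp add: L matrix_mul_assoc)
    qed
    moreover have "norm ((mat 1 - Q) ** (Y - Y') ** Q) \<le> q * norm (Y - Y') * k * norm Q * k"
      unfolding q_def using k by (intro order_trans[OF k(2)] mult_right_mono) auto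
    ultimately have "norm ((mat 1 - chart Q Y') ** ((mat 1 - Q) ** (Y - Y') ** Q)) \<le>
        a * (q * norm (Y - Y') * k * norm Q * k) * k"
      using k a by (intro order_trans[OF k(2)] mult_right_mono mult_mono) (auto simp: q_def)
    then have "norm ((mat 1 - chart Q Y') ** ((mat 1 - Q) ** (Y - Y') ** Q)) * norm L * k
        \<le> a * (q * norm (Y - Y') * k * norm Q * k) * k * norm L * k"
      using k(1) by (intro mult_right_mono) auto
    then have "norm ((mat 1 - chart Q Y') ** chart Q Y) \<le> a * (q * norm (Y - Y') * k * norm Q * k) * k * norm L * k"
      unfolding eq by (rule order_trans[OF k(2)])
    then have "(norm ((mat 1 - chart Q Y') ** chart Q Y))\<^sup>2 \<le> (a * (q * norm (Y - Y') * k * norm Q * k) * k * norm L * k)\<^sup>2"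
      by (intro power_mono) auto
    then have "(norm (chart Q Y - chart Q Y'))\<^sup>2 \<le> 2 * (a * (q * norm (Y - Y') * k * norm Q * k) * k * norm L * k)\<^sup>2"
      unfolding norm_diff_projectors[OF chart_props(1) chart_props(1)] by simp
    also have "\<dots> \<le> (2 * (a * (q * norm (Y - Y') * k * norm Q * k) * k * norm L * k))\<^sup>2"
      by (simp add: power_mult_distrib)
    finally have "norm (chart Q Y - chart Q Y') \<le> 2 * (a * (q * norm (Y - Y') * k * norm Q * k) * k * norm L * k)"
      by (rule power2_le_imp_le) (use a k in \<open>simp add: q_def\<close>)
    then show "norm (chart Q Y' - chart Q Y) \<le> (2 * a * q * k * norm Q * k * k * norm L * k) * norm (Y' - Y)"
      by (simp add: norm_minus_commute mult_ac)
  qed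
qed

lemma pointwise_lipschitz_chart: "pointwise_lipschitz_on S (chart Q)"
  unfolding pointwise_lipschitz_on_def
proof
  fix Y
  obtain C where "\<And>Y'. norm (chart Q Y' - chart Q Y) \<le> C * norm (Y' - Y)" by (rule chart_lipschitz) blast
  then show "\<exists>B d. d > 0 \<and> (\<forall>y\<in>S. dist y Y < d \<longrightarrow> norm (chart Q y - chart Q Y) \<le> B * norm (y - Y))"
    by (intro exI[of _ C] exI[of _ "1::real"]) simp
qed

lemma chart_tendsto:
  assumes "f \<longlonglongrightarrow> Y" shows "(\<lambda>j. chart Q (f j)) \<longlonglongrightarrow> chart Q Y"
proof -
  obtain C where C: "\<And>Y'. norm (chart Q Y' - chart Q Y) \<le> C * norm (Y' - Y)" by (rule chart_lipschitz) blast
  have "(\<lambda>j. f j - Y) \<longlonglongrightarrow> 0" using assms by (simp add: LIM_zero)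
  then have "(\<lambda>j. chart Q (f j) - chart Q Y) \<longlonglongrightarrow> 0"
    by (rule tendsto_0_le[where K = C]) (use C in \<open>simp add: mult.commute\<close>)
  then show ?thesis by (simp add: LIM_zero_iff)
qed

text \<open>The columns of \<open>X\<close> form a frame whose component over the range of
  \<open>Q\<close> is invertible there; right multiplication by the inverse of that component
  normalises the frame to a graph.\<close>

lemma chart_of_frame:
  assumes "Q ** X = Q ** X ** Q" "X ** Q = X" and inj: "\<And>v. (Q ** X + mat 1 - Q) *v v = 0 \<Longrightarrow> v = 0"
  shows "\<exists>Y. chart Q Y ** X = X \<and> (\<forall>P\<in>projectors n. P ** X = X \<longrightarrow> P = chart Q Y)"
proof -
  note q = projectors_idem[OF Q]
  define J where "J = Q ** X + mat 1 - Q"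
  have inv: "J ** matrix_inv J = mat 1" "matrix_inv J ** J = mat 1"
    using inj_mm_invertible[of J] inj unfolding J_def by blast+
  have JQ: "J ** Q = Q ** X" and QJ: "Q ** J = Q ** X"
    by (simp_all add: J_def mm_simps q mm_absorb[OF assms(2)] assms(1)[symmetric])
  have JiQ: "matrix_inv J ** Q = Q ** matrix_inv J"
    by (rule matrix_inv_commute[OF inv]) (unfold JQ QJ, rule refl)
  define W where "W = X ** matrix_inv J ** Q"
  have WQ: "W ** Q = W" by (simp add: W_def mm_absorb[OF q])
  have "Q ** W = J ** Q ** matrix_inv J ** Q" by (simp add: W_def JQ matrix_mul_assoc)
  also have "\<dots> = J ** (Q ** matrix_inv J) ** Q" by (simp add: matrix_mul_assoc)
  also have "\<dots> = Q" unfolding JiQ[symmetric] by (simp add: matrix_mul_assoc inv q)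
  finally have QW: "Q ** W = Q" .
  have cW: "chartW Q W = W" by (simp add: chartW_def mm_simps QW WQ q)
  have "W ** J = X ** matrix_inv J ** (J ** Q)" by (simp add: W_def QJ JQ matrix_mul_assoc[symmetric])
  also have "\<dots> = X" by (simp add: matrix_mul_assoc mm_absorb[OF inv(2)] assms(2))
  finally have WJ: "W ** J = X" .
  have "chart Q W ** X = X" using chart_props(2)[of W] WJ by (metis cW matrix_mul_assoc)
  moreover have "P = chart Q W" if "P \<in> projectors n" "P ** X = X" for P
  proof (rule chart_unique[OF that(1)])
    show "P ** chartW Q W = chartW Q W" unfolding cW by (simp add: W_def matrix_mul_assoc that(2))
  qed
  ultimately show ?thesis by blast
qed

end

text \<open>The frame \<open>P ** Q\<close> has the component \<open>Q ** P ** Q\<close>. A vector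
  of the range of \<open>Q\<close> killed by it is killed by \<open>P\<close>, hence fixed by
  \<open>Q - P\<close>, which is a strict contraction within the radius. The radius does not depend
  on \<open>Q\<close>, so finitely many charts cover the compact set of projectors.\<close>

lemma chart_surj:
  obtains \<rho> where "\<rho> > 0" "\<And>(P :: complex^'N^'N) Q. P \<in> projectors n \<Longrightarrow> Q \<in> projectors n \<Longrightarrow> norm (P - Q) < \<rho> \<Longrightarrow> \<exists>Y. P = chart Q Y"
proof -
  have "\<exists>k>0. \<forall>(a :: complex^'N^'N) (x :: complex^'N). norm (a *v x) \<le> norm a * norm x * k" by (rule mv.pos_bounded)
  then obtain k where k: "k > 0" "\<And>(a :: complex^'N^'N) (x :: complex^'N). norm (a *v x) \<le> norm a * norm x * k" by metis
  show thesis
  proof (rule that[of "1 / k"])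
    show "1 / k > 0" using k by simp
    fix P Q :: "complex^'N^'N" assume P: "P \<in> projectors n" and Q: "Q \<in> projectors n" and d: "norm (P - Q) < 1 / k"
    note q = projectors_ct[OF Q] projectors_idem[OF Q] and p = projectors_ct[OF P] projectors_idem[OF P]
    have "\<exists>Y. chart Q Y ** (P ** Q) = P ** Q \<and> (\<forall>P'\<in>projectors n. P' ** (P ** Q) = P ** Q \<longrightarrow> P' = chart Q Y)"
    proof (rule chart_of_frame[OF Q])
      show "Q ** (P ** Q) = Q ** (P ** Q) ** Q" "P ** Q ** Q = P ** Q"
        by (simp_all add: matrix_mul_assoc mm_absorb[OF q(2)])
      fix v assume v: "(Q ** (P ** Q) + mat 1 - Q) *v v = 0"
      have "(mat 1 - Q) ** (Q ** (P ** Q) + mat 1 - Q) = mat 1 - Q" by (simp add: mm_simps q)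
      then have "(mat 1 - Q) *v v = 0" by (metis v matrix_vector_mul_assoc mv.zero_right)
      then have vQ: "Q *v v = v" by (simp add: mv.diff_left)
      have "(Q ** (P ** Q)) *v v = 0" using v by (simp add: mv.diff_left mv.add_left vQ)
      then have "Q *v (P *v v) = 0" by (simp add: matrix_vector_mul_assoc[symmetric] vQ)
      then have "cdot v (Q *v (P *v v)) = 0" by (simp add: cdot_simps)
      then have "cdot v (P *v v) = 0" by (metis cdot_ct q(1) vQ)
      moreover have "cdot (P *v v) (P *v v) = cdot v (P *v v)"
        by (simp add: cdot_ct p matrix_vector_mul_assoc)
      ultimately have "P *v v = 0" by (simp add: cdot_self)
      then have "v = (Q - P) *v v" by (simp add: mv.diff_left vQ)
      then have "norm v \<le> norm (Q - P) * norm v * k" using k(2)[of "Q - P" v] by simp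
      then have "norm v \<le> (norm (P - Q) * k) * norm v" by (simp add: norm_minus_commute mult_ac)
      moreover have "norm (P - Q) * k < 1" using d k(1) by (simp add: pos_less_divide_eq)
      ultimately show "v = 0" by (smt (verit) mult_le_cancel_right1 zero_less_norm_iff)
    qed
    then show "\<exists>Y. P = chart Q Y" using P by (metis matrix_mul_assoc p(2))
  qed
qed

text \<open>\<open>U\<close> may lie outside the chart at \<open>Q\<close>. Its frame
  \<open>R ** Q\<close> is perturbed by \<open>s *\<^sub>R Q\<close>, which makes the component over
  the range of \<open>Q\<close> invertible for all but finitely many \<open>s\<close>.\<close>

lemma chart_approach:
  fixes Q U :: "complex^'N^'N"
  assumes Q: "Q \<in> projectors n" and U: "U \<in> projectors n"
  obtains Y where "(\<lambda>j. chart Q (Y j)) \<longlonglongrightarrow> U"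
proof -
  note q = projectors_ct[OF Q] projectors_idem[OF Q]
  obtain R where R: "ct R ** R = mat 1" "R ** ct R = mat 1" "R ** Q = U ** R"
    by (rule projectors_unitary_equiv[OF Q U])
  let ?X = "\<lambda>s::real. R ** Q + s *\<^sub>R Q"
  let ?J = "\<lambda>s. Q ** ?X s + mat 1 - Q"
  \<comment> \<open>Nontriviality of the determinant in \<open>s\<close>: at \<open>s = 2\<close>
    the vector \<open>Q *v (R *v v)\<close>, of norm at most \<open>norm v\<close>, cannot cancel
    \<open>2 *\<^sub>R v\<close>.\<close>
  have J2: "v = 0" if v: "?J 2 *v v = 0" for v
  proof -
    have "(mat 1 - Q) ** ?J 2 = mat 1 - Q" by (simp add: mm_simps q)
    then have "(mat 1 - Q) *v v = 0" by (metis v matrix_vector_mul_assoc mv.zero_right)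
    then have vQ: "Q *v v = v" by (simp add: mv.diff_left)
    have "Q *v (R *v v) + 2 *\<^sub>R v = 0"
      using v by (simp add: mv.diff_left mv.add_left mm.add_right mm.scaleR_right mv.scaleR_left q vQ
          matrix_vector_mul_assoc[symmetric])
    then have "2 *\<^sub>R v = - (Q *v (R *v v))" by (simp add: eq_neg_iff_add_eq_0 add.commute)
    then have "2 * norm v = norm (Q *v (R *v v))" by (metis norm_minus_cancel norm_scaleR abs_numeral)
    also have "\<dots> \<le> norm (R *v v)" by (rule projector_norm_le[OF q])
    also have "\<dots> = norm v"
    proof -
      have "cdot (R *v v) (R *v v) = cdot v v" by (simp add: cdot_ct matrix_vector_mul_assoc R)
      then have "(norm (R *v v))\<^sup>2 = (norm v)\<^sup>2" unfolding cdot_self by (metis of_real_eq_iff)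
      then show ?thesis by (simp add: power2_eq_iff_nonneg)
    qed
    finally show "v = 0" by simp
  qed
  have J_line: "?J = (\<lambda>s. (Q ** (R ** Q) + mat 1 - Q) + s *\<^sub>R Q)" by (rule ext) (simp add: mm_simps q)
  have "ratm ?J" unfolding J_line by (rule ratm_line)
  moreover have "det (?J 2) \<noteq> 0" unfolding det_ker using J2 by blast
  ultimately have "finite {s. det (?J s) = 0}" by (intro rat_finite_zeros[OF rat_det])
  then obtain d where d: "d > 0" "\<And>s. det (?J s) = 0 \<Longrightarrow> s \<noteq> 0 \<Longrightarrow> d \<le> dist 0 s"
    using finite_set_avoid[of "{s. det (?J s) = 0}" 0] by auto
  define s where "s j = d / real (j + 2)" for j
  have s: "0 < s j" "s j < d" for j
  proof -
    show "0 < s j" using d(1) by (simp add: s_def)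
    have "0 \<le> d * real j" using d(1) by simp
    then have "0 < d + d * real j" using d(1) by linarith
    then show "s j < d" using d(1) by (simp add: s_def pos_divide_less_eq distrib_left)
  qed
  have "\<exists>Y. chart Q Y ** ?X (s j) = ?X (s j)" for j
  proof -
    have "det (?J (s j)) \<noteq> 0" using d(2)[of "s j"] s[of j] by auto
    then have inj: "\<And>v. ?J (s j) *v v = 0 \<Longrightarrow> v = 0" using det_ker by blast
    have XQ: "?X (s j) ** Q = ?X (s j)" by (simp add: mm_simps q mm_absorb[OF q(2)])
    then have "Q ** ?X (s j) = Q ** ?X (s j) ** Q" by (metis matrix_mul_assoc)
    from chart_of_frame[OF Q this XQ inj] show ?thesis by blast
  qed
  then obtain Y where Y: "\<And>j. chart Q (Y j) ** ?X (s j) = ?X (s j)" by metis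
  obtain k where k: "k > 0" "\<And>(a :: complex^'N^'N) (b :: complex^'N^'N). norm (a ** b) \<le> norm a * norm b * k"
    by (rule mm_norm_bound) blast
  define C where "C = 2 * ((norm (mat 1 :: complex^'N^'N) + sqrt n) * norm (Q ** ct R) * k)"
  have bound: "norm (chart Q (Y j) - U) \<le> norm (s j) * C" for j
  proof -
    let ?P = "chart Q (Y j)"
    have P: "?P \<in> projectors n" by (rule chart_props(1)[OF Q])
    have "U = R ** Q ** ct R" by (simp add: R(3) mm_absorb[OF R(2)])
    moreover have "(mat 1 - ?P) ** (R ** Q) = - (s j *\<^sub>R ((mat 1 - ?P) ** Q))"
    proof -
      have "(mat 1 - ?P) ** ?X (s j) = 0" by (simp only: mm.diff_left matrix_mul_lid Y) simp
      then have "(mat 1 - ?P) ** (R ** Q) + s j *\<^sub>R ((mat 1 - ?P) ** Q) = 0"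
        unfolding mm.add_right mm.scaleR_right .
      then show ?thesis by (simp add: eq_neg_iff_add_eq_0)
    qed
    ultimately have "(mat 1 - ?P) ** U = - (s j *\<^sub>R ((mat 1 - ?P) ** (Q ** ct R)))"
      by (simp add: matrix_mul_assoc mm.minus_left mm.scaleR_left)
    then have "norm ((mat 1 - ?P) ** U) = s j * norm ((mat 1 - ?P) ** (Q ** ct R))" using s[of j] by simp
    also have "\<dots> \<le> s j * ((norm (mat 1 :: complex^'N^'N) + sqrt n) * norm (Q ** ct R) * k)"
    proof (intro mult_left_mono order_trans[OF k(2)] mult_right_mono)
      have "norm ?P = sqrt n" using projectors_norm[OF P] by (metis norm_ge_zero real_sqrt_unique)
      then show "norm (mat 1 - ?P) \<le> norm (mat 1 :: complex^'N^'N) + sqrt n"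
        using norm_triangle_ineq4[of "mat 1" ?P] by simp
    qed (use k s[of j] in auto)
    also have "\<dots> = s j * (C / 2)" by (simp add: C_def)
    finally have 1: "norm ((mat 1 - ?P) ** U) \<le> s j * (C / 2)" .
    have "(norm (U - ?P))\<^sup>2 = 2 * (norm ((mat 1 - ?P) ** U))\<^sup>2" by (rule norm_diff_projectors[OF U P])
    also have "\<dots> \<le> 2 * (s j * (C / 2))\<^sup>2" using 1 by (intro mult_left_mono power_mono) auto
    also have "\<dots> \<le> (s j * C)\<^sup>2" by (simp add: power_mult_distrib power_divide)
    finally have "norm (U - ?P) \<le> s j * C"
      by (rule power2_le_imp_le) (use k s[of j] in \<open>simp add: C_def\<close>)
    then show ?thesis using s[of j] by (simp add: norm_minus_commute)
  qed
  have s0: "s \<longlonglongrightarrow> 0"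
    unfolding s_def using LIMSEQ_ignore_initial_segment[OF lim_const_over_n[of d], of 2] by simp
  have "(\<lambda>j. chart Q (Y j) - U) \<longlonglongrightarrow> 0"
    by (rule tendsto_0_le[OF s0 always_eventually]) (rule allI, rule bound)
  then show thesis by (intro that[of Y]) (simp add: LIM_zero_iff)
qed

section \<open>Degenerate points\<close>

text \<open>The matrix of \<open>X \<mapsto> X ** T + ct T ** X - X\<close> in the basis of matrix units.\<close>

definition critT :: "complex^'N^'N \<Rightarrow> complex^('N \<times> 'N)^('N \<times> 'N)" where
  "critT T = (\<chi> p q. (if fst p = fst q then T $ snd q $ snd p else 0) +
     (if snd p = snd q then cnj (T $ fst q $ fst p) else 0) - (if p = q then 1 else 0))"

text \<open>A scalar certificate for \<open>noncritical\<close>. Along lines in a chart it is a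
  rational function of the parameter, so it has finitely many zeros unless it vanishes
  identically.\<close>

definition ncdet :: "complex^'N^'N \<Rightarrow> complex^'N^'N \<Rightarrow> complex^'N^'N \<Rightarrow> complex" where
  "ncdet P U E = det (critT (U ** E ** U + mat 1 - U)) * det (E ** U ** P + mat 1 - P)"

lemma critT_mult:
  fixes X T :: "complex^'N^'N"
  shows "(critT T *v (\<chi> p. X $ fst p $ snd p)) $ (i, j) = (X ** T + ct T ** X - X) $ i $ j"
proof -
  have entry: "critT T $ (i, j) $ (k, l) * X $ k $ l = (if k = i then X $ k $ l * T $ l $ j else 0) +
      (if l = j then cnj (T $ k $ i) * X $ k $ l else 0) - (if l = j then if k = i then X $ k $ l else 0 else 0)" for k l
    by (cases "k = i"; cases "l = j"; simp add: critT_def; simp add: algebra_simps)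
  have "(critT T *v (\<chi> p. X $ fst p $ snd p)) $ (i, j) =
      (\<Sum>q\<in>UNIV \<times> UNIV. critT T $ (i, j) $ q * X $ fst q $ snd q)"
    by (simp add: matrix_vector_mult_def)
  also have "\<dots> = (\<Sum>k\<in>UNIV. \<Sum>l\<in>UNIV. critT T $ (i, j) $ (k, l) * X $ k $ l)"
    by (simp only: sum.cartesian_product case_prod_unfold prod.collapse)
  also have "\<dots> = (\<Sum>k\<in>UNIV. \<Sum>l\<in>UNIV. if k = i then X $ k $ l * T $ l $ j else 0) +
      (\<Sum>k\<in>UNIV. \<Sum>l\<in>UNIV. if l = j then cnj (T $ k $ i) * X $ k $ l else 0) -
      (\<Sum>k\<in>UNIV. \<Sum>l\<in>UNIV. if l = j then if k = i then X $ k $ l else 0 else 0)"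
    by (simp only: entry sum.distrib sum_subtractf)
  also have "(\<Sum>k\<in>UNIV. \<Sum>l\<in>UNIV. if k = i then X $ k $ l * T $ l $ j else 0) = (X ** T) $ i $ j"
    by (subst sum.swap) (simp add: matrix_matrix_mult_def)
  also have "(\<Sum>k\<in>UNIV. \<Sum>l\<in>UNIV. if l = j then cnj (T $ k $ i) * X $ k $ l else 0) = (ct T ** X) $ i $ j"
    by (simp add: matrix_matrix_mult_def)
  also have "(\<Sum>k\<in>UNIV. \<Sum>l\<in>UNIV. if l = j then if k = i then X $ k $ l else 0 else 0) = X $ i $ j"
    by simp
  finally show ?thesis by simp
qed

lemma ncdet_noncritical:
  assumes "ncdet P U E \<noteq> 0" shows "noncritical P U E"
  unfolding noncritical_def
proof (intro conjI allI impI)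
  let ?T = "U ** E ** U + mat 1 - U"
  fix C assume C: "C ** ?T + ct ?T ** C = C"
  have "critT ?T *v (\<chi> p. C $ fst p $ snd p) = 0"
    using C critT_mult[of ?T C] by (simp add: vec_eq_iff split_paired_all)
  then have "(\<chi> p. C $ fst p $ snd p) = (0 :: complex^('a \<times> 'a))"
    using assms det_ker[of "critT ?T"] unfolding ncdet_def by simp
  then show "C = 0" by (simp add: vec_eq_iff)
next
  have "det (E ** U ** P + mat 1 - P) \<noteq> 0" using assms by (simp add: ncdet_def)
  then show "\<exists>J. (E ** U ** P + mat 1 - P) ** J = mat 1"
    using inj_mm_invertible(1) det_ker by blast
qed

text \<open>At \<open>P = U\<close> both determinants are taken of identity matrices. This is the
  source of nontriviality for the rational condition.\<close>

lemma ncdet_self: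
  fixes U E :: "complex^'N^'N"
  assumes U: "U \<in> projectors n" and E: "E ** U = U" shows "ncdet U U E = 1"
proof -
  note u = projectors_idem[OF U]
  have "critT (mat 1 :: complex^'N^'N) = mat 1"
    by (simp add: vec_eq_iff critT_def mat_def prod_eq_iff)
  moreover have "U ** E ** U + mat 1 - U = mat 1" by (simp add: mm_absorb[OF E] u)
  moreover have "E ** U ** U + mat 1 - U = mat 1" by (simp add: E u)
  ultimately show ?thesis unfolding ncdet_def by simp
qed

lemma continuous_on_critT:
  assumes "continuous_on S F" shows "continuous_on S (\<lambda>x. critT (F x))"
proof -
  have "continuous_on S (\<lambda>x. critT (F x) $ p $ q)" for p q
  proof -
    have "continuous_on S (\<lambda>x. F x $ a $ b)" for a b by (intro continuous_on_component assms)
    then show ?thesis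
      unfolding critT_def
      by (cases "fst p = fst q"; cases "snd p = snd q"; cases "p = q") (simp_all add: continuous_intros)
  qed
  then have "continuous_on S (\<lambda>x. \<chi> p q. critT (F x) $ p $ q)"
    by (intro continuous_on_vec_lambda)
  then show ?thesis by simp
qed

lemma continuous_on_ncdet:
  assumes "continuous_on S f" "continuous_on S g" "continuous_on S h"
  shows "continuous_on S (\<lambda>x. ncdet (f x) (g x) (h x))"
  unfolding ncdet_def
  by (intro continuous_on_mult continuous_on_det continuous_on_critT continuous_on_diff continuous_on_add
      mm.continuous_on continuous_on_const assms)

lemma rat_ncdet:
  assumes "ratm F" "ratm G" shows "rat (\<lambda>s. ncdet (F s) U (G s))"
proof -
  have r: "rat (\<lambda>s. T s $ i $ j)" if "ratm T" for T :: "real \<Rightarrow> complex^'N^'N" and i j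
    using that by (simp add: ratm_def)
  then have "rat (\<lambda>s. critT (T s) $ p $ q)" if "ratm T" for T :: "real \<Rightarrow> complex^'N^'N" and p q
    unfolding critT_def
    by (cases "fst p = fst q"; cases "snd p = snd q"; cases "p = q")
      (auto intro!: rat_add rat_diff rat_const rat_cnj rat_minus r that)
  then have cT: "ratm (\<lambda>s. critT (T s))" if "ratm T" for T :: "real \<Rightarrow> complex^'N^'N"
    using that unfolding ratm_def[of "\<lambda>s. critT (T s)"] by blast
  show ?thesis unfolding ncdet_def
    by (intro rat_mult rat_det cT ratm_add ratm_diff ratm_mult ratm_const assms)
qed

lemma chart_mproj_tendsto:
  fixes M Q :: "complex^'N^'N"
  assumes M: "pos_def M" and Q: "Q \<in> projectors n" and f: "f \<longlonglongrightarrow> Y"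
  shows "(\<lambda>j. mproj M (chart Q (f j))) \<longlonglongrightarrow> mproj M (chart Q Y)"
proof -
  interpret scf 0 M n by unfold_locales (simp_all add: ct_zero M)
  show ?thesis by (intro E_tendsto chart_props(1)[OF Q] chart_tendsto[OF Q] f)
qed

lemma continuous_on_chart:
  assumes Q: "Q \<in> projectors n" shows "continuous_on UNIV (chart Q)"
  unfolding continuous_on_sequentially using chart_tendsto[OF Q] by (auto simp: o_def)

lemma continuous_on_mproj_chart:
  assumes M: "pos_def M" and Q: "Q \<in> projectors n" shows "continuous_on UNIV (\<lambda>Y. mproj M (chart Q Y))"
  unfolding continuous_on_sequentially using chart_mproj_tendsto[OF M Q] by (auto simp: o_def)

text \<open>The known nonzero value is attained at \<open>U\<close>, possibly outside the chart;
  approximation of \<open>U\<close> by chart points and continuity transfer it into the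
  chart.\<close>

lemma exists_ncdet_nonzero:
  fixes M Q U :: "complex^'N^'N"
  assumes M: "pos_def M" and Q: "Q \<in> projectors n" and U: "U \<in> projectors n"
  shows "\<exists>Y. ncdet (chart Q Y) U (mproj M (chart Q Y)) \<noteq> 0"
proof (rule ccontr)
  assume "\<not> ?thesis"
  then have z: "ncdet (chart Q Y) U (mproj M (chart Q Y)) = 0" for Y by blast
  interpret scf 0 M n by unfold_locales (simp_all add: ct_zero M)
  obtain Y where Y: "(\<lambda>j. chart Q (Y j)) \<longlonglongrightarrow> U" by (rule chart_approach[OF Q U])
  have "(\<lambda>j. mproj M (chart Q (Y j))) \<longlonglongrightarrow> mproj M U"
    by (intro E_tendsto chart_props(1)[OF Q] Y U)
  then have "(\<lambda>j. (chart Q (Y j), mproj M (chart Q (Y j)))) \<longlonglongrightarrow> (U, mproj M U)"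
    by (intro tendsto_Pair Y)
  moreover have "continuous_on UNIV (\<lambda>x. ncdet (fst x) U (snd x))"
    by (intro continuous_on_ncdet continuous_intros)
  ultimately have "(\<lambda>j. ncdet (chart Q (Y j)) U (mproj M (chart Q (Y j)))) \<longlonglongrightarrow> ncdet U U (mproj M U)"
    using continuous_on_tendsto_compose[of UNIV "\<lambda>x. ncdet (fst x) U (snd x)" "\<lambda>j. (chart Q (Y j), mproj M (chart Q (Y j)))" "(U, mproj M U)" sequentially]
    by simp
  then have "ncdet U U (mproj M U) = 0" unfolding z by (metis LIMSEQ_unique tendsto_const)
  then show False using ncdet_self[OF U E_Q[OF U]] by simp
qed

text \<open>On every line through a point \<open>Y0\<close> with nonzero \<open>ncdet\<close> the
  chart, \<open>mproj\<close> and the determinants are rational, so the line meets the set in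
  finitely many points.\<close>

lemma negligible_critical:
  fixes M Q U :: "complex^'N^'N"
  assumes M: "pos_def M" and Q: "Q \<in> projectors n" and U: "U \<in> projectors n"
  shows "negligible {Y. ncdet (chart Q Y) U (mproj M (chart Q Y)) = 0}"
proof -
  obtain Y0 where Y0: "ncdet (chart Q Y0) U (mproj M (chart Q Y0)) \<noteq> 0"
    using exists_ncdet_nonzero[OF M Q U] by blast
  show ?thesis
  proof (rule negligible_star)
    have "closed {Y. ncdet (chart Q Y) U (mproj M (chart Q Y)) = 0}"
      by (intro closed_Collect_eq continuous_on_ncdet continuous_on_const continuous_on_chart[OF Q]
          continuous_on_mproj_chart[OF M Q])
    then show "{Y. ncdet (chart Q Y) U (mproj M (chart Q Y)) = 0} \<in> sets borel" by simp
    fix x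
    let ?Y = "\<lambda>s. Y0 + s *\<^sub>R (x - Y0)"
    have Z: "ratm (\<lambda>s. (mat 1 - Q) ** ?Y s ** Q)" by (intro ratm_mult ratm_const ratm_line)
    have rW: "ratm (\<lambda>s. chartW Q (?Y s))" unfolding chartW_def by (intro ratm_add ratm_const Z)
    have rc: "ratm (\<lambda>s. chart Q (?Y s))"
      unfolding chart_def
      by (intro ratm_mult ratm_ct rW ratm_inv ratm_add ratm_const Z) (erule one_plus_gram_ker)
    have rE: "ratm (\<lambda>s. mproj M (chart Q (?Y s)))"
      unfolding mproj_def
    proof (intro ratm_mult ratm_inv ratm_diff ratm_add ratm_const rc)
      fix s v assume "(chart Q (?Y s) ** M ** chart Q (?Y s) + mat 1 - chart Q (?Y s)) *v v = 0"
      then show "v = 0"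
        by (rule gram_ker[OF M projectors_ct[OF chart_props(1)[OF Q]] projectors_idem[OF chart_props(1)[OF Q]]])
    qed
    have "finite {s. ncdet (chart Q (?Y s)) U (mproj M (chart Q (?Y s))) = 0}"
      by (rule rat_finite_zeros[OF rat_ncdet[OF rc rE], of 0]) (simp add: Y0)
    then show "countable {s. ?Y s \<in> {Y. ncdet (chart Q Y) U (mproj M (chart Q Y)) = 0}}"
      by (simp add: countable_finite)
  qed
qed

text \<open>\<open>U\<close> ranges over all projectors commuting with \<open>H\<close>, since the
  image under the iteration is only known to be one of them. For Hermitian \<open>H\<close> the
  first disjunct covers all multiple eigenvalues, which leaves finitely many \<open>U\<close> in the
  second.\<close>

definition degenerate :: "nat \<Rightarrow> complex^'N^'N \<Rightarrow> complex^'N^'N \<Rightarrow> complex^'N^'N \<Rightarrow> bool" where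
  "degenerate n M H P \<longleftrightarrow> det (krylov H) = 0 \<or>
     (\<exists>U\<in>projectors n. H ** U = U ** H \<and> ncdet P U (mproj M P) = 0)"

text \<open>Hermitian parts and unrestricted chart coordinates \<open>Y\<close> make this a subset
  of a full Euclidean space, where Fubini applies to the ambient Lebesgue measure.\<close>

definition bad :: "nat \<Rightarrow> complex^'N^'N \<Rightarrow> (((complex^'N^'N) \<times> (complex^'N^'N)) \<times> (complex^'N^'N)) set" where
  "bad n Q = {((A, B), Y). pos_def (- hpart B) \<and>
     degenerate n (- hpart B) (hpart A - - hpart B ** mproj (- hpart B) (chart Q Y)) (chart Q Y)}"

text \<open>Cutting the fibres with closed balls makes them compact; projection along compact fibres
  preserves closedness, so the whole projection is a countable union of closed sets.\<close>

lemma borel_projection: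
  fixes S :: "('a::euclidean_space \<times> 'b::euclidean_space) set"
  assumes "closed S" shows "{x. \<exists>y. (x, y) \<in> S} \<in> sets borel"
proof -
  let ?T = "{(y, x). (x, y) \<in> S}"
  have "closed ?T"
  proof -
    have "?T = (\<lambda>(y, x). (x, y)) -` S" by auto
    moreover have "continuous_on UNIV (\<lambda>(y::'b, x::'a). (x, y))"
      by (simp add: case_prod_unfold continuous_on_Pair continuous_on_fst continuous_on_snd)
    ultimately show ?thesis using continuous_closed_vimage[OF assms] by (metis continuous_on_eq_continuous_at open_UNIV UNIV_I)
  qed
  then have "closed {x. \<exists>y. y \<in> cball 0 (real k) \<and> (y, x) \<in> ?T}" for k
    by (intro closed_compact_projection compact_cball)
  then have "(\<Union>k. {x. \<exists>y. y \<in> cball 0 (real k) \<and> (y, x) \<in> ?T}) \<in> sets borel"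
    by (intro sets.countable_UN) auto
  also have "(\<Union>k. {x. \<exists>y. y \<in> cball 0 (real k) \<and> (y, x) \<in> ?T}) = {x. \<exists>y. (x, y) \<in> S}"
    by (auto simp: mem_cball) (metis real_arch_simple)
  finally show ?thesis .
qed

text \<open>By coercivity, positive definiteness is a countable union of closed conditions, one for
  each constant \<open>inverse (real (Suc k))\<close>.\<close>

lemma borel_pos_def: "{B :: complex^'N^'N. pos_def (- hpart B)} \<in> sets borel"
proof -
  let ?T = "\<lambda>k::nat. {B :: complex^'N^'N. \<forall>v. inverse (real (Suc k)) * (norm v)\<^sup>2 \<le> inner v (- hpart B *v v)}"
  have eq: "{B :: complex^'N^'N. pos_def (- hpart B)} = (\<Union>k. ?T k)"
  proof (intro set_eqI iffI)
    fix B :: "complex^'N^'N" assume "B \<in> {B. pos_def (- hpart B)}"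
    then obtain m where m: "m > 0" "\<And>v. m * (norm v)\<^sup>2 \<le> Re (cdot v (- hpart B *v v))"
      using pos_def_coercive[of "- hpart B"] by blast
    obtain k where k: "inverse (real (Suc k)) < m" using reals_Archimedean[OF m(1)] by blast
    have "inverse (real (Suc k)) * (norm v)\<^sup>2 \<le> inner v (- hpart B *v v)" for v
    proof -
      have "inverse (real (Suc k)) * (norm v)\<^sup>2 \<le> m * (norm v)\<^sup>2" using k by (intro mult_right_mono) auto
      then show ?thesis using m(2)[of v] by (simp add: inner_cdot)
    qed
    then show "B \<in> (\<Union>k. ?T k)" by blast
  next
    fix B :: "complex^'N^'N" assume "B \<in> (\<Union>k. ?T k)"
    then obtain k where k: "\<And>v. inverse (real (Suc k)) * (norm v)\<^sup>2 \<le> inner v (- hpart B *v v)" by blast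
    have "0 < Re (cdot v (- hpart B *v v))" if "v \<noteq> 0" for v
    proof -
      have "0 < inverse (real (Suc k)) * (norm v)\<^sup>2" using that by simp
      then show ?thesis using k[of v] by (simp add: inner_cdot)
    qed
    then show "B \<in> {B. pos_def (- hpart B)}" by (simp add: pos_def_def ct_minus ct_hpart)
  qed
  have "closed (?T k)" for k
    by (intro closed_Collect_all closed_Collect_le continuous_on_const continuous_on_inner mv.continuous_on
        continuous_on_minus continuous_on_hpart continuous_on_id)
  then show ?thesis unfolding eq by (intro sets.countable_UN) auto
qed

text \<open>The inverses in \<open>chart\<close> and \<open>mproj\<close> and the quantified
  \<open>U\<close> are turned into witnesses \<open>P\<close>, \<open>E\<close>, \<open>U\<close>
  subject to closed equations; \<open>chart_unique\<close> and \<open>is_mproj_unique\<close>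
  identify the first two.\<close>

lemma borel_bad:
  fixes Q :: "complex^'N^'N"
  assumes Q: "Q \<in> projectors n" shows "bad n Q \<in> sets borel"
proof -
  let ?A = "\<lambda>x :: (((complex^'N^'N) \<times> (complex^'N^'N)) \<times> (complex^'N^'N)) \<times> ((complex^'N^'N) \<times> (complex^'N^'N) \<times> (complex^'N^'N)). hpart (fst (fst (fst x)))"
  let ?M = "\<lambda>x :: (((complex^'N^'N) \<times> (complex^'N^'N)) \<times> (complex^'N^'N)) \<times> ((complex^'N^'N) \<times> (complex^'N^'N) \<times> (complex^'N^'N)). - hpart (snd (fst (fst x)))"
  let ?W = "\<lambda>x :: (((complex^'N^'N) \<times> (complex^'N^'N)) \<times> (complex^'N^'N)) \<times> ((complex^'N^'N) \<times> (complex^'N^'N) \<times> (complex^'N^'N)). chartW Q (snd (fst x))"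
  let ?P = "\<lambda>x :: (((complex^'N^'N) \<times> (complex^'N^'N)) \<times> (complex^'N^'N)) \<times> ((complex^'N^'N) \<times> (complex^'N^'N) \<times> (complex^'N^'N)). fst (snd x)"
  let ?E = "\<lambda>x :: (((complex^'N^'N) \<times> (complex^'N^'N)) \<times> (complex^'N^'N)) \<times> ((complex^'N^'N) \<times> (complex^'N^'N) \<times> (complex^'N^'N)). fst (snd (snd x))"
  let ?U = "\<lambda>x :: (((complex^'N^'N) \<times> (complex^'N^'N)) \<times> (complex^'N^'N)) \<times> ((complex^'N^'N) \<times> (complex^'N^'N) \<times> (complex^'N^'N)). snd (snd (snd x))"
  let ?H = "\<lambda>x. ?A x - ?M x ** ?E x"
  let ?proj = "\<lambda>X :: complex^'N^'N. ct X = X \<and> X ** X = X \<and> rtr X = n"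
  let ?S = "{x. ?proj (?P x) \<and> ?P x ** ?W x = ?W x \<and>
     (?E x ** ?P x = ?P x \<and> ?P x ** ?E x = ?E x \<and> ?M x ** ?E x = ct (?E x) ** ?M x) \<and>
     (det (krylov (?H x)) = 0 \<or> (?proj (?U x) \<and> ?H x ** ?U x = ?U x ** ?H x \<and> ncdet (?P x) (?U x) (?E x) = 0))}"
  have "closed ?S"
    unfolding chartW_def
    by (intro closed_Collect_conj closed_Collect_disj closed_Collect_eq continuous_on_det continuous_on_krylov
        continuous_on_ncdet continuous_on_diff continuous_on_add continuous_on_minus mm.continuous_on continuous_on_ct continuous_on_rtr
        continuous_on_hpart continuous_on_const continuous_on_fst continuous_on_snd continuous_on_id)
  then have "{x. \<exists>y. (x, y) \<in> ?S} \<in> sets borel" by (rule borel_projection)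
  moreover have "{x :: ((complex^'N^'N) \<times> (complex^'N^'N)) \<times> (complex^'N^'N). pos_def (- hpart (snd (fst x)))} \<in> sets borel"
  proof -
    have "(\<lambda>x :: ((complex^'N^'N) \<times> (complex^'N^'N)) \<times> (complex^'N^'N). snd (fst x)) \<in> borel_measurable borel"
      by (intro borel_measurable_continuous_onI continuous_intros)
    from measurable_sets[OF this borel_pos_def] show ?thesis by (simp add: vimage_def)
  qed
  ultimately have "{x. \<exists>y. (x, y) \<in> ?S} \<inter> {x. pos_def (- hpart (snd (fst x)))} \<in> sets borel"
    by (rule sets.Int)
  moreover have "bad n Q = {x. \<exists>y. (x, y) \<in> ?S} \<inter> {x. pos_def (- hpart (snd (fst x)))}"
  proof (intro set_eqI iffI)
    fix x assume x: "x \<in> bad n Q"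
    obtain A B Y where xe: "x = ((A, B), Y)" by (metis prod.exhaust)
    define M where "M = - hpart B"
    define P where "P = chart Q Y"
    have M: "pos_def M" and d: "degenerate n M (hpart A - M ** mproj M P) P"
      using x unfolding bad_def xe M_def P_def by simp_all
    have P: "P \<in> projectors n" "P ** chartW Q Y = chartW Q Y" unfolding P_def by (rule chart_props[OF Q])+
    have E: "is_mproj M P (mproj M P)" by (rule is_mproj_mproj[OF M projectors_ct[OF P(1)] projectors_idem[OF P(1)]])
    obtain U where U: "det (krylov (hpart A - M ** mproj M P)) = 0 \<or>
      (U \<in> projectors n \<and> (hpart A - M ** mproj M P) ** U = U ** (hpart A - M ** mproj M P) \<and> ncdet P U (mproj M P) = 0)"
      using d unfolding degenerate_def by blast
    have "(x, (P, mproj M P, U)) \<in> ?S"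
      using U P E unfolding xe projectors_iff is_mproj_def M_def by simp
    then show "x \<in> {x. \<exists>y. (x, y) \<in> ?S} \<inter> {x. pos_def (- hpart (snd (fst x)))}"
      using M unfolding xe M_def by auto
  next
    fix x assume x: "x \<in> {x. \<exists>y. (x, y) \<in> ?S} \<inter> {x. pos_def (- hpart (snd (fst x)))}"
    obtain A B Y where xe: "x = ((A, B), Y)" by (metis prod.exhaust)
    define M where "M = - hpart B"
    have M: "pos_def M" using x unfolding xe M_def by simp
    obtain y where "(x, y) \<in> ?S" using x by blast
    moreover obtain P E U where ye: "y = (P, E, U)" by (metis prod.exhaust)
    ultimately have S: "P \<in> projectors n" "P ** chartW Q Y = chartW Q Y" "is_mproj M P E"
      "det (krylov (hpart A - M ** E)) = 0 \<or>
      (U \<in> projectors n \<and> (hpart A - M ** E) ** U = U ** (hpart A - M ** E) \<and> ncdet P U E = 0)"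
      unfolding xe ye projectors_iff is_mproj_def M_def mem_Collect_eq fst_conv snd_conv by blast+
    have Pc: "P = chart Q Y" by (rule chart_unique[OF Q S(1,2)])
    have "E = mproj M P"
      by (rule is_mproj_unique[OF M S(3) is_mproj_mproj[OF M projectors_ct[OF S(1)] projectors_idem[OF S(1)]]])
    then show "x \<in> bad n Q"
      using M S(4) unfolding bad_def xe Pc degenerate_def M_def by auto
  qed
  ultimately show ?thesis by simp
qed

lemma negligible_imp_AE: "negligible S \<Longrightarrow> AE x in lborel. x \<notin> S"
proof -
  assume "negligible S"
  then obtain N where "N \<in> null_sets lborel" "S \<subseteq> N" by (rule negligible_imp_null_set)
  then show ?thesis using AE_not_in[of N lborel] by (auto elim: AE_mp)
qed

lemma AE_imp_negligible: "AE x in lborel. x \<notin> S \<Longrightarrow> negligible S"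
  unfolding eventually_ae_filter negligible_iff_null_sets null_sets_completion_iff2 by auto

lemma AE_lborel_translate:
  fixes c :: "'a::euclidean_space"
  assumes "AE x in lborel. P x" shows "AE x in lborel. P (x - c)"
proof -
  have "negligible {x. \<not> P x}" by (rule AE_imp_negligible) (use assms in simp)
  then have "negligible ((+) c ` {x. \<not> P x})" by (rule negligible_translation)
  then have "AE x in lborel. x \<notin> (+) c ` {x. \<not> P x}" by (rule negligible_imp_AE)
  then show ?thesis
  proof (rule AE_mp, intro AE_I2 impI)
    fix x assume "x \<notin> (+) c ` {x. \<not> P x}"
    then show "P (x - c)" by (metis (mono_tags, lifting) add.commute diff_add_cancel image_eqI mem_Collect_eq)
  qed
qed

text \<open>For fixed \<open>B\<close> the shear \<open>A = H + M ** mproj M (chart Q Y)\<close> makes \<open>H\<close> and the point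
  \<open>chart Q Y\<close> independent variables.\<close>

lemma AE_bad_fixed:
  fixes B Q :: "complex^'N^'N"
  assumes Q: "Q \<in> projectors n"
  shows "AE A in lborel. AE Y in lborel. ((A, B), Y) \<notin> bad n Q"
proof (cases "pos_def (- hpart B)")
  case False
  then show ?thesis by (simp add: bad_def)
next
  case True
  define M where "M = - hpart B"
  have M: "pos_def M" using True by (simp add: M_def)
  let ?c = "\<lambda>Y. M ** mproj M (chart Q Y)"
  let ?R = "\<lambda>H Y. ((H + ?c Y, B), Y) \<notin> bad n Q"
  have hc: "hpart (?c Y) = ?c Y" for Y
  proof -
    interpret scf 0 M n by unfold_locales (simp_all add: ct_zero M)
    show ?thesis by (rule hpart_id) (rule ct_ME[OF chart_props(1)[OF Q]])
  qed
  have R: "?R H Y \<longleftrightarrow> \<not> degenerate n M (hpart H) (chart Q Y)" for H Y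
    using True by (simp add: bad_def M_def[symmetric] hpart_add hc)
  have "AE H in lborel. AE Y in lborel. ?R H Y"
  proof (rule AE_mp[OF negligible_imp_AE[OF negligible_krylov]], rule AE_I2, rule impI)
    fix H :: "complex^'N^'N" assume H: "H \<notin> {A. det (krylov (hpart A)) = 0}"
    have h: "hermitian (hpart H)" by (simp add: hermitian_def ct_hpart)
    let ?F = "{U \<in> projectors n. hpart H ** U = U ** hpart H}"
    have "finite ?F" by (rule finite_commuting_projectors[OF h krylov_simple[OF h]]) (use H in simp)
    then have "negligible (\<Union>U\<in>?F. {Y. ncdet (chart Q Y) U (mproj M (chart Q Y)) = 0})"
      by (intro negligible_Union) (auto intro!: negligible_critical[OF M Q])
    then have "AE Y in lborel. Y \<notin> (\<Union>U\<in>?F. {Y. ncdet (chart Q Y) U (mproj M (chart Q Y)) = 0})"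
      by (rule negligible_imp_AE)
    then show "AE Y in lborel. ?R H Y"
      by (rule AE_mp) (use H in \<open>auto simp: R degenerate_def intro!: AE_I2\<close>)
  qed
  moreover have "{p\<in>space (lborel \<Otimes>\<^sub>M lborel). ?R (fst p) (snd p)} \<in> sets ((lborel :: (complex^'N^'N) measure) \<Otimes>\<^sub>M (lborel :: (complex^'N^'N) measure))"
  proof -
    have cc: "continuous_on UNIV (\<lambda>p :: (complex^'N^'N) \<times> (complex^'N^'N). mproj M (chart Q (snd p)))"
      using continuous_on_compose[OF continuous_on_snd[OF continuous_on_id, of UNIV], of "\<lambda>Y. mproj M (chart Q Y)"]
        continuous_on_subset[OF continuous_on_mproj_chart[OF M Q]] by (simp add: o_def)
    have "(\<lambda>p :: (complex^'N^'N) \<times> (complex^'N^'N). ((fst p + ?c (snd p), B), snd p)) \<in> borel_measurable borel"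
      by (intro borel_measurable_continuous_onI continuous_on_Pair continuous_on_add mm.continuous_on
          continuous_on_const continuous_on_fst continuous_on_snd continuous_on_id cc)
    from measurable_sets[OF this borel_bad[OF Q]]
    have "{p. \<not> ?R (fst p) (snd p)} \<in> sets borel" by (simp add: vimage_def)
    then have "{p\<in>space borel. \<not> \<not> ?R (fst p) (snd p)} \<in> sets borel" by (intro sets.sets_Collect_neg) simp
    then show ?thesis unfolding lborel_prod by simp
  qed
  \<comment> \<open>With \<open>Y\<close> outermost the shear by \<open>?c Y\<close> is a mere
    translation in \<open>H\<close>; it is undone there, and then the order is exchanged
    back.\<close>
  ultimately have ae: "AE Y in lborel. AE H in lborel. ?R H Y"
    using lborel_pair.AE_commute[of ?R] by blast
  have "AE Y in lborel. AE A in lborel. ((A, B), Y) \<notin> bad n Q"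
  proof (rule AE_mp[OF ae], rule AE_I2, rule impI)
    fix Y assume "AE H in lborel. ?R H Y"
    from AE_lborel_translate[OF this, of "?c Y"] show "AE A in lborel. ((A, B), Y) \<notin> bad n Q" by simp
  qed
  moreover have "{p\<in>space (lborel \<Otimes>\<^sub>M lborel). ((snd p, B), fst p) \<notin> bad n Q} \<in> sets ((lborel :: (complex^'N^'N) measure) \<Otimes>\<^sub>M (lborel :: (complex^'N^'N) measure))"
  proof -
    have "(\<lambda>p :: (complex^'N^'N) \<times> (complex^'N^'N). ((snd p, B), fst p)) \<in> borel_measurable borel"
      by (intro borel_measurable_continuous_onI continuous_intros)
    from measurable_sets[OF this borel_bad[OF Q]]
    have "{p :: (complex^'N^'N) \<times> (complex^'N^'N). \<not> ((snd p, B), fst p) \<notin> bad n Q} \<in> sets borel" by (simp add: vimage_def)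
    then have "{p \<in> space borel. \<not> \<not> ((snd p, B), fst p) \<notin> bad n Q} \<in> sets borel" by (intro sets.sets_Collect_neg) simp
    then show ?thesis unfolding lborel_prod by simp
  qed
  ultimately show ?thesis
    using lborel_pair.AE_commute[of "\<lambda>Y A. ((A, B), Y) \<notin> bad n Q"] by blast
qed

text \<open>Fubini runs with \<open>B\<close> outermost because the shear behind
  \<open>AE_bad_fixed\<close> depends on \<open>B\<close>; the linear map \<open>?g\<close> then
  restores the order of the factors.\<close>

lemma AE_bad:
  fixes Q :: "complex^'N^'N"
  assumes Q: "Q \<in> projectors n"
  shows "AE AB in lborel. AE Y in lborel. (AB, Y) \<notin> bad n Q"
proof -
  let ?g = "\<lambda>p :: (complex^'N^'N) \<times> (complex^'N^'N) \<times> (complex^'N^'N). ((fst (snd p), fst p), snd (snd p))"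
  have "?g \<in> borel_measurable borel" by (intro borel_measurable_continuous_onI continuous_intros)
  from measurable_sets[OF this borel_bad[OF Q]]
  have X: "{p. ?g p \<in> bad n Q} \<in> sets borel" by (simp add: vimage_def)
  then have "{p \<in> space borel. \<not> ?g p \<in> bad n Q} \<in> sets borel" by (intro sets.sets_Collect_neg) simp
  then have X': "{p \<in> space (lborel \<Otimes>\<^sub>M lborel). ?g p \<notin> bad n Q} \<in> sets ((lborel :: (complex^'N^'N) measure) \<Otimes>\<^sub>M (lborel :: ((complex^'N^'N) \<times> (complex^'N^'N)) measure))"
    unfolding lborel_prod by simp
  have "AE B in lborel. AE q in lborel. ?g (B, q) \<notin> bad n Q"
  proof (rule AE_I2)
    fix B :: "complex^'N^'N"
    let ?h = "\<lambda>q :: (complex^'N^'N) \<times> (complex^'N^'N). ((fst q, B), snd q)"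
    have "?h \<in> borel_measurable borel" by (intro borel_measurable_continuous_onI continuous_intros)
    from measurable_sets[OF this borel_bad[OF Q]]
    have "{q. ?h q \<in> bad n Q} \<in> sets borel" by (simp add: vimage_def)
    then have "{q \<in> space borel. \<not> ?h q \<in> bad n Q} \<in> sets borel" by (intro sets.sets_Collect_neg) simp
    then have "{q \<in> space (lborel \<Otimes>\<^sub>M lborel). ?h q \<notin> bad n Q} \<in> sets ((lborel :: (complex^'N^'N) measure) \<Otimes>\<^sub>M (lborel :: (complex^'N^'N) measure))"
      unfolding lborel_prod by simp
    from lborel_pair.AE_pair_measure[OF this] have "AE q in lborel. ?h q \<notin> bad n Q"
      using AE_bad_fixed[OF Q, of B] unfolding lborel_prod by simp
    then show "AE q in lborel. ?g (B, q) \<notin> bad n Q" by simp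
  qed
  from lborel_pair.AE_pair_measure[OF X' this]
  have "AE p in lborel. p \<notin> {p. ?g p \<in> bad n Q}" unfolding lborel_prod by simp
  then have "negligible {p. ?g p \<in> bad n Q}" by (rule AE_imp_negligible)
  then have "negligible (?g ` {p. ?g p \<in> bad n Q})"
    by (rule negligible_linear_image_le[rotated]) (auto intro!: linearI)
  moreover have "bad n Q \<subseteq> ?g ` {p. ?g p \<in> bad n Q}"
  proof
    fix x assume x: "x \<in> bad n Q"
    have "x = ?g (snd (fst x), fst (fst x), snd x)" by simp
    then show "x \<in> ?g ` {p. ?g p \<in> bad n Q}" using x by (intro image_eqI[where x = "(snd (fst x), fst (fst x), snd x)"]) auto
  qed
  ultimately have "negligible (bad n Q)" by (rule negligible_subset)
  then have "AE x in (lborel :: ((complex^'N^'N) \<times> (complex^'N^'N)) measure) \<Otimes>\<^sub>M (lborel :: (complex^'N^'N) measure). x \<notin> bad n Q"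
    unfolding lborel_prod by (rule negligible_imp_AE)
  then show ?thesis by (rule lborel_pair.AE_pair)
qed

section \<open>Null sets of projectors and saddles\<close>

text \<open>Model of the tangent space at \<open>P\<close> and domain of the graph coordinates; its
  real dimension is the \<open>d\<close> of \<open>dnull\<close>.\<close>

definition offdiag :: "complex^'N^'N \<Rightarrow> (complex^'N^'N) set" where
  "offdiag P = {Y. (mat 1 - P) ** Y ** P = Y}"

lemma subspace_offdiag: "subspace (offdiag P)"
  by (auto simp: subspace_def offdiag_def mm.add_right mm.add_left mm.scaleR_right mm.scaleR_left)

lemma offdiag_proj:
  fixes P X :: "complex^'N^'N"
  assumes P: "P ** P = P" shows "(mat 1 - P) ** X ** P \<in> offdiag P"
  by (simp add: offdiag_def mm_simps P mm_absorb[OF P])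

text \<open>The map \<open>X \<mapsto> (mat 1 - P) ** X ** P\<close> is the orthogonal projection
  onto \<open>offdiag P\<close>.\<close>

lemma perp_offdiag:
  assumes P: "ct P = P" "P ** P = P" and w: "w \<in> perp (offdiag P)"
  shows "(mat 1 - P) ** w ** P = 0"
proof -
  let ?y = "(mat 1 - P) ** w ** P"
  have "inner w ?y = 0" using w offdiag_proj[OF P(2), of w] unfolding perp_def by blast
  moreover have "inner w ?y = inner ?y ?y"
  proof -
    have "rtr (ct ?y ** ?y) = rtr (P ** (ct w ** (mat 1 - P) ** (mat 1 - P) ** w ** P))"
      by (simp add: ct_simps P matrix_mul_assoc)
    also have "\<dots> = rtr ((ct w ** (mat 1 - P) ** (mat 1 - P) ** w ** P) ** P)" by (rule rtr_commute)
    also have "(ct w ** (mat 1 - P) ** (mat 1 - P) ** w ** P) ** P = ct w ** ?y"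
      by (simp add: mm_simps P mm_absorb[OF P(2)])
    finally show ?thesis by (simp add: inner_rtr)
  qed
  ultimately show ?thesis by simp
qed

text \<open>Conjugation by a unitary that carries \<open>Q\<close> to \<open>P\<close> embeds one
  space into the other.\<close>

lemma dim_offdiag_le:
  fixes P Q :: "complex^'N^'N"
  assumes P: "P \<in> projectors n" and Q: "Q \<in> projectors n"
  shows "dim (offdiag Q) \<le> dim (offdiag P)"
proof -
  obtain R where R: "ct R ** R = mat 1" "R ** ct R = mat 1" "R ** Q = P ** R"
    by (rule projectors_unitary_equiv[OF Q P])
  have R': "Q ** ct R = ct R ** P"
    using arg_cong[OF R(3), of ct] by (simp add: ct_mult projectors_ct[OF P] projectors_ct[OF Q])
  let ?f = "\<lambda>Y. R ** Y ** ct R"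
  have lin: "linear ?f"
    by (rule linearI) (simp_all add: mm.add_right mm.add_left mm.scaleR_right mm.scaleR_left)
  have "inj ?f"
  proof (rule injI)
    fix X Y assume "?f X = ?f Y"
    then have "ct R ** ?f X ** R = ct R ** ?f Y ** R" by simp
    then show "X = Y" by (simp add: matrix_mul_assoc R mm_absorb[OF R(1)])
  qed
  then have "inj_on ?f (span (offdiag Q))" by (rule inj_on_subset) simp
  then have "dim (offdiag Q) = dim (?f ` offdiag Q)" by (rule dim_image_eq[OF lin, symmetric])
  also have "\<dots> \<le> dim (offdiag P)"
  proof (rule dim_subset, clarify)
    fix Y assume "Y \<in> offdiag Q"
    then have Y: "(mat 1 - Q) ** Y ** Q = Y" by (simp add: offdiag_def)
    have 1: "(mat 1 - P) ** R = R ** (mat 1 - Q)" by (simp add: mm_simps R)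
    have "(mat 1 - P) ** ?f Y ** P = (mat 1 - P) ** R ** Y ** (ct R ** P)" by (simp add: matrix_mul_assoc)
    also have "\<dots> = R ** ((mat 1 - Q) ** Y ** Q) ** ct R"
      unfolding 1 R'[symmetric] by (simp add: matrix_mul_assoc)
    finally show "?f Y \<in> offdiag P" by (simp add: offdiag_def Y)
  qed
  finally show ?thesis .
qed

lemma dim_offdiag_eq:
  fixes P Q :: "complex^'N^'N"
  assumes "P \<in> projectors n" "Q \<in> projectors n"
  shows "dim (offdiag Q) = dim (offdiag P)"
  using dim_offdiag_le[OF assms] dim_offdiag_le[OF assms(2,1)] by simp

lemma chart_0: "Q \<in> projectors n \<Longrightarrow> chart Q 0 = Q"
  by (rule chart_unique[symmetric]) (simp_all add: chartW_def projectors_idem)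

text \<open>The difference of two coordinates has its columns in the common graph but no component
  over the range of \<open>Q\<close>; in a graph such vectors vanish.\<close>

lemma chart_inj:
  assumes Q: "Q \<in> projectors n" shows "inj_on (chart Q) (offdiag Q)"
proof (rule inj_onI)
  fix Y Y' assume Y: "Y \<in> offdiag Q" "Y' \<in> offdiag Q" and eq: "chart Q Y = chart Q Y'"
  note q = projectors_idem[OF Q]
  define X where "X = Y - Y'"
  have W: "chartW Q Y = Q + Y" "chartW Q Y' = Q + Y'" using Y by (simp_all add: chartW_def offdiag_def)
  have "chart Q Y ** (Q + Y) = Q + Y" "chart Q Y ** (Q + Y') = Q + Y'"
    using chart_props(2)[OF Q, of Y] chart_props(2)[OF Q, of Y'] W eq by simp_all
  then have "chart Q Y ** ((Q + Y) - (Q + Y')) = (Q + Y) - (Q + Y')" by (simp only: mm.diff_right)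
  then have cX: "chart Q Y ** X = X" by (simp add: X_def)
  obtain L where L: "chart Q Y = (Q + Y) ** L" using chart_props(3)[OF Q, of Y] W by metis
  have "Q ** Y = 0"
  proof -
    have "Q ** Y = Q ** ((mat 1 - Q) ** Y ** Q)" using Y by (simp add: offdiag_def)
    also have "\<dots> = 0" by (simp add: mm_simps q)
    finally show ?thesis .
  qed
  moreover have "Q ** Y' = 0"
  proof -
    have "Q ** Y' = Q ** ((mat 1 - Q) ** Y' ** Q)" using Y by (simp add: offdiag_def)
    also have "\<dots> = 0" by (simp add: mm_simps q)
    finally show ?thesis .
  qed
  ultimately have QX: "Q ** X = 0" by (simp add: X_def mm.diff_right)
  have "Q ** (chart Q Y ** X) = Q ** L ** X"
    using \<open>Q ** Y = 0\<close> by (simp add: L matrix_mul_assoc mm.add_right mm.add_left q)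
  then have QLX: "Q ** L ** X = 0" by (simp add: cX QX)
  have "Y ** Q = Y"
  proof -
    have "Y ** Q = ((mat 1 - Q) ** Y ** Q) ** Q" using Y by (simp add: offdiag_def)
    also have "\<dots> = (mat 1 - Q) ** Y ** Q" by (rule mm_absorb[OF q])
    finally show ?thesis using Y by (simp add: offdiag_def)
  qed
  then have "(Q + Y) ** L ** X = (Q + Y) ** (Q ** L ** X)"
    by (simp add: matrix_mul_assoc mm.add_left q)
  then have "chart Q Y ** X = 0" by (simp add: L QLX)
  then show "Y = Y'" using cX by (simp add: X_def)
qed

lemma differentiable_imp_pointwise_lipschitz:
  fixes f :: "'a::euclidean_space \<Rightarrow> 'b::euclidean_space"
  assumes "\<And>x. x \<in> S \<Longrightarrow> f differentiable (at x)"
  shows "pointwise_lipschitz_on S f"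
  unfolding pointwise_lipschitz_on_def
proof
  fix x assume "x \<in> S"
  then obtain f' where f': "(f has_derivative f') (at x)" using assms unfolding differentiable_def by blast
  then have bl: "bounded_linear f'"
    and alt: "\<forall>e>0. \<exists>d>0. \<forall>y. norm (y - x) < d \<longrightarrow> norm (f y - f x - f' (y - x)) \<le> e * norm (y - x)"
    unfolding has_derivative_at_alt by blast+
  obtain d where d: "d > 0" "\<And>y. norm (y - x) < d \<Longrightarrow> norm (f y - f x - f' (y - x)) \<le> 1 * norm (y - x)"
    using alt zero_less_one by blast
  obtain B where B: "\<And>v. norm (f' v) \<le> norm v * B" using bounded_linear.bounded[OF bl] by blast
  have "norm (f y - f x) \<le> (B + 1) * norm (y - x)" if "dist y x < d" for y
  proof -
    have "norm (f y - f x) \<le> norm (f' (y - x)) + norm (f y - f x - f' (y - x))"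
      by (rule norm_triangle_sub)
    also have "\<dots> \<le> norm (y - x) * B + 1 * norm (y - x)"
      using B[of "y - x"] d(2)[of y] that by (intro add_mono) (auto simp: dist_norm)
    finally show ?thesis by (simp add: algebra_simps)
  qed
  then show "\<exists>B d. d > 0 \<and> (\<forall>y\<in>S. dist y x < d \<longrightarrow> norm (f y - f x) \<le> B * norm (y - x))"
    using d(1) by blast
qed

text \<open>The slice subspace has at least the dimension of the Grassmannian, by invariance of
  domain, so \<open>dnull\<close> applies to the slice chart.\<close>

lemma dnull_null_in_submanifold:
  fixes S :: "(complex^'N^'N) set" and P :: "complex^'N^'N"
  assumes P: "P \<in> projectors n" and S: "S \<subseteq> projectors n" "dnull (dim (offdiag P)) S"
  shows "null_in_submanifold (projectors n) S"
  unfolding null_in_submanifold_def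
proof (intro allI impI)
  fix V W and \<phi> :: "complex^'N^'N \<Rightarrow> complex^'N^'N"
  assume sc: "slice_chart (projectors n) V W \<phi>"
  have V: "subspace V" and W: "open W" and inj: "inj_on \<phi> W" and smooth: "smooth_on W \<phi>"
    and flat: "\<phi> ` (W \<inter> projectors n) = \<phi> ` W \<inter> V"
    using sc unfolding slice_chart_def by blast+
  have diff: "\<phi> differentiable (at x)" if "x \<in> W" for x
  proof -
    have "Ck_on (Suc 0) W \<phi>" using smooth unfolding smooth_on_def by blast
    then show ?thesis using that by simp
  qed
  show "AE y in subspace_lborel V. y \<notin> \<phi> ` (W \<inter> S)"
  proof (cases "W \<inter> S = {}")
    case False
    then obtain Q where Q: "Q \<in> W" "Q \<in> projectors n" using S(1) by blast
    let ?T = "offdiag Q \<inter> chart Q -` W"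
    have "dim (offdiag Q) \<le> dim V"
    proof (rule invariance_of_dimension_subspaces)
      show "openin (top_of_set (offdiag Q)) ?T"
        by (intro openin_open_Int open_vimage W continuous_on_chart[OF Q(2)])
      show "continuous_on ?T (\<phi> \<circ> chart Q)"
      proof (rule continuous_on_compose)
        show "continuous_on ?T (chart Q)" by (rule continuous_on_subset[OF continuous_on_chart[OF Q(2)]]) simp
        have "continuous_on W \<phi>"
          using diff differentiable_imp_continuous_within by (intro continuous_at_imp_continuous_on) blast
        then show "continuous_on (chart Q ` ?T) \<phi>" by (rule continuous_on_subset) auto
      qed
      show "\<phi> \<circ> chart Q \<in> ?T \<rightarrow> V"
        using flat chart_props(1)[OF Q(2)] by auto
      show "inj_on (\<phi> \<circ> chart Q) ?T"
      proof (rule comp_inj_on)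
        show "inj_on (chart Q) ?T" by (rule inj_on_subset[OF chart_inj[OF Q(2)]]) simp
        show "inj_on \<phi> (chart Q ` ?T)" by (rule inj_on_subset[OF inj]) auto
      qed
      have "0 \<in> ?T" using Q(1) chart_0[OF Q(2)] by (simp add: offdiag_def)
      then show "?T \<noteq> {}" by blast
    qed (rule subspace_offdiag V)+
    then have d: "dim (offdiag P) \<le> dim V" using dim_offdiag_eq[OF P Q(2)] by simp
    let ?N = "{\<phi> x + w | x w. x \<in> W \<inter> S \<and> w \<in> perp V}"
    have "negligible ?N"
    proof (rule S(2)[unfolded dnull_def, rule_format])
      show "W \<inter> S \<subseteq> S" "subspace V" "dim (offdiag P) \<le> dim V" by (simp_all add: V d)
      show "\<phi> ` (W \<inter> S) \<subseteq> V" using flat S(1) by blast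
      show "pointwise_lipschitz_on (W \<inter> S) \<phi>"
        by (rule differentiable_imp_pointwise_lipschitz) (use diff in blast)
    qed
    then have ae: "AE y in subspace_lborel V. y \<in> V \<and> y \<notin> ?N"
    proof (rule AE_subspace_lborel[OF V])
      fix x w assume "x \<in> ?N" and w: "w \<in> perp V"
      then obtain u v where uv: "x = \<phi> u + v" "u \<in> W \<inter> S" "v \<in> perp V" by blast
      have "v + w \<in> perp V" using uv(3) w by (simp add: perp_def inner_add_left)
      moreover have "x + w = \<phi> u + (v + w)" using uv(1) by simp
      ultimately show "x + w \<in> ?N" using uv(2) by blast
    qed
    have "\<phi> ` (W \<inter> S) \<subseteq> ?N"
    proof clarify
      fix x assume "x \<in> W" "x \<in> S"
      moreover have "(0 :: complex^'N^'N) \<in> perp V" by (simp add: perp_def)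
      ultimately show "\<exists>x' w. \<phi> x = \<phi> x' + w \<and> x' \<in> W \<inter> S \<and> w \<in> perp V"
        by (intro exI[of _ x] exI[of _ 0]) auto
    qed
    then have "y \<notin> \<phi> ` (W \<inter> S)" if "y \<notin> ?N" for y using that by blast
    then show ?thesis by (intro eventually_mono[OF ae]) blast
  qed simp
qed

section \<open>Orbits trapped near a saddle and preimages of null sets\<close>

context scf
begin

lemma J_bound: obtains C where "C > 0" "\<And>X. J ((mat 1 - P) ** X ** P) \<le> C * (norm X)\<^sup>2" "\<And>X. \<bar>J X\<bar> \<le> C * (norm X)\<^sup>2"
proof -
  let ?f = "\<lambda>X. K ** X - X ** K" and ?p = "\<lambda>X. (mat 1 - P) ** X ** P"
  have lf: "linear ?f" by (rule linearI) (simp_all add: mm_simps scaleR_diff_right)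
  have lp: "linear ?p" by (rule linearI) (simp_all add: mm.add_right mm.add_left mm.scaleR_right mm.scaleR_left)
  obtain a where a: "a > 0" "\<And>X. norm (?f X) \<le> a * norm X" using linear_bounded_pos[OF lf] by blast
  obtain b where b: "b > 0" "\<And>X. norm (?p X) \<le> b * norm X" using linear_bounded_pos[OF lp] by blast
  have J: "\<bar>J X\<bar> \<le> a * (norm X)\<^sup>2" for X
  proof -
    have "\<bar>J X\<bar> \<le> norm X * norm (?f X)" unfolding J_def using Cauchy_Schwarz_ineq2[of X "?f X"] by simp
    also have "\<dots> \<le> norm X * (a * norm X)" by (intro mult_left_mono a) simp
    finally show ?thesis by (simp add: power2_eq_square mult_ac)
  qed
  have "J (?p X) \<le> a * b\<^sup>2 * (norm X)\<^sup>2" for X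
  proof -
    have "J (?p X) \<le> a * (norm (?p X))\<^sup>2" using J[of "?p X"] by linarith
    also have "\<dots> \<le> a * (b * norm X)\<^sup>2" using a b by (intro mult_left_mono power_mono) auto
    finally show ?thesis by (simp add: power_mult_distrib mult_ac)
  qed
  then have 1: "J (?p X) \<le> (a * b\<^sup>2 + a) * (norm X)\<^sup>2" for X
    using order_trans[OF _ mult_right_mono[of "a * b\<^sup>2" "a * b\<^sup>2 + a" "(norm X)\<^sup>2"]] a(1) by simp
  have 2: "\<bar>J X\<bar> \<le> (a * b\<^sup>2 + a) * (norm X)\<^sup>2" for X
    by (rule order_trans[OF J mult_right_mono]) (use a b in simp_all)
  have "a * b\<^sup>2 + a > 0" using a b by (simp add: add_nonneg_pos)
  with 1 2 show thesis by (rule that[rotated])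
qed

text \<open>Two distinct orbits cannot both stay near a saddle if their difference lies in the cone
  where \<open>J\<close> is not too negative: \<open>J\<close> of the difference would grow without bound.\<close>

lemma saddle_cone:
  assumes P: "P \<in> D" and com: "K ** P = P ** K" and g: "ground_projector n (H P) P"
    and nd: "\<And>Y. (mat 1 - P) ** Y ** P = Y \<Longrightarrow> K ** Y = Y ** K \<Longrightarrow> Y = 0"
    and F: "\<And>Q. Q \<in> D \<Longrightarrow> ground_projector n (H Q) (F Q)"
  shows "\<exists>c>0. \<forall>Q\<in>D. \<forall>R\<in>D. (\<forall>k. norm ((F ^^ k) Q - P) < c) \<longrightarrow> (\<forall>k. norm ((F ^^ k) R - P) < c) \<longrightarrow>
    J ((mat 1 - P) ** (R - Q) ** P) \<le> - c * (norm (R - Q))\<^sup>2"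
proof -
  let ?p = "\<lambda>X. (mat 1 - P) ** X ** P"
  have "\<exists>c>0. \<forall>Q\<in>D. \<forall>R\<in>D. \<forall>Q'\<in>D. \<forall>R'\<in>D. norm (Q - P) < c \<longrightarrow> norm (R - P) < c \<longrightarrow>
    norm (Q' - P) < c \<longrightarrow> norm (R' - P) < c \<longrightarrow>
    H Q ** Q' = Q' ** H Q \<longrightarrow> H R ** R' = R' ** H R \<longrightarrow>
    J (?p (R - Q)) + c * ((norm (R - Q))\<^sup>2 + (norm (R' - Q'))\<^sup>2) \<le> J (?p (R' - Q'))"
    by (rule J_increase[OF P com g nd])
  then obtain c where c: "c > 0" "\<And>Q R Q' R'. Q \<in> D \<Longrightarrow> R \<in> D \<Longrightarrow> Q' \<in> D \<Longrightarrow> R' \<in> D \<Longrightarrow>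
    norm (Q - P) < c \<Longrightarrow> norm (R - P) < c \<Longrightarrow> norm (Q' - P) < c \<Longrightarrow> norm (R' - P) < c \<Longrightarrow>
    H Q ** Q' = Q' ** H Q \<Longrightarrow> H R ** R' = R' ** H R \<Longrightarrow>
    J (?p (R - Q)) + c * ((norm (R - Q))\<^sup>2 + (norm (R' - Q'))\<^sup>2) \<le> J (?p (R' - Q'))" by blast
  obtain C where C: "C > 0" "\<And>X. J (?p X) \<le> C * (norm X)\<^sup>2" by (rule J_bound) blast
  have "J (?p (R - Q)) \<le> - c * (norm (R - Q))\<^sup>2"
    if Q: "Q \<in> D" "\<And>k. norm ((F ^^ k) Q - P) < c" and R: "R \<in> D" "\<And>k. norm ((F ^^ k) R - P) < c" for Q R
  proof (rule ccontr)
    assume neg: "\<not> ?thesis"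
    have QD: "(F ^^ k) Q \<in> D" for k by (induction k) (use Q F in \<open>auto simp: ground_projector_def\<close>)
    have RD: "(F ^^ k) R \<in> D" for k by (induction k) (use R F in \<open>auto simp: ground_projector_def\<close>)
    define d where "d k = (F ^^ k) R - (F ^^ k) Q" for k
    have inc: "J (?p (d k)) + c * ((norm (d k))\<^sup>2 + (norm (d (Suc k)))\<^sup>2) \<le> J (?p (d (Suc k)))" for k
      unfolding d_def
    proof (rule c(2)[OF QD RD QD RD Q(2) R(2) Q(2) R(2)])
      show "H ((F ^^ k) Q) ** (F ^^ Suc k) Q = (F ^^ Suc k) Q ** H ((F ^^ k) Q)"
        "H ((F ^^ k) R) ** (F ^^ Suc k) R = (F ^^ Suc k) R ** H ((F ^^ k) R)"
        using F[OF QD[of k]] F[OF RD[of k]] by (simp_all add: ground_projector_def)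
    qed
    \<comment> \<open>\<open>j\<close> measures the initial failure of the cone inequality. Once
      \<open>J\<close> is at least \<open>j\<close>, the difference has squared norm at least
      \<open>j / C\<close>, so each further step adds at least \<open>c * (j / C)\<close>, while
      staying near \<open>P\<close> keeps \<open>J\<close> bounded.\<close>
    define j where "j = J (?p (d 0)) + c * (norm (d 0))\<^sup>2"
    have j: "j > 0" using neg by (simp add: j_def d_def)
    have grow: "j + real k * (c * (j / C)) \<le> J (?p (d (Suc k)))" for k
    proof (induction k)
      case 0
      have "0 \<le> c * (norm (d (Suc 0)))\<^sup>2" using c(1) by simp
      then show ?case using inc[of 0] by (simp add: j_def distrib_left)
    next
      case (Suc k)
      have "0 \<le> real k * (c * (j / C))" using c(1) C(1) j by simp
      then have "j \<le> J (?p (d (Suc k)))" using Suc.IH by linarith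
      also have "\<dots> \<le> C * (norm (d (Suc k)))\<^sup>2" by (rule C(2))
      finally have "j / C \<le> (norm (d (Suc k)))\<^sup>2" using C(1) by (simp add: pos_divide_le_eq mult.commute)
      then have "c * (j / C) \<le> c * (norm (d (Suc k)))\<^sup>2" using c(1) by (intro mult_left_mono) auto
      moreover have "0 \<le> c * (norm (d (Suc (Suc k))))\<^sup>2" using c(1) by simp
      ultimately have "J (?p (d (Suc k))) + c * (j / C) \<le> J (?p (d (Suc (Suc k))))"
        using inc[of "Suc k"] by (simp add: distrib_left)
      moreover have "real (Suc k) * (c * (j / C)) = real k * (c * (j / C)) + c * (j / C)"
        by (simp only: of_nat_Suc distrib_right)
      ultimately show ?case using Suc.IH by linarith
    qed
    have "norm (d k) \<le> 2 * c" for k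
      using norm_triangle_ineq4[of "(F ^^ k) R - P" "(F ^^ k) Q - P"] Q(2)[of k] R(2)[of k] by (simp add: d_def)
    then have Jb: "J (?p (d k)) \<le> C * (2 * c)\<^sup>2" for k
      using C(1) by (intro order_trans[OF C(2)] mult_left_mono power_mono) auto
    have bd: "real k * (c * (j / C)) \<le> C * (2 * c)\<^sup>2" for k
      using grow[of k] Jb[of "Suc k"] j by linarith
    have "c * (j / C) > 0" using c(1) C(1) j by simp
    then obtain k where "C * (2 * c)\<^sup>2 < real k * (c * (j / C))" using reals_Archimedean3 by blast
    then show False using bd[of k] by simp
  qed
  then show ?thesis using c(1) by blast
qed

text \<open>Along the normalised descent direction \<open>e'\<close> the form \<open>J\<close> is
  positive, so the cone inequality bounds the \<open>e'\<close>-component of a difference by the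
  remaining components. Forgetting that component by \<open>q\<close> is therefore bounded below on
  the trapped points, and \<open>dnull_lipschitz_graph\<close> applies.\<close>

lemma saddle_dnull:
  assumes P: "P \<in> D" and com: "K ** P = P ** K" and g: "ground_projector n (H P) P"
    and nd: "\<And>Y. (mat 1 - P) ** Y ** P = Y \<Longrightarrow> K ** Y = Y ** K \<Longrightarrow> Y = 0"
    and F: "\<And>Q. Q \<in> D \<Longrightarrow> ground_projector n (H Q) (F Q)"
    and e: "(mat 1 - P) ** e0 ** P = e0" "inner e0 (K ** e0 - e0 ** K) < 0"
  shows "\<exists>r>0. dnull (dim (offdiag P)) {Q \<in> D. \<forall>k. norm ((F ^^ k) Q - P) < r}"
proof -
  let ?p = "\<lambda>X. (mat 1 - P) ** X ** P"
  have "\<exists>c>0. \<forall>Q\<in>D. \<forall>R\<in>D. (\<forall>k. norm ((F ^^ k) Q - P) < c) \<longrightarrow> (\<forall>k. norm ((F ^^ k) R - P) < c) \<longrightarrow>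
    J (?p (R - Q)) \<le> - c * (norm (R - Q))\<^sup>2"
    by (rule saddle_cone[OF P com g nd F])
  then obtain c1 where c1: "c1 > 0" "\<And>Q R. Q \<in> D \<Longrightarrow> R \<in> D \<Longrightarrow> (\<And>k. norm ((F ^^ k) Q - P) < c1) \<Longrightarrow>
    (\<And>k. norm ((F ^^ k) R - P) < c1) \<Longrightarrow> J (?p (R - Q)) \<le> - c1 * (norm (R - Q))\<^sup>2" by blast
  obtain c2 where c2: "c2 > 0" "\<And>Q R. Q \<in> D \<Longrightarrow> R \<in> D \<Longrightarrow> norm (Q - P) < c2 \<Longrightarrow> norm (R - P) < c2 \<Longrightarrow>
    c2 * norm (R - Q) \<le> norm (?p (R - Q))" using offdiag_bound[OF P] by blast
  define r where "r = min c1 c2"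
  have r: "r > 0" "r \<le> c1" "r \<le> c2" using c1 c2 by (auto simp: r_def)
  let ?S = "{Q \<in> D. \<forall>k. norm ((F ^^ k) Q - P) < r}"
  have e0: "e0 \<noteq> 0" using e(2) by auto
  define e' where "e' = (1 / norm e0) *\<^sub>R e0"
  have ne: "norm e' = 1" using e0 by (simp add: e'_def)
  have pe: "?p e' = e'" by (simp add: e'_def mm.scaleR_left mm.scaleR_right e(1))
  have "J e0 > 0" using e(2) by (simp add: J_def)
  then have Je: "J e' > 0" using e0 by (simp add: e'_def J_scaleR)
  define q where "q Q = ?p Q - inner e' (?p Q) *\<^sub>R e'" for Q
  obtain b where b: "b > 0" "\<And>X. \<bar>J X\<bar> \<le> b * (norm X)\<^sup>2" by (rule J_bound) blast
  define a where "a = norm (K ** e' - e' ** K)"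
  \<comment> \<open>In \<open>J (t *\<^sub>R e' + w)\<close> the mixed term is controlled by
    \<open>a\<close> and \<open>J w\<close> by \<open>b\<close>; \<open>m\<close> is chosen so that
    \<open>m * J e'\<close> exceeds \<open>2 * a + b\<close>. The summand 1 gives strictness and
    \<open>m \<ge> 1\<close>.\<close>
  define m where "m = (2 * a + b) / J e' + 1"
  have m1: "m \<ge> 1" using Je b(1) by (simp add: m_def a_def)
  have "(2 * a + b) / J e' * J e' = 2 * a + b" using Je by (metis less_irrefl nonzero_divide_eq_eq)
  then have m2: "2 * a + b < m * J e'" using Je unfolding m_def distrib_right by linarith
  have tw: "\<bar>t\<bar> \<le> m * norm w" if le: "J (t *\<^sub>R e' + w) \<le> 0" for t w
  proof (rule ccontr)
    assume "\<not> ?thesis"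
    then have t: "m * norm w < \<bar>t\<bar>" by simp
    have "0 \<le> m * norm w" using m1 by simp
    then have t0: "\<bar>t\<bar> > 0" using t by linarith
    have "J (t *\<^sub>R e' + w) = t\<^sup>2 * J e' - 2 * t * inner w (K ** e' - e' ** K) + J w"
    proof -
      have "inner e' (K ** w - w ** K) = inner w (K ** e' - e' ** K)"
        using K_self_adjoint[of e' w] by (simp add: inner_commute)
      moreover have "J (t *\<^sub>R e' + w) = t\<^sup>2 * J e' - t * inner e' (K ** w - w ** K)
          - t * inner w (K ** e' - e' ** K) + J w"
        by (simp add: J_def mm.add_left mm.add_right mm.scaleR_left mm.scaleR_right inner_add_left inner_add_right
            inner_diff_right power2_eq_square algebra_simps)
      ultimately show ?thesis by simp
    qed
    then have "t\<^sup>2 * J e' \<le> 2 * t * inner w (K ** e' - e' ** K) - J w" using le by linarith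
    also have "\<dots> \<le> 2 * \<bar>t\<bar> * (norm w * a) + b * (norm w)\<^sup>2"
    proof -
      have "t * inner w (K ** e' - e' ** K) \<le> \<bar>t\<bar> * \<bar>inner w (K ** e' - e' ** K)\<bar>"
        by (metis abs_ge_self abs_mult)
      also have "\<dots> \<le> \<bar>t\<bar> * (norm w * a)"
        unfolding a_def by (intro mult_left_mono Cauchy_Schwarz_ineq2) simp
      finally show ?thesis using b(2)[of w] by linarith
    qed
    finally have 1: "t\<^sup>2 * J e' \<le> 2 * \<bar>t\<bar> * (norm w * a) + b * (norm w)\<^sup>2" .
    have "m * (t\<^sup>2 * J e') \<le> m * (2 * \<bar>t\<bar> * (norm w * a) + b * (norm w)\<^sup>2)" using 1 m1 by (intro mult_left_mono) auto
    also have "\<dots> = 2 * a * \<bar>t\<bar> * (m * norm w) + b * norm w * (m * norm w)" by (simp add: power2_eq_square algebra_simps)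
    also have "\<dots> \<le> 2 * a * \<bar>t\<bar> * \<bar>t\<bar> + b * \<bar>t\<bar> * \<bar>t\<bar>"
    proof (intro add_mono mult_mono)
      have "norm w \<le> m * norm w" using m1 by (simp add: mult_le_cancel_right1)
      then show "norm w \<le> \<bar>t\<bar>" using t by linarith
    qed (use t b m1 in \<open>auto simp: a_def\<close>)
    also have "\<dots> = (2 * a + b) * t\<^sup>2" by (simp add: power2_eq_square algebra_simps)
    also have "\<dots> < m * J e' * t\<^sup>2" using m2 t0 by (intro mult_strict_right_mono) auto
    finally show False by (simp add: mult_ac)
  qed
  have "dnull (dim (offdiag P)) ?S"
  proof (rule dnull_lipschitz_graph[OF subspace_offdiag refl])
    show "e' \<in> offdiag P" using pe by (simp add: offdiag_def)
    show "e' \<noteq> 0" using ne by auto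
    show "q x \<in> offdiag P" for x
      unfolding q_def using \<open>e' \<in> offdiag P\<close>
      by (intro subspace_diff subspace_offdiag subspace_scale offdiag_proj projectors_idem[OF P])
    show "inner e' (q x) = 0" for x
      using ne by (simp add: q_def inner_diff_right dot_square_norm)
    fix Q R assume Q: "Q \<in> ?S" and R: "R \<in> ?S"
    let ?X = "?p (R - Q)"
    define t where "t = inner e' ?X"
    define w where "w = q R - q Q"
    have X: "?X = t *\<^sub>R e' + w"
      by (simp add: t_def w_def q_def mm.diff_right mm.diff_left inner_diff_right scaleR_diff_left)
    have "J ?X \<le> - c1 * (norm (R - Q))\<^sup>2"
      using Q R r by (intro c1(2)) (auto intro: less_le_trans)
    also have "\<dots> \<le> 0" using c1(1) by simp
    finally have "\<bar>t\<bar> \<le> m * norm w" unfolding X by (rule tw)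
    moreover have "norm ?X \<le> \<bar>t\<bar> + norm w"
      unfolding X using norm_triangle_ineq[of "t *\<^sub>R e'" w] ne by simp
    moreover have "c2 * norm (R - Q) \<le> norm ?X"
    proof (rule c2(2))
      show "Q \<in> D" "R \<in> D" using Q R by auto
      have "norm ((F ^^ 0) Q - P) < r" "norm ((F ^^ 0) R - P) < r" using Q R by blast+
      then show "norm (Q - P) < c2" "norm (R - P) < c2" using r(3) by simp_all
    qed
    ultimately have "c2 * norm (R - Q) \<le> (m + 1) * norm w" by (simp add: distrib_right)
    then show "norm (R - Q) \<le> ((m + 1) / c2) * norm (q R - q Q)"
      using c2(1) by (simp add: w_def[symmetric] pos_le_divide_eq mult.commute)
  qed
  then show ?thesis using r(1) by blast
qed

text \<open>At each step the degenerate points are moved into the null set assumed in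
  \<open>N\<close>; at all other points a single step is bounded below, so
  \<open>dnull_preimage\<close> applies.\<close>

lemma preimage_dnull:
  assumes F: "\<And>Q. Q \<in> D \<Longrightarrow> ground_projector n (H Q) (F Q)"
    and N: "dnull d {Q \<in> D. degenerate n M (H Q) Q}" and X: "dnull d X"
  shows "dnull d {Q \<in> D. (F ^^ k) Q \<in> X}"
proof (induction k)
  case 0
  show ?case by (rule dnull_subset[OF X]) auto
next
  case (Suc k)
  let ?N = "{Q \<in> D. degenerate n M (H Q) Q}"
  let ?T = "{Q \<in> D. \<not> degenerate n M (H Q) Q \<and> (F ^^ Suc k) Q \<in> X}"
  have "dnull d ?T"
  proof (rule dnull_preimage[OF Suc.IH])
    show "F ` ?T \<subseteq> {Q \<in> D. (F ^^ k) Q \<in> X}"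
      using F by (auto simp: ground_projector_def funpow_swap1)
    fix P assume P: "P \<in> ?T"
    have U: "F P \<in> D" "H P ** F P = F P ** H P" using F P by (auto simp: ground_projector_def)
    have "ncdet P (F P) (E P) \<noteq> 0" using P U unfolding degenerate_def by blast
    then have nc: "noncritical P (F P) (E P)" by (rule ncdet_noncritical)
    have "P \<in> D" using P by blast
    from lower_Lipschitz_step[OF this U nc] obtain c where c: "c > 0"
      "\<And>R V. R \<in> D \<Longrightarrow> V \<in> D \<Longrightarrow> norm (R - P) < c \<Longrightarrow> H R ** V = V ** H R \<Longrightarrow> c * norm (R - P) \<le> norm (V - F P)"
      by blast
    have "c * norm (R - P) \<le> norm (F R - F P)" if "R \<in> ?T" "norm (R - P) < c" for R
      using that F[of R] by (intro c(2)) (auto simp: ground_projector_def)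
    then show "\<exists>c>0. \<forall>R\<in>?T. norm (R - P) < c \<longrightarrow> c * norm (R - P) \<le> norm (F R - F P)"
      using c(1) by blast
  qed
  then have "dnull d (?N \<union> ?T)" using N by (intro dnull_Un)
  then show ?case by (rule dnull_subset) blast
qed

lemma degenerate_dnull:
  assumes P: "P \<in> D"
    and nb: "\<And>Q. Q \<in> \<Q> \<Longrightarrow> negligible {Y. degenerate n M (H (chart Q Y)) (chart Q Y)}"
    and \<Q>: "finite \<Q>" "\<Q> \<subseteq> D" "D \<subseteq> (\<Union>Q\<in>\<Q>. ball Q \<rho>)"
    and \<rho>: "\<And>P Q. P \<in> D \<Longrightarrow> Q \<in> D \<Longrightarrow> norm (P - Q) < \<rho> \<Longrightarrow> \<exists>Y. P = chart Q Y"
  shows "dnull (dim (offdiag P)) {Q \<in> D. degenerate n M (H Q) Q}"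
proof -
  let ?Z = "\<lambda>Q. {Y \<in> offdiag Q. degenerate n M (H (chart Q Y)) (chart Q Y)}"
  have "dnull (dim (offdiag P)) (\<Union> ((\<lambda>Q. chart Q ` ?Z Q) ` \<Q>))"
  proof (rule dnull_Union_finite)
    show "finite ((\<lambda>Q. chart Q ` ?Z Q) ` \<Q>)" using \<Q>(1) by simp
    fix X assume "X \<in> (\<lambda>Q. chart Q ` ?Z Q) ` \<Q>"
    then obtain Q where X: "X = chart Q ` ?Z Q" and Q: "Q \<in> \<Q>" by blast
    then have QD: "Q \<in> D" using \<Q>(2) by blast
    note q = projectors_ct[OF QD] projectors_idem[OF QD]
    show "dnull (dim (offdiag P)) X"
      unfolding X
    proof (rule dnull_image_cylinder[OF subspace_offdiag dim_offdiag_eq[OF P QD]])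
      show "?Z Q \<subseteq> offdiag Q" by blast
      show "pointwise_lipschitz_on (?Z Q) (chart Q)" by (rule pointwise_lipschitz_chart[OF QD])
      show "negligible {z + w | z w. z \<in> ?Z Q \<and> w \<in> perp (offdiag Q)}"
      proof (rule negligible_subset[OF nb[OF Q]], clarify)
        fix z w assume z: "z \<in> offdiag Q" "degenerate n M (H (chart Q z)) (chart Q z)"
          and w: "w \<in> perp (offdiag Q)"
        \<comment> \<open>The chart sees only the off-diagonal block, which \<open>w\<close> does
          not change. The cylinder over the slice thus lies in the set of all degenerate
          coordinates, which is negligible in the full matrix space.\<close>
        have "(mat 1 - Q) ** (z + w) ** Q = (mat 1 - Q) ** z ** Q"
          using perp_offdiag[OF q w] by (simp only: mm.add_right mm.add_left add_0_right)
        then have "chart Q (z + w) = chart Q z" unfolding chart_def chartW_def by simp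
        then show "degenerate n M (H (chart Q (z + w))) (chart Q (z + w))" using z(2) by simp
      qed
    qed
  qed
  moreover have "{Q \<in> D. degenerate n M (H Q) Q} \<subseteq> (\<Union> ((\<lambda>Q. chart Q ` ?Z Q) ` \<Q>))"
  proof clarify
    fix R assume R: "R \<in> D" "degenerate n M (H R) R"
    obtain Q where Q: "Q \<in> \<Q>" "R \<in> ball Q \<rho>" using R(1) \<Q>(3) by blast
    have QD: "Q \<in> D" using Q(1) \<Q>(2) by blast
    have "norm (R - Q) < \<rho>" using Q(2) by (simp add: dist_norm norm_minus_commute)
    then obtain Y where Y: "R = chart Q Y" using \<rho>[OF R(1) QD] by blast
    let ?Y = "(mat 1 - Q) ** Y ** Q"
    have "R = chart Q ?Y" using Y chart_offdiag[OF QD] by simp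
    moreover have "?Y \<in> offdiag Q" by (rule offdiag_proj[OF projectors_idem[OF QD]])
    ultimately have "R \<in> chart Q ` ?Z Q" using R(2) by blast
    then show "R \<in> (\<Union> ((\<lambda>Q. chart Q ` ?Z Q) ` \<Q>))" using Q(1) by blast
  qed
  ultimately show ?thesis by (rule dnull_subset)
qed

text \<open>An orbit that does not converge to \<open>P\<close> converges to another commuting
  projector \<open>L\<close>, so some iterate starts an orbit staying within \<open>r L\<close> of
  \<open>L\<close>. Finitely many \<open>L\<close> and countably many iterates leave a countable
  union of null preimages.\<close>

lemma orbits_converge_almost_everywhere:
  assumes simple: "inj_on (eigval K) {1..CARD('N)}" and n: "n \<le> CARD('N)"
    and w: "orthonormal_on w {1..CARD('N)}"
      "\<And>i. i \<in> {1..CARD('N)} \<Longrightarrow> K *v w i = of_real (eigval K i) *s w i"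
      "\<And>i j. 1 \<le> i \<Longrightarrow> i \<le> j \<Longrightarrow> j \<le> CARD('N) \<Longrightarrow> eigval K i \<le> eigval K j"
    and P: "P = (\<Sum>i\<in>{1..n}. outer (w i) (w i))"
    and F: "\<And>Q. Q \<in> D \<Longrightarrow> ground_projector n (H Q) (F Q)"
    and N: "dnull d {Q \<in> D. degenerate n M (H Q) Q}" and d: "\<And>Q. Q \<in> D \<Longrightarrow> dim (offdiag Q) = d"
  shows "dnull d {Q \<in> D. \<not> (\<lambda>k. (F ^^ k) Q) \<longlonglongrightarrow> P}"
proof -
  have K: "hermitian K" by (simp add: hermitian_def ctK)
  define \<L> where "\<L> = {L \<in> D. K ** L = L ** K \<and> ground_projector n (H L) L \<and> L \<noteq> P}"
  have fin: "finite {Q \<in> D. K ** Q = Q ** K}" by (rule finite_commuting_projectors[OF K simple])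
  have finL: "finite \<L>" by (rule finite_subset[OF _ fin]) (auto simp: \<L>_def)
  have "\<exists>r>0. dnull d {Q \<in> D. \<forall>k. norm ((F ^^ k) Q - L) < r}" if L: "L \<in> \<L>" for L
  proof -
    have L': "L \<in> D" "K ** L = L ** K" "ground_projector n (H L) L" "L \<noteq> P" using L by (auto simp: \<L>_def)
    obtain Y where Y: "(mat 1 - L) ** Y ** L = Y" "inner Y (K ** Y - Y ** K) < 0"
      using saddle_direction[OF w K simple n L'(1,2)] L'(4) P by blast
    have "\<exists>r>0. dnull (dim (offdiag L)) {Q \<in> D. \<forall>k. norm ((F ^^ k) Q - L) < r}"
      by (rule saddle_dnull[OF L'(1-3) simple_commuting_offdiag_zero[OF K simple L'(1,2)] F Y])
    then show ?thesis using d[OF L'(1)] by simp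
  qed
  then have "\<forall>L\<in>\<L>. \<exists>r. r > 0 \<and> dnull d {Q \<in> D. \<forall>k. norm ((F ^^ k) Q - L) < r}" by blast
  from bchoice[OF this] obtain r where
    "\<forall>L\<in>\<L>. r L > 0 \<and> dnull d {Q \<in> D. \<forall>k. norm ((F ^^ k) Q - L) < r L}" by blast
  then have r: "\<And>L. L \<in> \<L> \<Longrightarrow> r L > 0"
    "\<And>L. L \<in> \<L> \<Longrightarrow> dnull d {Q \<in> D. \<forall>k. norm ((F ^^ k) Q - L) < r L}" by blast+
  let ?S = "\<lambda>L. {Q \<in> D. \<forall>k. norm ((F ^^ k) Q - L) < r L}"
  have "dnull d (\<Union> ((\<lambda>L. \<Union>k. {Q \<in> D. (F ^^ k) Q \<in> ?S L}) ` \<L>))"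
  proof (rule dnull_Union_finite)
    show "finite ((\<lambda>L. \<Union>k. {Q \<in> D. (F ^^ k) Q \<in> ?S L}) ` \<L>)" using finL by simp
    fix X assume "X \<in> (\<lambda>L. \<Union>k. {Q \<in> D. (F ^^ k) Q \<in> ?S L}) ` \<L>"
    then obtain L where L: "L \<in> \<L>" "X = (\<Union>k. {Q \<in> D. (F ^^ k) Q \<in> ?S L})" by blast
    show "dnull d X" unfolding L(2) by (intro dnull_UN preimage_dnull[OF F N] r(2) L(1))
  qed
  moreover have "{Q \<in> D. \<not> (\<lambda>k. (F ^^ k) Q) \<longlonglongrightarrow> P} \<subseteq> (\<Union> ((\<lambda>L. \<Union>k. {Q \<in> D. (F ^^ k) Q \<in> ?S L}) ` \<L>))"
  proof clarify
    fix Q assume Q: "Q \<in> D" and nP: "\<not> (\<lambda>k. (F ^^ k) Q) \<longlonglongrightarrow> P"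
    have FD: "(F ^^ k) Q \<in> D" for k by (induction k) (use Q F in \<open>auto simp: ground_projector_def\<close>)
    have "\<exists>L\<in>D. K ** L = L ** K \<and> ground_projector n (H L) L \<and> (\<lambda>k. (F ^^ k) Q) \<longlonglongrightarrow> L"
    proof (rule orbit_converges[OF fin])
      show "(F ^^ 0) Q \<in> D" using Q by simp
      show "ground_projector n (H ((F ^^ k) Q)) ((F ^^ Suc k) Q)" if "(F ^^ k) Q \<in> D" for k
        using F[OF that] by simp
    qed
    then obtain L where L: "L \<in> D" "K ** L = L ** K" "ground_projector n (H L) L" "(\<lambda>k. (F ^^ k) Q) \<longlonglongrightarrow> L"
      by blast
    then have LL: "L \<in> \<L>" using nP by (auto simp: \<L>_def)
    obtain k0 where k0: "\<And>k. k \<ge> k0 \<Longrightarrow> dist ((F ^^ k) Q) L < r L"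
      using L(4) r(1)[OF LL] unfolding lim_sequentially by blast
    have "norm ((F ^^ k) ((F ^^ k0) Q) - L) < r L" for k
      using k0[of "k + k0"] by (simp add: dist_norm funpow_add)
    then have "(F ^^ k0) Q \<in> ?S L" using FD by blast
    then show "Q \<in> (\<Union> ((\<lambda>L. \<Union>k. {Q \<in> D. (F ^^ k) Q \<in> ?S L}) ` \<L>))" using Q LL by blast
  qed
  ultimately show ?thesis by (rule dnull_subset)
qed

end

text \<open>The orthogonal directions are pairs of skew-Hermitian matrices; testing against
  \<open>hpart A\<close> and \<open>hpart B\<close> themselves shows it.\<close>

lemma perp_hermitian_pair:
  fixes A B :: "complex^'N^'N"
  assumes "(A, B) \<in> perp ({A. hermitian A} \<times> {B. hermitian B})"
  shows "hpart A = 0" "hpart B = 0"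
proof -
  have h: "hermitian (hpart X)" for X :: "complex^'N^'N" by (simp add: hermitian_def ct_hpart)
  have z: "hpart X = 0" if "inner X (hpart X) = 0" for X :: "complex^'N^'N"
  proof -
    have "rtr (X ** hpart X) = rtr (ct (X ** hpart X))" by (simp add: rtr_ct)
    also have "\<dots> = rtr (hpart X ** ct X)" by (simp add: ct_mult ct_hpart)
    also have "\<dots> = rtr (ct X ** hpart X)" by (rule rtr_commute)
    finally have "inner (hpart X) (hpart X) = inner X (hpart X)"
      unfolding inner_rtr ct_hpart
      by (subst (1) hpart_def) (simp add: mm.scaleR_left mm.add_left rtr_scaleR rtr_add)
    then show ?thesis using that by simp
  qed
  have "(hpart A, 0) \<in> {A. hermitian A} \<times> {B. hermitian B}" "(0, hpart B) \<in> {A. hermitian A} \<times> {B. hermitian B}"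
    using h by (simp_all add: hermitian_def ct_zero)
  then have "inner (A, B) (hpart A, 0) = 0" "inner (A, B) (0, hpart B) = 0"
    using assms unfolding perp_def by blast+
  then show "hpart A = 0" "hpart B = 0" using z by simp_all
qed

text \<open>With the base point \<open>(H0, 0)\<close> the sum of the two components again runs
  through a line from \<open>H0\<close>, where the determinant is nonzero.\<close>

lemma negligible_krylov_sum:
  "negligible {x :: (complex^'N^'N) \<times> (complex^'N^'N). det (krylov (hpart (fst x + snd x))) = 0}"
proof -
  define H0 :: "complex^'N^'N" where "H0 = (\<chi> i j. if i = j then of_nat (idx i) else 0)"
  have h0: "hpart H0 = H0" by (rule hpart_id) (simp add: H0_def vec_eq_iff)
  have k0: "det (krylov H0) \<noteq> 0" unfolding H0_def by (rule krylov_diag)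
  show ?thesis
  proof (rule negligible_star[where ?x0.0 = "(H0, 0)"])
    have "closed {x :: (complex^'N^'N) \<times> (complex^'N^'N). det (krylov (hpart (fst x + snd x))) = 0}"
      by (intro closed_Collect_eq continuous_on_det continuous_on_krylov continuous_on_hpart continuous_on_add
          continuous_on_fst continuous_on_snd continuous_on_id continuous_on_const)
    then show "{x :: (complex^'N^'N) \<times> (complex^'N^'N). det (krylov (hpart (fst x + snd x))) = 0} \<in> sets borel" by simp
    fix x :: "(complex^'N^'N) \<times> (complex^'N^'N)"
    let ?l = "\<lambda>s. H0 + s *\<^sub>R (fst x - H0 + snd x)"
    have "rat (\<lambda>s. det (krylov (hpart (?l s))))"
      by (intro rat_det ratm_krylov ratm_hpart ratm_line)
    then have "finite {s. det (krylov (hpart (?l s))) = 0}"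
      by (rule rat_finite_zeros[of _ 0]) (simp add: h0 k0)
    moreover have "fst ((H0, 0) + s *\<^sub>R (x - (H0, 0))) + snd ((H0, 0) + s *\<^sub>R (x - (H0, 0))) = ?l s" for s
      by (simp add: algebra_simps)
    ultimately show "countable {s. (H0, 0) + s *\<^sub>R (x - (H0, 0)) \<in> {x. det (krylov (hpart (fst x + snd x))) = 0}}"
      by (simp only: mem_Collect_eq countable_finite)
  qed
qed

theorem theorem1p5:
  fixes n :: nat
  assumes "1 \<le> n" and "n < CARD('N::finite)"
  shows "AE (A, B) in subspace_lborel
           ({A :: complex^'N^'N. hermitian A} \<times> {B :: complex^'N^'N. hermitian B}).
         neg_def B \<longrightarrow>
         (\<exists>P. is_density_matrix n (A + B) P \<and>
              (\<forall>F. is_fixed_point_map n A B F \<longrightarrow>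
                   almost_every_on (projectors n)
                     (\<lambda>P0. (\<lambda>k. (F ^^ k) P0) \<longlonglongrightarrow> P)))"
proof -
  let ?D = "projectors n :: (complex^'N^'N) set"
  let ?V = "{A :: complex^'N^'N. hermitian A} \<times> {B :: complex^'N^'N. hermitian B}"
  obtain \<rho> where \<rho>: "\<rho> > 0" "\<And>(P :: complex^'N^'N) Q. P \<in> ?D \<Longrightarrow> Q \<in> ?D \<Longrightarrow> norm (P - Q) < \<rho> \<Longrightarrow> \<exists>Y. P = chart Q Y"
    by (rule chart_surj) blast
  have "?D \<subseteq> (\<Union>Q\<in>?D. ball Q \<rho>)" using \<rho>(1) by force
  then obtain \<Q> where \<Q>: "\<Q> \<subseteq> ?D" "finite \<Q>" "?D \<subseteq> (\<Union>Q\<in>\<Q>. ball Q \<rho>)"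
    using compactE_image[OF compact_projectors[of n], of ?D "\<lambda>Q. ball Q \<rho>"] by auto
  \<comment> \<open>\<open>T\<close> depends on the pair only through Hermitian parts, as
    \<open>AE_subspace_lborel\<close> demands, and stays null because the cover by charts is
    finite.\<close>
  define T where "T = {AB :: (complex^'N^'N) \<times> (complex^'N^'N). det (krylov (hpart (fst AB + snd AB))) = 0 \<or>
    (\<exists>Q\<in>\<Q>. \<not> (AE Y in lborel. (AB, Y) \<notin> bad n Q))}"
  have negT: "negligible T"
  proof (rule AE_imp_negligible)
    have "AE AB in lborel. \<forall>Q\<in>\<Q>. AE Y in lborel. (AB, Y) \<notin> bad n Q"
      by (rule AE_finite_allI[OF \<Q>(2)]) (use AE_bad \<Q>(1) in blast)
    moreover have "AE AB in lborel. AB \<notin> {x :: (complex^'N^'N) \<times> (complex^'N^'N). det (krylov (hpart (fst x + snd x))) = 0}"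
      by (rule negligible_imp_AE[OF negligible_krylov_sum])
    ultimately show "AE AB in lborel. AB \<notin> T"
      by eventually_elim (simp add: T_def)
  qed
  have subV: "subspace ?V"
    by (auto simp: subspace_def hermitian_def ct_add ct_scaleR ct_zero zero_prod_def)
  have invT: "x + w \<in> T" if x: "x \<in> T" and w: "w \<in> perp ?V" for x w
  proof -
    obtain A B where xe: "x = (A, B)" by (metis prod.exhaust)
    obtain A' B' where we: "w = (A', B')" by (metis prod.exhaust)
    have h0: "hpart A' = 0" "hpart B' = 0" using perp_hermitian_pair w unfolding we by blast+
    have 1: "hpart (A + A') = hpart A" "hpart (B + B') = hpart B" by (simp_all add: hpart_add h0)
    have 2: "hpart (A + A' + (B + B')) = hpart (A + B)" by (simp add: hpart_add h0)
    have 3: "((A + A', B + B'), Y) \<in> bad n Q \<longleftrightarrow> ((A, B), Y) \<in> bad n Q" for Y Q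
      by (simp add: bad_def 1)
    show ?thesis using x unfolding T_def xe we by (simp add: 2 3)
  qed
  have ae: "AE y in subspace_lborel ?V. y \<in> ?V \<and> y \<notin> T"
    by (rule AE_subspace_lborel[OF subV negT invT])
  have good: "neg_def B \<longrightarrow>
         (\<exists>P. is_density_matrix n (A + B) P \<and>
              (\<forall>F. is_fixed_point_map n A B F \<longrightarrow>
                   almost_every_on ?D (\<lambda>P0. (\<lambda>k. (F ^^ k) P0) \<longlonglongrightarrow> P)))"
    if AB: "(A, B) \<in> ?V" "(A, B) \<notin> T" for A B
  proof
    assume B: "neg_def B"
    define M where "M = - B"
    have M: "pos_def M" using B by (simp add: M_def neg_def_pos_def)
    have cA: "ct A = A" and cB: "ct B = B" using AB(1) by (simp_all add: hermitian_def)
    have hA: "hpart A = A" and hB: "hpart B = B" by (rule hpart_id, rule cA, rule hpart_id, rule cB)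
    interpret scf A M n by unfold_locales (rule cA, rule M)
    have KAB: "K = A + B" unfolding K_def by (simp add: M_def)
    have hK: "hermitian K" by (simp add: hermitian_def ctK)
    have "hpart (A + B) = K" unfolding KAB[symmetric] by (rule hpart_id[OF ctK])
    then have "det (krylov K) \<noteq> 0" using AB(2) by (simp add: T_def)
    then have simple: "inj_on (eigval K) {1..CARD('N)}" by (rule krylov_simple[OF hK])
    obtain w :: "nat \<Rightarrow> complex^'N" where w: "orthonormal_on w {1..CARD('N)}"
      "\<And>i. i \<in> {1..CARD('N)} \<Longrightarrow> K *v w i = of_real (eigval K i) *s w i"
      "\<And>i j. 1 \<le> i \<Longrightarrow> i \<le> j \<Longrightarrow> j \<le> CARD('N) \<Longrightarrow> eigval K i \<le> eigval K j"
      using hermitian_sorted_eigenbasis[OF hK] by metis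
    define P where "P = (\<Sum>i\<in>{1..n}. outer (w i) (w i))"
    have "eigval K n \<noteq> eigval K (n + 1)" using inj_onD[OF simple, of n "n + 1"] assms by auto
    then have gap: "eigval K n < eigval K (n + 1)" using w(3)[of n "n + 1"] assms by simp
    have dm: "is_density_matrix n (A + B) P"
      unfolding P_def KAB[symmetric] by (rule density_matrix_exists[OF hK assms gap w])
    have PD: "P \<in> ?D"
    proof -
      have "orthonormal_on w {1..n}" by (rule orthonormal_on_subset[OF w(1)]) (use assms in auto)
      from sum_outer_in_projectors[OF this] show ?thesis by (simp add: P_def)
    qed
    have "negligible {Y. degenerate n M (H (chart Q Y)) (chart Q Y)}" if "Q \<in> \<Q>" for Q
    proof -
      have "AE Y in lborel. ((A, B), Y) \<notin> bad n Q" using AB(2) that unfolding T_def by blast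
      then have "negligible {Y. ((A, B), Y) \<in> bad n Q}" by (intro AE_imp_negligible) simp
      moreover have "{Y. ((A, B), Y) \<in> bad n Q} = {Y. degenerate n M (H (chart Q Y)) (chart Q Y)}"
        using M unfolding H_def by (simp add: bad_def hA hB M_def[symmetric])
      ultimately show ?thesis by simp
    qed
    from degenerate_dnull[OF PD this \<Q>(2,1,3) \<rho>(2)]
    have N: "dnull (dim (offdiag P)) {Q \<in> ?D. degenerate n M (H Q) Q}" .
    have "almost_every_on ?D (\<lambda>P0. (\<lambda>k. (F ^^ k) P0) \<longlonglongrightarrow> P)" if fp: "is_fixed_point_map n A B F" for F
    proof -
      \<comment> \<open>Whatever eigenvectors \<open>F\<close> selects, its values are ground
        projectors; hence the exceptional set \<open>T\<close> could be fixed before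
        \<open>F\<close>.\<close>
      have F: "ground_projector n (H Q) (F Q)" if Q: "Q \<in> ?D" for Q
      proof -
        have eq: "A + adaptive_compression B Q = H Q"
          unfolding adaptive_compression_eq[OF B projectors_ct[OF Q] projectors_idem[OF Q]] H_def M_def[symmetric] by simp
        have "\<exists>u :: nat \<Rightarrow> complex^'N.
            (\<forall>i\<in>{1..n}. \<forall>j\<in>{1..n}. cdot (u i) (u j) = (if i = j then 1 else 0)) \<and>
            (\<forall>i\<in>{1..n}. u i \<in> eigenspace (H Q) (eigval (H Q) i)) \<and>
            F Q = (\<Sum>i\<in>{1..n}. outer (u i) (u i))"
          unfolding eq[symmetric] by (rule fp[unfolded is_fixed_point_map_def, rule_format, OF Q])
        then obtain u :: "nat \<Rightarrow> complex^'N" where u: "orthonormal_on u {1..n}"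
          "\<And>i. i \<in> {1..n} \<Longrightarrow> u i \<in> eigenspace (H Q) (eigval (H Q) i)"
          "F Q = (\<Sum>i\<in>{1..n}. outer (u i) (u i))"
          unfolding orthonormal_on_def by blast
        show ?thesis
          unfolding u(3)
        proof (rule ground_projector_sum_outer[OF _ assms(1) _ u(1)])
          show "hermitian (H Q)" using ct_H[OF Q] by (simp add: hermitian_def)
          show "n \<le> CARD('N)" using assms by simp
          show "H Q *v u i = of_real (eigval (H Q) i) *s u i" if "i \<in> {1..n}" for i
            using u(2)[OF that] by (simp add: eigenspace_def)
        qed
      qed
      have "dnull (dim (offdiag P)) {Q \<in> ?D. \<not> (\<lambda>k. (F ^^ k) Q) \<longlonglongrightarrow> P}"
        by (rule orbits_converge_almost_everywhere[OF simple less_imp_le[OF assms(2)] w P_def F N])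
          (assumption | rule dim_offdiag_eq[OF PD] | simp)+
      then show ?thesis
        unfolding almost_every_on_def by (intro dnull_null_in_submanifold[OF PD]) auto
    qed
    then show "\<exists>P. is_density_matrix n (A + B) P \<and>
              (\<forall>F. is_fixed_point_map n A B F \<longrightarrow>
                   almost_every_on ?D (\<lambda>P0. (\<lambda>k. (F ^^ k) P0) \<longlonglongrightarrow> P))"
      using dm by blast
  qed
  show ?thesis
  proof (rule AE_mp[OF ae], rule AE_I2, rule impI, clarify)
    fix A B
    assume "(A, B) \<notin> T" "hermitian A" "hermitian B" "neg_def B"
    then show "\<exists>P. is_density_matrix n (A + B) P \<and>
              (\<forall>F. is_fixed_point_map n A B F \<longrightarrow>
                   almost_every_on ?D (\<lambda>P0. (\<lambda>k. (F ^^ k) P0) \<longlonglongrightarrow> P))"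
      using good[of A B] by simp
  qed
qed

end
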